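(* Consider the Rician block-fading channel and codes defined in the context, with parameters $\ell\ge1$, $n_c\ge2$, $\epsilon\in(0,1)$, $\rho>0$, $\kappa\ge0$, and fix an integer $n_p$ with $1\le n_p\le n_c-1$; set $n_d=n_c-n_p$, $\sigma_e^2=1/(n_p\rho)$, $\sigma_p^2=\frac{\sigma_H^2\sigma_e^2}{\sigma_H^2+\sigma_e^2}$, and $\mu_p(\hat h)=\frac{\sigma_H^2\hat h+\sigma_e^2\mu_H}{\sigma_H^2+\sigma_e^2}$ for $\hat h\in\mathbb{C}$. Then \[ R^*\ \ge\ \max\Big\{\tfrac{\log_2M}{n_c\ell}:\ M\ge2\text{ integer},\ \epsilon^{(n_p)}_{\mathrm{ub}}(M)\le\epsilon\Big\}, \] where \[ \epsilon^{(n_p)}_{\mathrm{ub}}(M)=\mathbb{E}\Big[\exp\Big\{-\Big[\sum_{k=1}^\ell\bar S_k(\hat H_k)-\ln\tfrac{M-1}{2}\Big]^+\Big\}\Big]. \] Here $\hat H_1,\dots,\hat H_\ell$ are i.i.d. with $\hat H_k\sim\mathcal{CN}(\mu_H,\sigma_H^2+\sigma_e^2)$ (the distribution of $H_k+E_k$ with $E_k\sim\mathcal{CN}(0,\sigma_e^2)$ independent of $H_k$), and, conditionally on $\hat H_k=\hat h_k$ ($k=1,\dots,\ell$), the random variables $\bar S_1(\hat h_1),\dots,\bar S_\ell(\hat h_\ell)$ are independent, with $\bar S_k(\hat h_k)$ defined as the random variable $S_k$ of the context with block length $n_d$ in place of $n_c$, $\mu=\mu_p(\hat h_k)$ and $\sigma^2=\sigma_p^2$.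 The expectation is over both $\{\hat H_k\}$ and the $\{\bar S_k\}$.
   Context: Channel model: fix integers $\ell\ge1$ (number of coherence blocks) and $n_c\ge1$ (block length of each coherence block), a Rician factor $\kappa\ge0$, and $\rho>0$. Set $\mu_H=\sqrt{\kappa/(1+\kappa)}$ and $\sigma_H^2=1/(1+\kappa)$. The channel maps an input $(\mathbf{x}_1,\dots,\mathbf{x}_\ell)\in(\mathbb{C}^{n_c})^\ell$ to $\mathbf{Y}_k=H_k\mathbf{x}_k+\mathbf{W}_k$, $k=1,\dots,\ell$, where $H_k\sim\mathcal{CN}(\mu_H,\sigma_H^2)$ (i.e., $\mu_H$ plus a circularly-symmetric complex Gaussian of variance $\sigma_H^2$) and $\mathbf{W}_k\sim\mathcal{CN}(\mathbf{0},\mathbf{I}_{n_c})$, all of $H_1,\dots,H_\ell,\mathbf{W}_1,\dots,\mathbf{W}_\ell$ mutually independent and independent of the input; neither transmitter nor receiver knows the realizations of $H_k$ (the receiver knows $\mu_H,\sigma_H^2$). Codes: an $(\ell,n_c,M,\epsilon,\rho)$-code consists of an encoder mapping each message $j\in\{1,\dots,M\}$ to a codeword $\mathbf{c}_j=(\mathbf{c}_{j,1},\dots,\mathbf{c}_{j,\ell})$ with $\mathbf{c}_{j,k}\in\mathbb{C}^{n_c}$ and $\|\mathbf{c}_{j,k}\|^2=n_c\rho$ for every $k$, and a decoder $g:\mathbb{C}^{n_c\ell}\to\{1,\dots,M\}$ such that, with message $J$ uniform on $\{1,\dots,M\}$, $\frac1M\sum_{j=1}^M\Pr\{g(\mathbf{Y}_1,\dots,\mathbf{Y}_\ell)\ne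 J\mid J=j\}\le\epsilon$. The maximum coding rate is $R^*=\sup\{\log_2(M)/(\ell n_c):\exists\ (\ell,n_c,M,\epsilon,\rho)\text{-code}\}$. Definition of $S_k$ (for given $\mu\in\mathbb{C}$, $\sigma^2>0$, and block length $m$ in place of $n_c$): let $\mathbf{e}_1=[1,0,\dots,0]^{T}\in\mathbb{C}^{m}$; let $f_{\mathbf{Y}\mid\mathbf{e}_1}$ be the density of $\mathcal{CN}\big(\mu\sqrt{m\rho}\,\mathbf{e}_1,\ \sigma^2 m\rho\,\mathbf{e}_1\mathbf{e}_1^{H}+\mathbf{I}_{m}\big)$, and let \[ f_{\mathbf{Y}}(\mathbf{y})=\frac{\Gamma(m)}{\sigma^2\pi^{m}}e^{-\|\mathbf{y}\|^2}e^{-|\mu|^2/\sigma^2}\int_0^\infty\frac{e^{-(\rho m+\sigma^{-2})z}}{(\sqrt{\|\mathbf{y}\|^2\rho m z})^{m-1}}I_0\big(2\sqrt{z|\mu|^2/\sigma^4}\big)I_{m-1}\big(2\sqrt{\|\mathbf{y}\|^2\rho m z}\big)\,\mathrm{d}z \] (the output density when the input is uniform on the sphere of radius $\sqrt{m\rho}$ and the fading is $\mathcal{CN}(\mu,\sigma^2)$). With $\mathbf{W}_k\sim\mathcal{CN}(\mathbf{0},\mathbf{I}_{m})$, set $\widetilde{\mathbf{W}}_k=\begin{bmatrix}\mu\sqrt{m\rho}\\ \mathbf{0}_{m-1}\end{bmatrix}+\begin{bmatrix}\sqrt{\sigma^2m\rho+1}\\ \mathbf{1}_{m-1}\end{bmatrix}\odot\mathbf{W}_k$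 (where $\odot$ is the entrywise product and $\mathbf{0}_{j},\mathbf{1}_j$ are the all-zero/all-one vectors of length $j$) and $S_k=\ln\dfrac{f_{\mathbf{Y}\mid\mathbf{e}_1}(\widetilde{\mathbf{W}}_k)}{f_{\mathbf{Y}}(\widetilde{\mathbf{W}}_k)}$. Also $[a]^+=\max\{0,a\}$ and $\ln$ is the natural logarithm. Pilot-assisted scheme underlying the bound (for interpretation): in each coherence block $n_p$ channel uses carry known pilot symbols of power $\rho$ each and the remaining $n_d$ carry data of total energy $n_d\rho$; the receiver forms the maximum-likelihood estimate $\hat H_k$ of $H_k$ from the pilot outputs, so that given $H_k=h_k$, $\hat H_k\sim\mathcal{CN}(h_k,\sigma_e^2)$, and given $\hat H_k=\hat h_k$ the fading coefficient is $\mathcal{CN}(\mu_p(\hat h_k),\sigma_p^2)$. *)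

theory Defs
  imports "HOL-Probability.Probability"
begin

definition cn_density :: "complex \<Rightarrow> real \<Rightarrow> complex \<Rightarrow> real" where
  "cn_density mu s z = exp (- (cmod (z - mu))\<^sup>2 / s) / (pi * s)"

definition CN :: "complex \<Rightarrow> real \<Rightarrow> complex measure" where
  "CN mu s = density lborel (\<lambda>z. ennreal (cn_density mu s z))"

definition bessel_I :: "nat \<Rightarrow> real \<Rightarrow> real" where
  "bessel_I n x = (\<Sum>k. (x / 2) ^ (2 * k + n) / (fact k * fact (k + n)))"

definition muH :: "real \<Rightarrow> complex" where
  "muH \<kappa> = complex_of_real (sqrt (\<kappa> / (1 + \<kappa>)))"

definition sigH2 :: "real \<Rightarrow> real" where
  "sigH2 \<kappa> = 1 / (1 + \<kappa>)"

text \<open>Channel inputs/outputs of the whole codeword are functions on the index set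
  {..<l} x {..<nc}: entry (k,i) is the i-th symbol of the k-th coherence block.\<close>

definition idx :: "nat \<Rightarrow> nat \<Rightarrow> (nat \<times> nat) set" where
  "idx l m = {..<l} \<times> {..<m}"

definition channel_space :: "nat \<Rightarrow> nat \<Rightarrow> real \<Rightarrow> ((nat \<Rightarrow> complex) \<times> (nat \<times> nat \<Rightarrow> complex)) measure" where
  "channel_space l nc \<kappa> =
     (PiM {..<l} (\<lambda>_. CN (muH \<kappa>) (sigH2 \<kappa>))) \<Otimes>\<^sub>M (PiM (idx l nc) (\<lambda>_. CN 0 1))"

definition channel_out :: "nat \<Rightarrow> nat \<Rightarrow> (nat \<times> nat \<Rightarrow> complex) \<Rightarrow>
    (nat \<Rightarrow> complex) \<Rightarrow> (nat \<times> nat \<Rightarrow> complex) \<Rightarrow> (nat \<times> nat \<Rightarrow> complex)" where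
  "channel_out l nc x h w = restrict (\<lambda>(k, i). h k * x (k, i) + w (k, i)) (idx l nc)"

definition is_code ::
  "nat \<Rightarrow> nat \<Rightarrow> nat \<Rightarrow> real \<Rightarrow> real \<Rightarrow> real \<Rightarrow>
   (nat \<Rightarrow> nat \<times> nat \<Rightarrow> complex) \<Rightarrow> ((nat \<times> nat \<Rightarrow> complex) \<Rightarrow> nat) \<Rightarrow> bool" where
  "is_code l nc M \<epsilon> \<rho> \<kappa> c g \<longleftrightarrow>
     M \<ge> 1 \<and>
     (\<forall>j\<in>{1..M}. \<forall>k<l. (\<Sum>i<nc. (cmod (c j (k, i)))\<^sup>2) = real nc * \<rho>) \<and>
     (\<forall>y. g y \<in> {1..M}) \<and>
     g \<in> measurable (PiM (idx l nc) (\<lambda>_. borel)) (count_space UNIV) \<and>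
     (1 / real M) * (\<Sum>j\<in>{1..M}.
        measure (channel_space l nc \<kappa>)
          {hw \<in> space (channel_space l nc \<kappa>).
             g (channel_out l nc (c j) (fst hw) (snd hw)) \<noteq> j}) \<le> \<epsilon>"

definition R_star :: "nat \<Rightarrow> nat \<Rightarrow> real \<Rightarrow> real \<Rightarrow> real \<Rightarrow> ereal" where
  "R_star l nc \<epsilon> \<rho> \<kappa> =
     Sup {ereal (log 2 (real M) / (real l * real nc)) | M. \<exists>c g. is_code l nc M \<epsilon> \<rho> \<kappa> c g}"

definition sqnorm :: "nat \<Rightarrow> (nat \<Rightarrow> complex) \<Rightarrow> real" where
  "sqnorm m y = (\<Sum>i<m. (cmod (y i))\<^sup>2)"

text \<open>Density of CN(mu sqrt(m rho) e1, s2 m rho e1 e1^H + I_m), written out explicitly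
  (determinant s2 m rho + 1, diagonal inverse covariance).\<close>
definition f_cond :: "real \<Rightarrow> complex \<Rightarrow> real \<Rightarrow> nat \<Rightarrow> (nat \<Rightarrow> complex) \<Rightarrow> real" where
  "f_cond \<rho> mu s2 m y =
     exp (- (cmod (y 0 - mu * complex_of_real (sqrt (real m * \<rho>))))\<^sup>2 / (s2 * real m * \<rho> + 1)
          - (\<Sum>i\<in>{1..<m}. (cmod (y i))\<^sup>2))
     / (pi ^ m * (s2 * real m * \<rho> + 1))"

definition f_out :: "real \<Rightarrow> complex \<Rightarrow> real \<Rightarrow> nat \<Rightarrow> (nat \<Rightarrow> complex) \<Rightarrow> real" where
  "f_out \<rho> mu s2 m y =
     Gamma (real m) / (s2 * pi ^ m) * exp (- sqnorm m y) * exp (- (cmod mu)\<^sup>2 / s2) *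
     (LINT z:{0<..}|lborel.
        exp (- (\<rho> * real m + 1 / s2) * z) / (sqrt (sqnorm m y * \<rho> * real m * z)) ^ (m - 1)
        * bessel_I 0 (2 * sqrt (z * (cmod mu)\<^sup>2 / s2\<^sup>2))
        * bessel_I (m - 1) (2 * sqrt (sqnorm m y * \<rho> * real m * z)))"

definition W_tilde :: "real \<Rightarrow> complex \<Rightarrow> real \<Rightarrow> nat \<Rightarrow> (nat \<Rightarrow> complex) \<Rightarrow> (nat \<Rightarrow> complex)" where
  "W_tilde \<rho> mu s2 m w =
     (\<lambda>i. if i = 0 then mu * complex_of_real (sqrt (real m * \<rho>))
                        + complex_of_real (sqrt (s2 * real m * \<rho> + 1)) * w 0
          else w i)"

definition S_rv :: "real \<Rightarrow> complex \<Rightarrow> real \<Rightarrow> nat \<Rightarrow> (nat \<Rightarrow> complex) \<Rightarrow> real" where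
  "S_rv \<rho> mu s2 m w =
     ln (f_cond \<rho> mu s2 m (W_tilde \<rho> mu s2 m w) / f_out \<rho> mu s2 m (W_tilde \<rho> mu s2 m w))"

definition sig_e2 :: "nat \<Rightarrow> real \<Rightarrow> real" where
  "sig_e2 np \<rho> = 1 / (real np * \<rho>)"

definition sig_p2 :: "real \<Rightarrow> nat \<Rightarrow> real \<Rightarrow> real" where
  "sig_p2 \<kappa> np \<rho> = sigH2 \<kappa> * sig_e2 np \<rho> / (sigH2 \<kappa> + sig_e2 np \<rho>)"

definition mu_p :: "real \<Rightarrow> nat \<Rightarrow> real \<Rightarrow> complex \<Rightarrow> complex" where
  "mu_p \<kappa> np \<rho> hh =
     (complex_of_real (sigH2 \<kappa>) * hh + complex_of_real (sig_e2 np \<rho>) * muH \<kappa>)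
     / complex_of_real (sigH2 \<kappa> + sig_e2 np \<rho>)"

text \<open>Joint law of (Hhat_1..Hhat_l) i.i.d. CN(muH, sigH2 + sig_e2) and independent noise
  vectors W_k ~ CN(0, I_{nd}); Sbar_k(Hhat_k) = S_rv evaluated on the k-th noise vector,
  which realises the conditional independence structure.\<close>
definition ub_space :: "nat \<Rightarrow> nat \<Rightarrow> nat \<Rightarrow> real \<Rightarrow> real \<Rightarrow>
    ((nat \<Rightarrow> complex) \<times> (nat \<times> nat \<Rightarrow> complex)) measure" where
  "ub_space l nc np \<rho> \<kappa> =
     (PiM {..<l} (\<lambda>_. CN (muH \<kappa>) (sigH2 \<kappa> + sig_e2 np \<rho>))) \<Otimes>\<^sub>M
     (PiM (idx l (nc - np)) (\<lambda>_. CN 0 1))"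

definition eps_ub :: "nat \<Rightarrow> nat \<Rightarrow> nat \<Rightarrow> real \<Rightarrow> real \<Rightarrow> nat \<Rightarrow> real" where
  "eps_ub l nc np \<rho> \<kappa> M =
     (\<integral>hw. exp (- max 0
          ((\<Sum>k<l. S_rv \<rho> (mu_p \<kappa> np \<rho> (fst hw k)) (sig_p2 \<kappa> np \<rho>) (nc - np)
                        (\<lambda>i. snd hw (k, i)))
           - ln ((real M - 1) / 2)))
      \<partial>ub_space l nc np \<rho> \<kappa>)"

end

theory Submission
  imports Defs
begin

text \<open>
  This is the dependence-testing argument for a random code. Each codeword block carries
  \<^term>\<open>np\<close> pilots followed by data drawn uniformly from a sphere, realised as a normalised Gaussian
  vector. From an output block the decoder keeps the pilot estimate of the fading and the data part;
  by Gaussian conjugacy, the law of this pair given the codeword has an explicit density with respect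
  to a product law that does not depend on the codeword. Averaging that density over the sphere gives
  \<^const>\<open>f_out\<close>. The decoder picks the first message whose log-likelihood ratio exceeds
  \<open>ln ((M - 1) / 2)\<close>; a union bound over the preceding messages and the change of measure by the
  likelihood ratio bound the average error probability by \<^const>\<open>eps_ub\<close>. Unitary invariance of the
  Gaussian law makes the law of the log-likelihood ratio independent of the codeword, so it may be
  computed for \<open>e\<^sub>1\<close>.
\<close>

section \<open>Lebesgue measure on the complex plane\<close>

lemma nn_integral_lborel_affine:
  fixes f :: "'a::euclidean_space \<Rightarrow> ennreal"
  assumes [measurable]: "f \<in> borel_measurable borel" and r_neq_0: "r \<noteq> 0"
  shows "(\<integral>\<^sup>+x. f x \<partial>lborel) = ennreal (\<bar>r\<bar> ^ DIM('a)) * (\<integral>\<^sup>+x. f (t + r *\<^sub>R x) \<partial>lborel)"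
  by (subst lborel_affine[OF r_neq_0, of t])
     (simp add: nn_integral_density nn_integral_distr nn_integral_cmult)

lemma
  fixes F :: "'a::euclidean_space \<Rightarrow> 'a \<Rightarrow> ennreal"
  assumes [measurable]: "(\<lambda>(x, y). F x y) \<in> borel_measurable (borel \<Otimes>\<^sub>M borel)"
  shows nn_integral_lborel_shear_fst:
      "(\<integral>\<^sup>+x. \<integral>\<^sup>+y. F (x + t *\<^sub>R y) y \<partial>lborel \<partial>lborel) = (\<integral>\<^sup>+x. \<integral>\<^sup>+y. F x y \<partial>lborel \<partial>lborel)"
    and nn_integral_lborel_shear_snd:
      "(\<integral>\<^sup>+x. \<integral>\<^sup>+y. F x (y + t *\<^sub>R x) \<partial>lborel \<partial>lborel) = (\<integral>\<^sup>+x. \<integral>\<^sup>+y. F x y \<partial>lborel \<partial>lborel)"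
proof -
  have shift: "(\<integral>\<^sup>+x. f (x + a) \<partial>lborel) = (\<integral>\<^sup>+x. f x \<partial>lborel)"
    if "f \<in> borel_measurable borel" for f :: "'a \<Rightarrow> ennreal" and a
    using nn_integral_lborel_affine[OF that, of 1 a] by (simp add: add.commute)
  show "(\<integral>\<^sup>+x. \<integral>\<^sup>+y. F x (y + t *\<^sub>R x) \<partial>lborel \<partial>lborel) = (\<integral>\<^sup>+x. \<integral>\<^sup>+y. F x y \<partial>lborel \<partial>lborel)"
    by (intro nn_integral_cong shift) measurable
  have "(\<integral>\<^sup>+x. \<integral>\<^sup>+y. F (x + t *\<^sub>R y) y \<partial>lborel \<partial>lborel)
      = (\<integral>\<^sup>+y. \<integral>\<^sup>+x. F (x + t *\<^sub>R y) y \<partial>lborel \<partial>lborel)"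
    by (rule lborel_pair.Fubini') measurable
  also have "\<dots> = (\<integral>\<^sup>+y. \<integral>\<^sup>+x. F x y \<partial>lborel \<partial>lborel)"
    by (intro nn_integral_cong shift) measurable
  also have "\<dots> = (\<integral>\<^sup>+x. \<integral>\<^sup>+y. F x y \<partial>lborel \<partial>lborel)"
    by (rule lborel_pair.Fubini') measurable
  finally show "(\<integral>\<^sup>+x. \<integral>\<^sup>+y. F (x + t *\<^sub>R y) y \<partial>lborel \<partial>lborel)
      = (\<integral>\<^sup>+x. \<integral>\<^sup>+y. F x y \<partial>lborel \<partial>lborel)" .
qed

text \<open>A rotation with \<open>s \<noteq> 0\<close> is a product of three shears, with parameters \<open>(1 - c) / s\<close>, \<open>- s\<close> and
  \<open>(1 - c) / s\<close>.\<close>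

lemma nn_integral_lborel_rotation:
  fixes F :: "'a::euclidean_space \<Rightarrow> 'a \<Rightarrow> ennreal"
  assumes [measurable]: "(\<lambda>(x, y). F x y) \<in> borel_measurable (borel \<Otimes>\<^sub>M borel)"
    and circle: "c\<^sup>2 + s\<^sup>2 = 1"
  shows "(\<integral>\<^sup>+x. \<integral>\<^sup>+y. F (c *\<^sub>R x + s *\<^sub>R y) (c *\<^sub>R y - s *\<^sub>R x) \<partial>lborel \<partial>lborel)
       = (\<integral>\<^sup>+x. \<integral>\<^sup>+y. F x y \<partial>lborel \<partial>lborel)"
proof (cases "s = 0")
  case True
  then have abs_c: "\<bar>c\<bar> = 1" "c \<noteq> 0" using circle by (auto simp: power2_eq_1_iff)
  have reflect: "(\<integral>\<^sup>+x. f (c *\<^sub>R x) \<partial>lborel) = (\<integral>\<^sup>+x. f x \<partial>lborel)"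
    if "f \<in> borel_measurable borel" for f :: "'a \<Rightarrow> ennreal"
    using nn_integral_lborel_affine[OF that abs_c(2), of 0] abs_c by simp
  have "(\<integral>\<^sup>+x. \<integral>\<^sup>+y. F (c *\<^sub>R x) (c *\<^sub>R y) \<partial>lborel \<partial>lborel) = (\<integral>\<^sup>+x. \<integral>\<^sup>+y. F (c *\<^sub>R x) y \<partial>lborel \<partial>lborel)"
    by (intro nn_integral_cong reflect) measurable
  also have "\<dots> = (\<integral>\<^sup>+x. \<integral>\<^sup>+y. F x y \<partial>lborel \<partial>lborel)"
    by (rule reflect) measurable
  finally show ?thesis using True by simp
next
  case False
  define t where "t = (1 - c) / s"
  have c_eq: "c = 1 - t * s" and s_eq: "s = t + t * c"
    using False circle by (simp_all add: t_def field_simps power2_eq_square)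
  have three_shears: "c *\<^sub>R x + s *\<^sub>R y = (x + t *\<^sub>R y) + t *\<^sub>R (y - s *\<^sub>R (x + t *\<^sub>R y))"
      "c *\<^sub>R y - s *\<^sub>R x = y - s *\<^sub>R (x + t *\<^sub>R y)" for x y :: 'a
  proof -
    show second_shear: "c *\<^sub>R y - s *\<^sub>R x = y - s *\<^sub>R (x + t *\<^sub>R y)"
      unfolding c_eq by (simp add: algebra_simps)
    have "(x + t *\<^sub>R y) + t *\<^sub>R (c *\<^sub>R y - s *\<^sub>R x) = (1 - t * s) *\<^sub>R x + (t + t * c) *\<^sub>R y"
      by (simp add: scaleR_diff_right scaleR_diff_left scaleR_add_left)
    then show "c *\<^sub>R x + s *\<^sub>R y = (x + t *\<^sub>R y) + t *\<^sub>R (y - s *\<^sub>R (x + t *\<^sub>R y))"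
      by (simp only: second_shear[symmetric] c_eq[symmetric] s_eq[symmetric])
  qed
  show ?thesis unfolding three_shears
    using nn_integral_lborel_shear_fst[of "\<lambda>x y. F (x + t *\<^sub>R (y - s *\<^sub>R x)) (y - s *\<^sub>R x)" t]
      nn_integral_lborel_shear_snd[of "\<lambda>x y. F (x + t *\<^sub>R y) y" "- s"]
      nn_integral_lborel_shear_fst[of F t]
    by simp
qed

lemma measurable_Complex [measurable]:
  assumes [measurable]: "f \<in> borel_measurable M" "g \<in> borel_measurable M"
  shows "(\<lambda>x. Complex (f x) (g x)) \<in> borel_measurable M"
  unfolding Complex_eq by measurable

lemma lborel_complex_eq_distr:
  "(lborel :: complex measure) = distr (lborel \<Otimes>\<^sub>M lborel) borel (\<lambda>(x, y). Complex x y)"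
proof (rule lborel_eqI)
  fix l u :: complex assume l_le_u: "\<And>b. b \<in> Basis \<Longrightarrow> l \<bullet> b \<le> u \<bullet> b"
  have components_le: "Re l \<le> Re u" "Im l \<le> Im u"
    using l_le_u[of 1] l_le_u[of \<i>] by (auto simp: Basis_complex_def)
  have "(\<lambda>(x, y). Complex x y) -` box l u \<inter> space (lborel \<Otimes>\<^sub>M lborel)
     = {Re l<..<Re u} \<times> {Im l<..<Im u}"
    by (auto simp: box_def Basis_complex_def space_pair_measure)
  then show "emeasure (distr (lborel \<Otimes>\<^sub>M lborel) borel (\<lambda>(x, y). Complex x y)) (box l u)
     = ennreal (\<Prod>b\<in>Basis. (u - l) \<bullet> b)"
    using components_le by (simp add: emeasure_distr lborel.emeasure_pair_measure_Times Basis_complex_def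
      ennreal_mult[symmetric])
qed simp

lemma nn_integral_lborel_complex:
  assumes [measurable]: "f \<in> borel_measurable borel"
  shows "(\<integral>\<^sup>+z. f z \<partial>lborel) = (\<integral>\<^sup>+x. \<integral>\<^sup>+y. f (Complex x y) \<partial>lborel \<partial>lborel)"
  by (subst lborel_complex_eq_distr, subst nn_integral_distr, measurable)
     (auto simp: lborel.nn_integral_fst[symmetric] case_prod_beta)

lemma nn_integral_lborel_phase:
  assumes [measurable]: "f \<in> borel_measurable borel" and cmod_u: "cmod u = 1"
  shows "(\<integral>\<^sup>+z. f (u * z) \<partial>lborel) = (\<integral>\<^sup>+z. f z \<partial>lborel)"
proof -
  have "(Re u)\<^sup>2 + (- Im u)\<^sup>2 = 1" using cmod_u by (simp add: cmod_def)
  from nn_integral_lborel_rotation[OF _ this, of "\<lambda>x y. f (Complex x y)"]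
  show ?thesis
    by (simp add: nn_integral_lborel_complex complex_eq_iff times_complex.code algebra_simps)
qed

lemma nn_integral_lborel_complex_affine:
  assumes [measurable]: "f \<in> borel_measurable borel" and b_neq_0: "b \<noteq> 0"
  shows "(\<integral>\<^sup>+z. f z \<partial>lborel) = ennreal ((cmod b)\<^sup>2) * (\<integral>\<^sup>+z. f (a + b * z) \<partial>lborel)"
proof -
  obtain u where polar: "cmod u = 1" "b = of_real (cmod b) * u"
    using that[of "cis (Arg b)"] rcis_cmod_Arg[of b] by (simp add: rcis_def)
  have "(\<integral>\<^sup>+z. f z \<partial>lborel) = ennreal ((cmod b)\<^sup>2) * (\<integral>\<^sup>+z. f (a + cmod b *\<^sub>R z) \<partial>lborel)"
    using nn_integral_lborel_affine[of f "cmod b" a] b_neq_0 by simp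
  also have "(\<integral>\<^sup>+z. f (a + cmod b *\<^sub>R z) \<partial>lborel) = (\<integral>\<^sup>+z. f (a + cmod b *\<^sub>R (u * z)) \<partial>lborel)"
    by (rule nn_integral_lborel_phase[OF _ polar(1), symmetric]) measurable
  also have "\<dots> = (\<integral>\<^sup>+z. f (a + b * z) \<partial>lborel)"
    by (subst (2) polar(2)) (simp add: scaleR_conv_of_real mult.assoc)
  finally show ?thesis .
qed

lemma emeasure_lborel_cmod_square_less:
  "emeasure lborel {z::complex. (cmod z)\<^sup>2 < r} = ennreal pi * ennreal r"
proof -
  have "{z::complex. (cmod z)\<^sup>2 < r} = ball 0 (sqrt r)"
    using real_less_lsqrt real_less_rsqrt
    by (auto simp: real_less_rsqrt) (metis abs_norm_cancel real_sqrt_abs real_sqrt_less_iff)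
  moreover have "emeasure lborel (ball (0::complex) (sqrt r)) = ennreal pi * ennreal r"
  proof (cases "r \<ge> 0")
    case True
    then show ?thesis by (simp add: emeasure_ball unit_ball_vol_2 ennreal_mult)
  next
    case False
    then have ball_empty: "ball (0::complex) (sqrt r) = {}" by (simp add: ball_eq_empty)
    show ?thesis unfolding ball_empty using False by (simp add: ennreal_neg)
  qed
  ultimately show ?thesis by simp
qed

lemma distr_lborel_cmod_square:
  "distr lborel borel (\<lambda>z::complex. (cmod z)\<^sup>2) = density lborel (\<lambda>x. ennreal pi * indicator {0<..} x)"
  (is "?L = ?R")
proof (rule measure_eqI_generator_eq[where E="range lessThan" and \<Omega>=UNIV and A="\<lambda>i. {..<real i}"])
  show "Int_stable (range (lessThan :: real \<Rightarrow> _))"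
  proof (clarsimp simp: Int_stable_def)
    fix a b :: real
    have "{..<a} \<inter> {..<b} = {..<min a b}" by auto
    then show "{..<a} \<inter> {..<b} \<in> range lessThan" by blast
  qed
  have emeasure_left: "emeasure ?L {..<r} = ennreal pi * ennreal r" for r
    using emeasure_lborel_cmod_square_less[of r] by (simp add: emeasure_distr vimage_def)
  then show "emeasure ?L {..<real i} \<noteq> \<infinity>" for i
    by (simp add: ennreal_mult_eq_top_iff)
  have emeasure_right: "emeasure ?R {..<r} = ennreal pi * ennreal r" for r
  proof -
    have "{0<..} \<inter> {..<r} = {0<..<r}" by auto
    then show ?thesis
      by (cases "r \<ge> 0")
         (auto simp: emeasure_density nn_integral_cmult mult.assoc indicator_inter_arith[symmetric]
           ennreal_neg)
  qed
  show "emeasure ?L X = emeasure ?R X" if "X \<in> range lessThan" for X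
    using that emeasure_left emeasure_right by auto
qed (auto simp: borel_Iio intro: reals_Archimedean2)

section \<open>Complex Gaussian laws\<close>

lemma cn_density_pos: "s > 0 \<Longrightarrow> cn_density mu s z > 0"
  by (simp add: cn_density_def)

lemma borel_measurable_cn_density [measurable]:
  assumes [measurable]: "f \<in> borel_measurable M" "g \<in> borel_measurable M" "h \<in> borel_measurable M"
  shows "(\<lambda>x. cn_density (f x) (g x) (h x)) \<in> borel_measurable M"
  unfolding cn_density_def by measurable

lemma sets_CN [simp, measurable_cong]: "sets (CN mu s) = sets borel"
  by (simp add: CN_def)

lemma space_CN [simp]: "space (CN mu s) = UNIV"
  by (simp add: CN_def)

lemma nn_integral_CN:
  assumes [measurable]: "f \<in> borel_measurable borel"
  shows "(\<integral>\<^sup>+z. f z \<partial>CN mu s) = (\<integral>\<^sup>+z. ennreal (cn_density mu s z) * f z \<partial>lborel)"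
  unfolding CN_def by (simp add: nn_integral_density)

lemma nn_integral_CN_affine:
  assumes [measurable]: "f \<in> borel_measurable borel" and b_neq_0: "b \<noteq> 0"
  shows "(\<integral>\<^sup>+z. f (a + b * z) \<partial>CN mu s) = (\<integral>\<^sup>+z. f z \<partial>CN (a + b * mu) ((cmod b)\<^sup>2 * s))"
proof -
  have density_affine: "(cmod b)\<^sup>2 * cn_density (a + b * mu) ((cmod b)\<^sup>2 * s) (a + b * z)
      = cn_density mu s z" for z
  proof -
    have "cmod (a + b * z - (a + b * mu)) = cmod b * cmod (z - mu)"
      by (simp add: right_diff_distrib[symmetric] norm_mult)
    then show ?thesis using b_neq_0 unfolding cn_density_def
      by (simp add: power_mult_distrib)
  qed
  show ?thesis
    using b_neq_0 by (subst (1 2) nn_integral_CN, simp, simp, simp)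
       (subst nn_integral_lborel_complex_affine[OF _ b_neq_0, of _ a],
        simp_all add: nn_integral_cmult[symmetric] mult.assoc[symmetric] ennreal_mult'[symmetric]
          density_affine)
qed

lemma distr_CN_affine:
  "b \<noteq> 0 \<Longrightarrow> distr (CN mu s) borel (\<lambda>z. a + b * z) = CN (a + b * mu) ((cmod b)\<^sup>2 * s)"
  by (rule measure_eqI)
     (simp_all add: nn_integral_distr nn_integral_CN_affine flip: nn_integral_indicator)

lemma distributed_CN_cmod_square:
  assumes s_pos: "s > 0"
  shows "distributed (CN 0 s) lborel (\<lambda>z. (cmod z)\<^sup>2) (exponential_density (1 / s))"
  unfolding distributed_def
proof (intro conjI measure_eqI)
  fix A assume "A \<in> sets (distr (CN 0 s) lborel (\<lambda>z. (cmod z)\<^sup>2))"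
  then have [measurable]: "A \<in> sets borel" by simp
  define e where "e x = ennreal (exp (- x / s) / (pi * s)) * indicator A x" for x
  have [measurable]: "e \<in> borel_measurable borel" unfolding e_def by measurable
  have "emeasure (distr (CN 0 s) lborel (\<lambda>z. (cmod z)\<^sup>2)) A = (\<integral>\<^sup>+z. e ((cmod z)\<^sup>2) \<partial>lborel)"
    by (subst nn_integral_indicator[symmetric], simp, subst nn_integral_distr)
       (simp_all add: nn_integral_CN cn_density_def e_def)
  also have "\<dots> = (\<integral>\<^sup>+x. e x \<partial>distr lborel borel (\<lambda>z::complex. (cmod z)\<^sup>2))"
    by (simp add: nn_integral_distr)
  also have "\<dots> = (\<integral>\<^sup>+x. ennreal pi * indicator {0<..} x * e x \<partial>lborel)"
    unfolding distr_lborel_cmod_square by (rule nn_integral_density) measurable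
  also have "\<dots> = (\<integral>\<^sup>+x. ennreal (exponential_density (1 / s) x) * indicator A x \<partial>lborel)"
  proof (rule nn_integral_cong_AE)
    have "ennreal pi * ennreal (exp (- x / s) / (pi * s)) = ennreal (exp (- x / s) / s)" for x
      using s_pos by (simp add: ennreal_mult'[symmetric])
    then have "ennreal pi * indicator {0<..} x * e x
        = ennreal (exponential_density (1 / s) x) * indicator A x"
      if "x \<noteq> 0" for x
      using that by (auto simp: e_def exponential_density_def indicator_def mult.assoc[symmetric])
    then show "AE x in lborel. ennreal pi * indicator {0<..} x * e x
        = ennreal (exponential_density (1 / s) x) * indicator A x"
      by (intro eventually_mono[OF AE_lborel_singleton[of 0]])
  qed
  also have "\<dots> = emeasure (density lborel (exponential_density (1 / s))) A"
    by (simp add: emeasure_density)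
  finally show "emeasure (distr (CN 0 s) lborel (\<lambda>z. (cmod z)\<^sup>2)) A
      = emeasure (density lborel (exponential_density (1 / s))) A" .
qed auto

lemma nn_integral_CN_cmod_square:
  assumes "f \<in> borel_measurable borel" and "s > 0"
  shows "(\<integral>\<^sup>+z. f ((cmod z)\<^sup>2) \<partial>CN 0 s) = (\<integral>\<^sup>+x. ennreal (exponential_density (1 / s) x) * f x \<partial>lborel)"
  using distributed_nn_integral[OF distributed_CN_cmod_square[OF assms(2)]] assms(1) by simp

lemma prob_space_CN:
  assumes s_pos: "s > 0" shows "prob_space (CN mu s)"
proof -
  have "prob_space (distr (CN 0 s) lborel (\<lambda>z. (cmod z)\<^sup>2))"
    using distributed_distr_eq_density[OF distributed_CN_cmod_square[OF s_pos]]
      prob_space_exponential_density[of "1 / s"] s_pos by simp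
  then have "prob_space (CN 0 s)"
    by (rule prob_space_distrD[rotated]) simp
  then have "prob_space (distr (CN 0 s) borel (\<lambda>z. mu + 1 * z))"
    by (rule prob_space.prob_space_distr) simp
  then show ?thesis
    unfolding distr_CN_affine[OF one_neq_zero] by simp
qed

lemma emeasure_CN_UNIV [simp]: "s > 0 \<Longrightarrow> emeasure (CN mu s) UNIV = 1"
  using prob_space.emeasure_space_1[OF prob_space_CN] by simp

section \<open>Products of probability spaces\<close>

lemma nn_integral_swap:
  assumes "sigma_finite_measure M" "sigma_finite_measure N"
    and "(\<lambda>(x, y). f x y) \<in> borel_measurable (M \<Otimes>\<^sub>M N)"
  shows "(\<integral>\<^sup>+x. \<integral>\<^sup>+y. f x y \<partial>N \<partial>M) = (\<integral>\<^sup>+y. \<integral>\<^sup>+x. f x y \<partial>M \<partial>N)"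
  using assms by (intro pair_sigma_finite.Fubini'[symmetric] pair_sigma_finite.intro) simp_all

lemma (in prob_space) exists_le_nn_integral:
  assumes [measurable]: "f \<in> borel_measurable M" and integral_le: "(\<integral>\<^sup>+x. f x \<partial>M) \<le> c" and c_finite: "c < \<infinity>"
  shows "\<exists>x\<in>space M. f x \<le> c"
proof (rule ccontr)
  assume "\<not> ?thesis"
  then have above_c: "c < f x" if "x \<in> space M" for x using that by force
  have "(\<integral>\<^sup>+x. c \<partial>M) < (\<integral>\<^sup>+x. f x \<partial>M)"
  proof (rule nn_integral_less)
    show "AE x in M. c \<le> f x" using above_c by (auto intro: less_imp_le)
    show "\<not> (AE x in M. f x \<le> c)"
    proof
      assume "AE x in M. f x \<le> c"
      then have "AE x in M. False"
        using AE_space by eventually_elim (use above_c not_le in blast)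
      then show False by simp
    qed
  qed (use c_finite in \<open>auto simp: emeasure_space_1\<close>)
  with integral_le show False by (simp add: emeasure_space_1)
qed

lemma distr_PiM_components:
  assumes finite_I: "finite I" and prob_M: "\<And>i. prob_space (M i)"
    and measurable_f [measurable]: "\<And>i. f i \<in> measurable (M i) (N i)"
  shows "distr (PiM I M) (PiM I N) (\<lambda>x. \<lambda>i\<in>I. f i (x i)) = PiM I (\<lambda>i. distr (M i) (N i) (f i))"
proof -
  interpret M: product_prob_space M I by (intro product_prob_spaceI prob_M)
  interpret D: product_prob_space "\<lambda>i. distr (M i) (N i) (f i)" I
    by (intro product_prob_spaceI prob_space.prob_space_distr prob_M measurable_f)
  show ?thesis
  proof (rule D.PiM_eqI[OF finite_I])
    fix A assume sets_A: "\<And>i. i \<in> I \<Longrightarrow> A i \<in> sets (distr (M i) (N i) (f i))"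
    have "(\<lambda>x. \<lambda>i\<in>I. f i (x i)) -` Pi\<^sub>E I A \<inter> space (PiM I M) = (\<Pi>\<^sub>E i\<in>I. f i -` A i \<inter> space (M i))"
      by (auto simp: space_PiM PiE_iff)
    then show "emeasure (distr (PiM I M) (PiM I N) (\<lambda>x. \<lambda>i\<in>I. f i (x i))) (Pi\<^sub>E I A)
        = (\<Prod>i\<in>I. emeasure (distr (M i) (N i) (f i)) (A i))"
      using finite_I sets_A by (subst emeasure_distr)
        (auto simp: M.emeasure_PiM emeasure_distr intro!: sets_PiM_I_finite prod.cong)
  qed (auto intro!: sets_PiM_cong)
qed

lemma density_PiM:
  assumes finite_I: "finite I" and prob_N: "\<And>i. prob_space (N i)"
    and [measurable]: "\<And>i. p i \<in> borel_measurable (N i)"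
    and prob_density: "\<And>i. prob_space (density (N i) (p i))"
  shows "density (PiM I N) (\<lambda>x. \<Prod>i\<in>I. p i (x i)) = PiM I (\<lambda>i. density (N i) (p i))"
proof -
  interpret N: product_prob_space N I by (intro product_prob_spaceI prob_N)
  interpret D: product_prob_space "\<lambda>i. density (N i) (p i)" I by (intro product_prob_spaceI prob_density)
  show ?thesis
  proof (rule D.PiM_eqI[OF finite_I])
    fix A assume sets_A: "\<And>i. i \<in> I \<Longrightarrow> A i \<in> sets (density (N i) (p i))"
    then have [measurable]: "\<And>i. i \<in> I \<Longrightarrow> A i \<in> sets (N i)" by simp
    have indicator_PiE: "indicator (Pi\<^sub>E I A) x = (\<Prod>i\<in>I. indicator (A i) (x i) :: ennreal)"
      if "x \<in> space (PiM I N)" for x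
      using that finite_I by (auto simp: space_PiM PiE_iff indicator_def prod_zero_iff)
    have "emeasure (density (PiM I N) (\<lambda>x. \<Prod>i\<in>I. p i (x i))) (Pi\<^sub>E I A)
        = (\<integral>\<^sup>+x. (\<Prod>i\<in>I. p i (x i)) * indicator (Pi\<^sub>E I A) x \<partial>PiM I N)"
      using finite_I sets_A by (intro emeasure_density) (auto intro!: sets_PiM_I_finite)
    also have "\<dots> = (\<integral>\<^sup>+x. (\<Prod>i\<in>I. p i (x i) * indicator (A i) (x i)) \<partial>PiM I N)"
      by (intro nn_integral_cong) (simp add: indicator_PiE prod.distrib)
    also have "\<dots> = (\<Prod>i\<in>I. \<integral>\<^sup>+x. p i x * indicator (A i) x \<partial>N i)"
      by (rule N.product_nn_integral_prod[OF finite_I]) measurable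
    also have "\<dots> = (\<Prod>i\<in>I. emeasure (density (N i) (p i)) (A i))"
      by (intro prod.cong) (auto simp: emeasure_density)
    finally show "emeasure (density (PiM I N) (\<lambda>x. \<Prod>i\<in>I. p i (x i))) (Pi\<^sub>E I A)
        = (\<Prod>i\<in>I. emeasure (density (N i) (p i)) (A i))" .
  qed (auto intro!: sets_PiM_cong)
qed

lemma distr_PiM_pair:
  assumes distinct_ij: "i \<in> I" "j \<in> I" "i \<noteq> j" and prob_M: "\<And>i. prob_space (M i)"
  shows "distr (PiM I M) (M i \<Otimes>\<^sub>M M j) (\<lambda>x. (x i, x j)) = M i \<Otimes>\<^sub>M M j"
proof (rule pair_measure_eqI[symmetric])
  interpret M: product_prob_space M I by (intro product_prob_spaceI prob_M)
  fix A B assume [measurable]: "A \<in> sets (M i)" "B \<in> sets (M j)"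
  have "{x \<in> space (PiM I M). \<forall>k\<in>{i, j}. x k \<in> (if k = i then A else B)}
      = (\<lambda>x. (x i, x j)) -` (A \<times> B) \<inter> space (PiM I M)"
    using distinct_ij(3) by auto
  moreover have "emeasure (PiM I M) {x \<in> space (PiM I M). \<forall>k\<in>{i, j}. x k \<in> (if k = i then A else B)}
      = (\<Prod>k\<in>{i, j}. emeasure (M k) (if k = i then A else B))"
    using distinct_ij by (intro M.emeasure_PiM_Collect) auto
  ultimately show "emeasure (M i) A * emeasure (M j) B
      = emeasure (distr (PiM I M) (M i \<Otimes>\<^sub>M M j) (\<lambda>x. (x i, x j))) (A \<times> B)"
    using distinct_ij by (simp add: emeasure_distr)
qed (simp_all add: prob_M prob_space_imp_sigma_finite)

lemma nn_integral_PiM_component: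
  assumes "i \<in> I" and prob_M: "\<And>i. i \<in> I \<Longrightarrow> prob_space (M i)" and "f \<in> borel_measurable (M i)"
  shows "(\<integral>\<^sup>+x. f (x i) \<partial>PiM I M) = (\<integral>\<^sup>+x. f x \<partial>M i)"
proof -
  have "(\<integral>\<^sup>+x. f (x i) \<partial>PiM I M) = (\<integral>\<^sup>+x. f x \<partial>distr (PiM I M) (M i) (\<lambda>x. x i))"
    using assms by (intro nn_integral_distr[symmetric]) auto
  also have "distr (PiM I M) (M i) (\<lambda>x. x i) = M i"
    by (rule distr_PiM_component[OF prob_M \<open>i \<in> I\<close>])
  finally show ?thesis .
qed

lemma nn_integral_PiM_pair:
  assumes distinct_ij: "i \<in> I" "j \<in> I" "i \<noteq> j" and prob_M: "\<And>i. prob_space (M i)"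
    and measurable_h: "(\<lambda>(x, y). h x y) \<in> borel_measurable (M i \<Otimes>\<^sub>M M j)"
  shows "(\<integral>\<^sup>+x. h (x i) (x j) \<partial>PiM I M) = (\<integral>\<^sup>+x. \<integral>\<^sup>+y. h x y \<partial>M j \<partial>M i)"
proof -
  interpret J: prob_space "M j" by (rule prob_M)
  have "(\<integral>\<^sup>+x. \<integral>\<^sup>+y. h x y \<partial>M j \<partial>M i) = (\<integral>\<^sup>+z. (\<lambda>(x, y). h x y) z \<partial>(M i \<Otimes>\<^sub>M M j))"
    using measurable_h by (subst J.nn_integral_fst[symmetric]) simp_all
  also have "M i \<Otimes>\<^sub>M M j = distr (PiM I M) (M i \<Otimes>\<^sub>M M j) (\<lambda>x. (x i, x j))"
    by (rule distr_PiM_pair[OF distinct_ij prob_M, symmetric])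
  also have "(\<integral>\<^sup>+z. (\<lambda>(x, y). h x y) z \<partial>\<dots>) = (\<integral>\<^sup>+x. (\<lambda>(x, y). h x y) (x i, x j) \<partial>PiM I M)"
    using distinct_ij measurable_h by (intro nn_integral_distr) auto
  finally show ?thesis by simp
qed

definition append_seq :: "nat \<Rightarrow> nat \<Rightarrow> (nat \<Rightarrow> 'a) \<Rightarrow> (nat \<Rightarrow> 'a) \<Rightarrow> nat \<Rightarrow> 'a" where
  "append_seq n m x y = (\<lambda>i\<in>{..<n + m}. if i < n then x i else y (i - n))"

lemma measurable_append_seq [measurable]:
  "(\<lambda>(x, y). append_seq n m x y)
    \<in> measurable (PiM {..<n} (\<lambda>_. B) \<Otimes>\<^sub>M PiM {..<m} (\<lambda>_. B)) (PiM {..<n + m} (\<lambda>_. B))"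
  unfolding case_prod_beta append_seq_def
proof (rule measurable_restrict)
  show "(\<lambda>xy. if i < n then fst xy i else snd xy (i - n))
      \<in> measurable (PiM {..<n} (\<lambda>_. B) \<Otimes>\<^sub>M PiM {..<m} (\<lambda>_. B)) B" if "i \<in> {..<n + m}" for i
    using that by (cases "i < n") auto
qed

lemma distr_PiM_append:
  assumes prob_B: "prob_space B"
  shows "distr (PiM {..<n} (\<lambda>_. B) \<Otimes>\<^sub>M PiM {..<m} (\<lambda>_. B)) (PiM {..<n + m} (\<lambda>_. B))
      (\<lambda>(x, y). append_seq n m x y) = PiM {..<n + m} (\<lambda>_. B)"
    (is "distr ?P _ ?app = _")
proof -
  interpret B: product_sigma_finite "\<lambda>_::nat. B"
    by (intro product_sigma_finite.intro prob_space_imp_sigma_finite prob_B)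
  interpret Y: prob_space "PiM {..<m} (\<lambda>_. B)" by (intro prob_space_PiM prob_B)
  show ?thesis
  proof (rule B.PiM_eqI)
    fix A assume sets_A: "\<And>i. i \<in> {..<n + m} \<Longrightarrow> A i \<in> sets B"
    have Ball_append: "(\<forall>i\<in>{..<n + m}. P i) \<longleftrightarrow> (\<forall>i\<in>{..<n}. P i) \<and> (\<forall>j\<in>{..<m}. P (n + j))" for P
    proof -
      have "{..<n + m} = {..<n} \<union> (+) n ` {..<m}"
        by (simp add: lessThan_atLeast0 image_add_atLeastLessThan ivl_disj_un_two(3) add.commute)
      then show ?thesis by (simp add: ball_Un)
    qed
    have in_space: "x \<in> space B" if "i < n \<and> x \<in> A i \<or> i < m \<and> x \<in> A (n + i)" for x i
      using sets_A[of i, THEN sets.sets_into_space] sets_A[of "n + i", THEN sets.sets_into_space] that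
      by auto
    have "?app -` Pi\<^sub>E {..<n + m} A \<inter> space ?P = Pi\<^sub>E {..<n} A \<times> Pi\<^sub>E {..<m} (\<lambda>j. A (n + j))"
      using in_space by (auto simp: space_pair_measure space_PiM PiE_iff append_seq_def Ball_append)
    moreover have "(\<Prod>i<n + k. f i) = (\<Prod>i<n. f i) * (\<Prod>j<k. f (n + j))" for f :: "nat \<Rightarrow> ennreal" and k
      by (induction k) (simp_all add: mult_ac)
    moreover have "emeasure (PiM {..<n} (\<lambda>_. B)) (Pi\<^sub>E {..<n} A) = (\<Prod>i<n. emeasure B (A i))"
      "emeasure (PiM {..<m} (\<lambda>_. B)) (\<Pi>\<^sub>E j\<in>{..<m}. A (n + j)) = (\<Prod>j<m. emeasure B (A (n + j)))"
      using sets_A by (auto intro!: B.emeasure_PiM)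
    ultimately show "emeasure (distr ?P (PiM {..<n + m} (\<lambda>_. B)) ?app) (Pi\<^sub>E {..<n + m} A)
        = (\<Prod>i\<in>{..<n + m}. emeasure B (A i))"
      using sets_A by (simp add: emeasure_distr[OF measurable_append_seq] sets_PiM_I_finite
        Y.emeasure_pair_measure_Times)
  qed auto
qed

lemma nn_integral_PiM_append:
  assumes prob_B: "prob_space B" and [measurable]: "G \<in> borel_measurable (PiM {..<n + m} (\<lambda>_. B))"
  shows "(\<integral>\<^sup>+w. G w \<partial>PiM {..<n + m} (\<lambda>_. B))
    = (\<integral>\<^sup>+x. \<integral>\<^sup>+y. G (append_seq n m x y) \<partial>PiM {..<m} (\<lambda>_. B) \<partial>PiM {..<n} (\<lambda>_. B))"
proof -
  interpret Y: prob_space "PiM {..<m} (\<lambda>_. B)" by (intro prob_space_PiM prob_B)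
  let ?P = "PiM {..<n} (\<lambda>_. B) \<Otimes>\<^sub>M PiM {..<m} (\<lambda>_. B)"
  have "(\<integral>\<^sup>+w. G w \<partial>distr ?P (PiM {..<n + m} (\<lambda>_. B)) (\<lambda>(x, y). append_seq n m x y))
      = (\<integral>\<^sup>+xy. G ((\<lambda>(x, y). append_seq n m x y) xy) \<partial>?P)"
    by (rule nn_integral_distr) measurable
  also have "\<dots>
      = (\<integral>\<^sup>+x. \<integral>\<^sup>+y. G ((\<lambda>(x, y). append_seq n m x y) (x, y)) \<partial>PiM {..<m} (\<lambda>_. B) \<partial>PiM {..<n} (\<lambda>_. B))"
    by (rule Y.nn_integral_fst[symmetric]) measurable
  finally show ?thesis by (simp add: distr_PiM_append[OF prob_B])
qed

lemma distr_PiM_curry: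
  assumes finite_K: "finite K" and finite_J: "finite J" and prob_B: "prob_space B"
  shows "distr (PiM (K \<times> J) (\<lambda>_. B)) (PiM K (\<lambda>_. PiM J (\<lambda>_. B))) (\<lambda>w. \<lambda>k\<in>K. \<lambda>j\<in>J. w (k, j))
       = PiM K (\<lambda>_. PiM J (\<lambda>_. B))" (is "distr ?P ?Q ?curry = _")
proof -
  interpret B: product_sigma_finite "\<lambda>_. B"
    by (intro product_sigma_finite.intro prob_space_imp_sigma_finite prob_B)
  interpret Q: product_prob_space "\<lambda>_. PiM J (\<lambda>_. B)" K by (intro product_prob_spaceI prob_space_PiM prob_B)
  let ?uncurry = "\<lambda>x. \<lambda>(k, j)\<in>K \<times> J. x k j"
  have "(\<lambda>x. x k j) \<in> measurable ?Q B" if "k \<in> K" "j \<in> J" for k j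
  proof -
    have "(\<lambda>x. x k) \<in> measurable ?Q (PiM J (\<lambda>_. B))" using that(1) by (rule measurable_component_singleton)
    from measurable_compose[OF this, of "\<lambda>y. y j" B] that(2) show ?thesis by simp
  qed
  then have [measurable]: "?uncurry \<in> measurable ?Q ?P"
    by (intro measurable_restrict) auto
  have [measurable]: "?curry \<in> measurable ?P ?Q"
    by (intro measurable_restrict) auto
  have "distr ?Q ?P ?uncurry = ?P"
  proof (rule B.PiM_eqI)
    fix A :: "'a \<times> 'b \<Rightarrow> 'c set" assume sets_A: "\<And>i. i \<in> K \<times> J \<Longrightarrow> A i \<in> sets B"
    have in_space: "x \<in> space B" if "k \<in> K" "j \<in> J" "x \<in> A (k, j)" for x k j
      using sets_A[of "(k, j)"] that sets.sets_into_space by auto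
    have "?uncurry -` Pi\<^sub>E (K \<times> J) A \<inter> space ?Q = (\<Pi>\<^sub>E k\<in>K. \<Pi>\<^sub>E j\<in>J. A (k, j))"
      using in_space by (auto simp: space_PiM PiE_iff)
    moreover have "Pi\<^sub>E (K \<times> J) A \<in> sets ?P"
      using finite_K finite_J sets_A by (intro sets_PiM_I_finite) auto
    moreover have "emeasure (PiM J (\<lambda>_. B)) (\<Pi>\<^sub>E j\<in>J. A (k, j)) = (\<Prod>j\<in>J. emeasure B (A (k, j)))"
      if "k \<in> K" for k
      using finite_J sets_A that by (intro B.emeasure_PiM) auto
    ultimately show "emeasure (distr ?Q ?P ?uncurry) (Pi\<^sub>E (K \<times> J) A) = (\<Prod>i\<in>K \<times> J. emeasure B (A i))"
      using finite_K finite_J sets_A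
      by (simp add: emeasure_distr Q.emeasure_PiM sets_PiM_I_finite prod.cartesian_product')
  qed (use finite_K finite_J in auto)
  then have "distr ?P ?Q ?curry = distr (distr ?Q ?P ?uncurry) ?Q ?curry" by simp
  also have "\<dots> = distr ?Q ?Q (?curry \<circ> ?uncurry)" by (rule distr_distr) measurable
  also have "\<dots> = distr ?Q ?Q (\<lambda>x. x)"
    by (intro distr_cong) (auto simp: space_PiM PiE_iff extensional_def fun_eq_iff)
  finally show ?thesis by (simp add: distr_id)
qed

lemma distr_PiM_zip:
  assumes finite_K: "finite K" and prob_A: "\<And>k. prob_space (A k)" and prob_B: "\<And>k. prob_space (B k)"
  shows "distr (PiM K A \<Otimes>\<^sub>M PiM K B) (PiM K (\<lambda>k. A k \<Otimes>\<^sub>M B k)) (\<lambda>(x, y). \<lambda>k\<in>K. (x k, y k))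
       = PiM K (\<lambda>k. A k \<Otimes>\<^sub>M B k)" (is "distr ?P ?Q ?zip = _")
proof -
  interpret A: product_prob_space A K by (intro product_prob_spaceI prob_A)
  interpret B: product_prob_space B K by (intro product_prob_spaceI prob_B)
  interpret Q: product_prob_space "\<lambda>k. A k \<Otimes>\<^sub>M B k" K
    by (intro product_prob_spaceI prob_space_pair prob_A prob_B)
  have [measurable]: "?zip \<in> measurable ?P ?Q"
    unfolding case_prod_beta by measurable
  show ?thesis
  proof (rule Q.PiM_eqI[OF finite_K])
    fix E assume sets_E: "\<And>k. k \<in> K \<Longrightarrow> E k \<in> sets (A k \<Otimes>\<^sub>M B k)"
    then have [measurable]: "Pi\<^sub>E K E \<in> sets ?Q" using finite_K by (intro sets_PiM_I_finite)
    have measurable_slice: "(\<lambda>y. indicator (E k) (x, y) :: ennreal) \<in> borel_measurable (B k)"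
      if "k \<in> K" "x \<in> space (A k)" for k x
      using sets_E[OF that(1)] that(2) by measurable
    have "emeasure (distr ?P ?Q ?zip) (Pi\<^sub>E K E) = (\<integral>\<^sup>+xy. indicator (Pi\<^sub>E K E) (?zip xy) \<partial>?P)"
      by (subst nn_integral_indicator[symmetric], simp, subst nn_integral_distr) auto
    also have "\<dots> = (\<integral>\<^sup>+x. \<integral>\<^sup>+y. indicator (Pi\<^sub>E K E) (?zip (x, y)) \<partial>PiM K B \<partial>PiM K A)"
      by (rule B.P.nn_integral_fst[symmetric]) measurable
    also have "\<dots> = (\<integral>\<^sup>+x. \<integral>\<^sup>+y. (\<Prod>k\<in>K. indicator (E k) (x k, y k)) \<partial>PiM K B \<partial>PiM K A)"
      using finite_K by (intro nn_integral_cong) (auto simp: indicator_def PiE_iff prod_zero_iff)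
    also have "\<dots> = (\<integral>\<^sup>+x. (\<Prod>k\<in>K. \<integral>\<^sup>+y. indicator (E k) (x k, y) \<partial>B k) \<partial>PiM K A)"
      by (intro nn_integral_cong B.product_nn_integral_prod finite_K measurable_slice)
        (auto simp: space_PiM PiE_iff)
    also have "\<dots> = (\<Prod>k\<in>K. \<integral>\<^sup>+x. \<integral>\<^sup>+y. indicator (E k) (x, y) \<partial>B k \<partial>A k)"
      by (rule A.product_nn_integral_prod[OF finite_K]) (use sets_E in measurable)
    also have "\<dots> = (\<Prod>k\<in>K. emeasure (A k \<Otimes>\<^sub>M B k) (E k))"
      using sets_E by (intro prod.cong refl) (simp add: B.M.emeasure_pair_measure)
    finally show "emeasure (distr ?P ?Q ?zip) (Pi\<^sub>E K E) = (\<Prod>k\<in>K. emeasure (A k \<Otimes>\<^sub>M B k) (E k))" .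
  qed auto
qed

definition blocks :: "'k set \<Rightarrow> 'j set \<Rightarrow> ('k \<Rightarrow> 'a) \<times> ('k \<times> 'j \<Rightarrow> 'b) \<Rightarrow> 'k \<Rightarrow> 'a \<times> ('j \<Rightarrow> 'b)" where
  "blocks K J = (\<lambda>(h, w). \<lambda>k\<in>K. (h k, \<lambda>j\<in>J. w (k, j)))"

lemma measurable_blocks [measurable]:
  "blocks K J \<in> measurable (PiM K (\<lambda>_. A) \<Otimes>\<^sub>M PiM (K \<times> J) (\<lambda>_. B)) (PiM K (\<lambda>_. A \<Otimes>\<^sub>M PiM J (\<lambda>_. B)))"
  unfolding blocks_def case_prod_beta
  by (intro measurable_restrict measurable_Pair
    measurable_compose[OF measurable_fst measurable_component_singleton]
     measurable_compose[OF measurable_snd measurable_component_singleton]) auto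

lemma distr_PiM_blocks:
  assumes finite_K: "finite K" and finite_J: "finite J" and prob_A: "prob_space A"
    and prob_B: "prob_space B"
  shows "distr (PiM K (\<lambda>_. A) \<Otimes>\<^sub>M PiM (K \<times> J) (\<lambda>_. B)) (PiM K (\<lambda>_. A \<Otimes>\<^sub>M PiM J (\<lambda>_. B))) (blocks K J)
    = PiM K (\<lambda>_. A \<Otimes>\<^sub>M PiM J (\<lambda>_. B))"
proof -
  let ?A = "PiM K (\<lambda>_. A)" and ?B = "PiM (K \<times> J) (\<lambda>_. B)" and ?C = "PiM K (\<lambda>_. PiM J (\<lambda>_. B))"
    and ?D = "PiM K (\<lambda>_. A \<Otimes>\<^sub>M PiM J (\<lambda>_. B))"
  let ?curry = "\<lambda>w. \<lambda>k\<in>K. \<lambda>j\<in>J. w (k, j)" and ?zip = "\<lambda>(x, y). \<lambda>k\<in>K. (x k, y k)"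
  have measurable_curry: "?curry \<in> measurable ?B ?C"
    by (intro measurable_restrict measurable_component_singleton) auto
  have measurable_zip: "?zip \<in> measurable (?A \<Otimes>\<^sub>M ?C) ?D"
    unfolding case_prod_beta by measurable
  have "sigma_finite_measure (distr ?B ?C ?curry)"
    unfolding distr_PiM_curry[OF finite_K finite_J prob_B]
    by (intro prob_space_imp_sigma_finite prob_space_PiM prob_B)
  from pair_measure_distr[OF measurable_ident_sets[OF refl] measurable_curry this]
  have "?A \<Otimes>\<^sub>M ?C = distr (?A \<Otimes>\<^sub>M ?B) (?A \<Otimes>\<^sub>M ?C) (\<lambda>(x, y). (x, ?curry y))"
    by (simp add: distr_PiM_curry[OF finite_K finite_J prob_B] distr_id2)
  then have "distr (?A \<Otimes>\<^sub>M ?C) ?D ?zip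
      = distr (distr (?A \<Otimes>\<^sub>M ?B) (?A \<Otimes>\<^sub>M ?C) (\<lambda>(x, y). (x, ?curry y))) ?D ?zip"
    by (rule arg_cong)
  also have "\<dots> = distr (?A \<Otimes>\<^sub>M ?B) ?D (?zip \<circ> (\<lambda>(x, y). (x, ?curry y)))"
    using measurable_curry by (intro distr_distr[OF measurable_zip]) measurable
  also have "?zip \<circ> (\<lambda>(x, y). (x, ?curry y)) = blocks K J"
    by (auto simp: blocks_def fun_eq_iff)
  finally show ?thesis
    by (simp only: distr_PiM_zip[OF finite_K prob_A prob_space_PiM[OF prob_B]])
qed

lemma nn_integral_PiM_sum_law:
  fixes f :: "'k \<Rightarrow> 'b \<Rightarrow> real"
  assumes finite_K: "finite K" and prob_B: "prob_space B"
    and [measurable]: "\<And>k. p k \<in> borel_measurable B" "\<And>k. f k \<in> borel_measurable B" "S \<in> borel_measurable B"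
    and same_law: "\<And>k. distr (density B (p k)) borel (f k) = distr B borel S"
    and [measurable]: "g \<in> borel_measurable borel"
  shows "(\<integral>\<^sup>+x. (\<Prod>k\<in>K. p k (x k)) * g (\<Sum>k\<in>K. f k (x k)) \<partial>PiM K (\<lambda>_. B))
      = (\<integral>\<^sup>+x. g (\<Sum>k\<in>K. S (x k)) \<partial>PiM K (\<lambda>_. B))"
proof -
  interpret B: prob_space B by fact
  have prob_density: "prob_space (density B (p k))" for k
  proof (rule prob_space_distrD)
    show "prob_space (distr (density B (p k)) borel (f k))"
      unfolding same_law by (rule B.prob_space_distr) measurable
  qed measurable
  have pushforward: "(\<integral>\<^sup>+x. g (\<Sum>k\<in>K. h k (x k)) \<partial>PiM K M)
      = (\<integral>\<^sup>+z. g (\<Sum>k\<in>K. z k) \<partial>PiM K (\<lambda>k. distr (M k) borel (h k)))"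
    if "\<And>k. prob_space (M k)" and [measurable]: "\<And>k. h k \<in> borel_measurable (M k)"
    for M :: "'k \<Rightarrow> 'b measure" and h
    unfolding distr_PiM_components[OF finite_K that(1), where f=h and N="\<lambda>_. borel", symmetric, OF that(2)]
    by (subst nn_integral_distr) auto
  have "(\<integral>\<^sup>+x. (\<Prod>k\<in>K. p k (x k)) * g (\<Sum>k\<in>K. f k (x k)) \<partial>PiM K (\<lambda>_. B))
      = (\<integral>\<^sup>+x. g (\<Sum>k\<in>K. f k (x k)) \<partial>density (PiM K (\<lambda>_. B)) (\<lambda>x. \<Prod>k\<in>K. p k (x k)))"
    by (rule nn_integral_density[symmetric]) measurable
  also have "\<dots> = (\<integral>\<^sup>+x. g (\<Sum>k\<in>K. f k (x k)) \<partial>PiM K (\<lambda>k. density B (p k)))"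
    by (subst density_PiM[OF finite_K prob_B]) (simp_all add: prob_density)
  also have "\<dots> = (\<integral>\<^sup>+z. g (\<Sum>k\<in>K. z k) \<partial>PiM K (\<lambda>_. distr B borel S))"
    by (simp add: pushforward prob_density same_law)
  also have "\<dots> = (\<integral>\<^sup>+x. g (\<Sum>k\<in>K. S (x k)) \<partial>PiM K (\<lambda>_. B))"
    by (rule pushforward[symmetric, OF prob_B]) measurable
  finally show ?thesis .
qed

section \<open>Circular symmetry and Bessel functions\<close>

definition bessel_series :: "nat \<Rightarrow> real \<Rightarrow> real" where
  "bessel_series n t = (\<Sum>k. t ^ k / (fact k * fact (k + n)))"

lemma summable_bessel_series: "summable (\<lambda>k. (t::real) ^ k / (fact k * fact (k + n)))"
proof (rule summable_comparison_test')
  show "summable (\<lambda>k. \<bar>t\<bar> ^ k / fact k)" using summable_exp[of "\<bar>t\<bar>"] by (simp add: field_simps)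
  fix k :: nat
  have "(1::real) \<le> fact (k + n)" by (rule fact_ge_1)
  then show "norm (t ^ k / (fact k * fact (k + n))) \<le> \<bar>t\<bar> ^ k / fact k"
    using mult_right_mono[of 1 "fact (k + n)" "\<bar>t\<bar> ^ k"]
    by (simp add: power_abs abs_mult divide_simps mult.commute)
qed

lemma bessel_I_eq_series:
  assumes "t \<ge> 0"
  shows "bessel_I n (2 * sqrt t) = sqrt t ^ n * bessel_series n t"
proof -
  have "(2 * sqrt t / 2) ^ (2 * k + n) / (fact k * fact (k + n))
      = sqrt t ^ n * (t ^ k / (fact k * fact (k + n)))" for k
    using assms by (simp add: power_add power_mult)
  then show ?thesis
    unfolding bessel_I_def bessel_series_def
    by (subst suminf_mult[OF summable_bessel_series, symmetric]) simp
qed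

lemma bessel_series_pos: "t \<ge> 0 \<Longrightarrow> bessel_series n t > 0"
  unfolding bessel_series_def
  by (rule suminf_pos2[OF summable_bessel_series, where i=0]) auto

lemma ennreal_bessel_series:
  "t \<ge> 0 \<Longrightarrow> ennreal (bessel_series n t) = (\<Sum>k. ennreal (t ^ k / (fact k * fact (k + n))))"
  unfolding bessel_series_def by (rule suminf_ennreal2[symmetric]) (simp_all add: summable_bessel_series)

lemma borel_measurable_bessel_series [measurable]: "bessel_series n \<in> borel_measurable borel"
  unfolding bessel_series_def by measurable

lemma borel_measurable_bessel_I [measurable]: "bessel_I n \<in> borel_measurable borel"
  unfolding bessel_I_def by measurable

lemma borel_measurable_cnj [measurable]: "cnj \<in> borel_measurable borel"
  by (intro borel_measurable_continuous_onI continuous_intros)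

definition circularly_symmetric :: "complex measure \<Rightarrow> bool" where
  "circularly_symmetric L \<longleftrightarrow> (\<forall>u. cmod u = 1 \<longrightarrow> distr L borel (\<lambda>z. u * z) = L)"

lemma circularly_symmetricD: "circularly_symmetric L \<Longrightarrow> cmod u = 1 \<Longrightarrow> distr L borel (\<lambda>z. u * z) = L"
  by (simp add: circularly_symmetric_def)

lemma sets_circularly_symmetric:
  assumes "circularly_symmetric L"
  shows "sets L = sets borel"
  using arg_cong[OF circularly_symmetricD[OF assms, of 1], of sets] by simp

lemma circularly_symmetric_CN: "circularly_symmetric (CN 0 s)"
  unfolding circularly_symmetric_def
proof (intro allI impI)
  fix u :: complex assume cmod_u: "cmod u = 1"
  then have "u \<noteq> 0" by auto
  from distr_CN_affine[OF this, of 0 s 0] cmod_u show "distr (CN 0 s) borel (\<lambda>z. u * z) = CN 0 s" by simp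
qed

lemma circularly_symmetric_moment_zero:
  assumes symmetric: "circularly_symmetric L" and j_neq_k: "j \<noteq> k"
  shows "(\<integral>z. z ^ j * cnj z ^ k \<partial>L) = 0"
proof -
  note [measurable_cong] = sets_circularly_symmetric[OF symmetric]
  define d where "d = real j - real k"
  have d_neq_0: "d \<noteq> 0" using j_neq_k by (simp add: d_def)
  define u where "u = cis (pi / d)"
  have phase_factor: "u ^ j * cnj u ^ k = -1"
  proof -
    have "u ^ j * cnj u ^ k = cis (real j * (pi / d)) * cis (- (real k * (pi / d)))"
      by (simp only: u_def cis_cnj Complex.DeMoivre mult_minus_right)
    also have "\<dots> = cis (d * (pi / d))"
      by (simp add: cis_mult d_def algebra_simps diff_divide_distrib)
    finally show ?thesis using d_neq_0 by simp
  qed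
  have "(\<integral>z. z ^ j * cnj z ^ k \<partial>L) = (\<integral>z. z ^ j * cnj z ^ k \<partial>distr L borel (\<lambda>z. u * z))"
    by (simp add: circularly_symmetricD[OF symmetric] u_def)
  also have "\<dots> = (\<integral>z. (u * z) ^ j * cnj (u * z) ^ k \<partial>L)"
    by (rule integral_distr) measurable
  also have "\<dots> = (\<integral>z. (u ^ j * cnj u ^ k) * (z ^ j * cnj z ^ k) \<partial>L)"
    by (simp add: power_mult_distrib mult_ac)
  also have "\<dots> = - (\<integral>z. z ^ j * cnj z ^ k \<partial>L)"
    unfolding phase_factor by simp
  finally show ?thesis by simp
qed

lemma sums_integral_mult_exp:
  fixes f g :: "'a \<Rightarrow> complex"
  assumes integrable_f: "integrable M f" and [measurable]: "g \<in> borel_measurable M"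
    and g_bounded: "AE x in M. cmod (g x) \<le> B"
  shows "(\<lambda>k. (\<integral>x. f x * g x ^ k \<partial>M) / fact k) sums (\<integral>x. f x * exp (g x) \<partial>M)"
proof -
  have [measurable]: "f \<in> borel_measurable M" using integrable_f by simp
  have term_bound: "AE x in M. norm (f x * g x ^ k / fact k) \<le> cmod (f x) * (B ^ k / fact k)" for k
    using g_bounded by eventually_elim
      (auto simp: norm_mult norm_divide norm_power intro!: mult_left_mono divide_right_mono power_mono)
  have integrable_term: "integrable M (\<lambda>x. f x * g x ^ k / fact k)" for k
  proof (rule Bochner_Integration.integrable_bound)
    show "integrable M (\<lambda>x. cmod (f x) * (B ^ k / fact k))" using integrable_f by simp
    show "AE x in M. norm (f x * g x ^ k / fact k) \<le> norm (cmod (f x) * (B ^ k / fact k))"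
      using term_bound[of k] by eventually_elim (unfold real_norm_def, rule order_trans[OF _ abs_ge_self])
  qed simp
  have summable_B: "summable (\<lambda>k. B ^ k / fact k)" using summable_exp[of B] by (simp add: field_simps)
  have "(\<lambda>k. \<integral>x. f x * g x ^ k / fact k \<partial>M) sums (\<integral>x. (\<Sum>k. f x * g x ^ k / fact k) \<partial>M)"
  proof (rule sums_integral[OF integrable_term])
    have "AE x in M. \<forall>k. norm (f x * g x ^ k / fact k) \<le> cmod (f x) * (B ^ k / fact k)"
      unfolding AE_all_countable using term_bound by blast
    then show "AE x in M. summable (\<lambda>k. norm (f x * g x ^ k / fact k))"
    proof eventually_elim
      case (elim x)
      show ?case
        by (rule summable_comparison_test'[OF summable_mult[OF summable_B, of "cmod (f x)"], of 0])
           (use elim in simp)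
    qed
    have "(\<integral>x. norm (f x * g x ^ k / fact k) \<partial>M) \<le> (\<integral>x. cmod (f x) \<partial>M) * (B ^ k / fact k)" for k
      using integral_mono_AE[OF integrable_norm[OF integrable_term] _ term_bound, of k] integrable_f by simp
    then show "summable (\<lambda>k. \<integral>x. norm (f x * g x ^ k / fact k) \<partial>M)"
      by (intro summable_comparison_test'[OF summable_mult[OF summable_B], of 0]) simp
  qed
  moreover have "(\<Sum>k. f x * g x ^ k / fact k) = f x * exp (g x)" for x
    using sums_mult[OF exp_converges[of "g x"], of "f x"]
    by (simp add: sums_iff scaleR_conv_of_real field_simps)
  ultimately show ?thesis by simp
qed

text \<open>Parseval: \<open>exp (2 Re z) = exp z * cnj (exp z)\<close>, and the powers of \<open>z\<close> are orthogonal.\<close>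

lemma circularly_symmetric_sums_exp_Re:
  assumes symmetric: "circularly_symmetric L" and "finite_measure L" and bounded: "AE z in L. cmod z \<le> B"
  shows "(\<lambda>k. (\<integral>z. (cmod z) ^ (2 * k) \<partial>L) / (fact k)\<^sup>2) sums (\<integral>z. exp (2 * Re z) \<partial>L)"
proof -
  interpret finite_measure L by fact
  note [measurable_cong] = sets_circularly_symmetric[OF symmetric]
  have integrable_cnj_power: "integrable L (\<lambda>z. cnj z ^ k)" for k
    by (rule integrable_const_bound[where B="B ^ k"])
       (use bounded in \<open>auto elim!: eventually_mono simp: norm_power intro!: power_mono\<close>)
  have integrable_exp: "integrable L exp"
    by (rule integrable_const_bound[where B="exp B"])
       (use bounded in \<open>auto elim!: eventually_mono intro: order_trans[OF complex_Re_le_cmod]\<close>)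
  have diagonal: "(\<integral>z. cnj z ^ k * z ^ k \<partial>L) = of_real (\<integral>z. (cmod z) ^ (2 * k) \<partial>L)" for k
    unfolding integral_complex_of_real[symmetric]
    by (simp add: power_mult flip: power_mult_distrib complex_norm_square mult.commute[of z "cnj z" for z])
  have moment_exp: "(\<integral>z. cnj z ^ k * exp z \<partial>L) = of_real ((\<integral>z. (cmod z) ^ (2 * k) \<partial>L) / fact k)" for k
  proof -
    have "(\<integral>z. cnj z ^ k * z ^ j \<partial>L) / fact j
        = (if j = k then (\<integral>z. cnj z ^ k * z ^ k \<partial>L) / fact k else 0)" for j
      using circularly_symmetric_moment_zero[OF symmetric, of j k] by (simp add: mult.commute)
    then have "(\<lambda>j. if j = k then (\<integral>z. cnj z ^ k * z ^ k \<partial>L) / fact k else 0)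
        sums (\<integral>z. cnj z ^ k * exp z \<partial>L)"
      using sums_integral_mult_exp[OF integrable_cnj_power, of "\<lambda>z. z" B k] bounded by simp
    from sums_unique2[OF this sums_single] show ?thesis by (simp add: diagonal)
  qed
  have "(\<lambda>k. (\<integral>z. exp z * cnj z ^ k \<partial>L) / fact k) sums (\<integral>z. exp z * exp (cnj z) \<partial>L)"
    using sums_integral_mult_exp[OF integrable_exp, of cnj B] bounded by simp
  moreover have "exp z * exp (cnj z) = of_real (exp (2 * Re z))" for z
    by (simp add: exp_add[symmetric] complex_add_cnj exp_of_real[symmetric])
  ultimately have "(\<lambda>k. complex_of_real ((\<integral>z. (cmod z) ^ (2 * k) \<partial>L) / (fact k)\<^sup>2))
      sums of_real (\<integral>z. exp (2 * Re z) \<partial>L)"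
    by (simp add: mult.commute[of "exp _" "cnj _ ^ _"] moment_exp power2_eq_square)
  then show ?thesis unfolding sums_of_real_iff .
qed

abbreviation "CN_std \<equiv> CN 0 1"

interpretation CN_std: prob_space CN_std by (rule prob_space_CN) simp

lemma AE_CN_neq: "AE z in CN mu s. z \<noteq> a"
  unfolding CN_def using AE_lborel_singleton[of a] by (auto simp: AE_density elim: eventually_mono)

lemma CN_std_sgn_mgf:
  "(\<integral>\<^sup>+w. ennreal (exp (2 * Re (c * sgn w))) \<partial>CN_std) = ennreal (bessel_series 0 ((cmod c)\<^sup>2))"
proof -
  define L where "L = distr CN_std borel (\<lambda>w. c * sgn w)"
  interpret L: prob_space L unfolding L_def by (rule CN_std.prob_space_distr) measurable
  have symmetric: "circularly_symmetric L"
    unfolding circularly_symmetric_def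
  proof (intro allI impI)
    fix u :: complex assume cmod_u: "cmod u = 1"
    then have "sgn u = u" by (simp add: sgn_eq)
    then have "distr L borel (\<lambda>z. u * z) = distr CN_std borel ((\<lambda>w. c * sgn w) \<circ> (\<lambda>w. u * w))"
      unfolding L_def by (subst distr_distr) (auto simp: o_def sgn_mult mult_ac)
    also have "\<dots> = distr (distr CN_std borel (\<lambda>w. u * w)) borel (\<lambda>w. c * sgn w)"
      by (rule distr_distr[symmetric]) measurable
    finally show "distr L borel (\<lambda>z. u * z) = L"
      by (simp add: L_def circularly_symmetricD[OF circularly_symmetric_CN cmod_u])
  qed
  have AE_norm: "AE z in L. cmod z = cmod c"
    unfolding L_def using AE_CN_neq[of 0 0 1]
    by (subst AE_distr_iff) (auto elim!: eventually_mono simp: norm_mult norm_sgn)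
  have "(\<integral>z. (cmod z) ^ (2 * k) \<partial>L) = ((cmod c)\<^sup>2) ^ k" for k
  proof -
    have "(\<integral>z. (cmod z) ^ (2 * k) \<partial>L) = (\<integral>z. (cmod c) ^ (2 * k) \<partial>L)"
      using AE_norm by (intro integral_cong_AE) (auto simp: L_def elim: eventually_mono)
    then show ?thesis by (simp add: L.prob_space power_mult)
  qed
  moreover have bounded: "AE z in L. cmod z \<le> cmod c" using AE_norm by eventually_elim simp
  ultimately have "(\<integral>z. exp (2 * Re z) \<partial>L) = bessel_series 0 ((cmod c)\<^sup>2)"
    using circularly_symmetric_sums_exp_Re[OF symmetric L.finite_measure_axioms, of "cmod c"]
    by (simp add: bessel_series_def sums_iff power2_eq_square)
  moreover have "integrable L (\<lambda>z. exp (2 * Re z))"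
    by (rule L.integrable_const_bound[where B="exp (2 * cmod c)"])
       (use bounded in \<open>auto elim!: eventually_mono simp: L_def intro: order_trans[OF complex_Re_le_cmod]\<close>)
  ultimately have "(\<integral>\<^sup>+z. ennreal (exp (2 * Re z)) \<partial>L) = ennreal (bessel_series 0 ((cmod c)\<^sup>2))"
    by (subst nn_integral_eq_integral) auto
  then show ?thesis by (simp add: L_def nn_integral_distr)
qed

text \<open>Multiplying by an independent uniform phase does not change a circularly symmetric law; averaging over
  that phase first produces \<open>I\<^sub>0\<close>.\<close>

lemma circularly_symmetric_nn_integral_exp:
  assumes symmetric: "circularly_symmetric L" and sigma_finite_L: "sigma_finite_measure L"
    and [measurable]: "k \<in> borel_measurable borel" "g \<in> borel_measurable borel"
  shows "(\<integral>\<^sup>+z. k (cmod z) * ennreal (exp (2 * Re (g (cmod z) * z))) \<partial>L)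
    = (\<integral>\<^sup>+z. k (cmod z) * ennreal (bessel_series 0 ((cmod (g (cmod z) * z))\<^sup>2)) \<partial>L)"
proof -
  note [measurable_cong] = sets_circularly_symmetric[OF symmetric]
  have rotate: "(\<integral>\<^sup>+z. k (cmod z) * ennreal (exp (2 * Re (g (cmod z) * z * u))) \<partial>L)
      = (\<integral>\<^sup>+z. k (cmod z) * ennreal (exp (2 * Re (g (cmod z) * z))) \<partial>L)" if cmod_u: "cmod u = 1" for u
  proof -
    have "(\<integral>\<^sup>+z. k (cmod z) * ennreal (exp (2 * Re (g (cmod z) * z))) \<partial>distr L borel (\<lambda>z. u * z))
        = (\<integral>\<^sup>+z. k (cmod z) * ennreal (exp (2 * Re (g (cmod z) * z * u))) \<partial>L)"
      using cmod_u by (subst nn_integral_distr) (auto simp: norm_mult mult_ac)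
    then show ?thesis by (simp add: circularly_symmetricD[OF symmetric cmod_u])
  qed
  have "(\<integral>\<^sup>+z. k (cmod z) * ennreal (exp (2 * Re (g (cmod z) * z))) \<partial>L)
      = (\<integral>\<^sup>+w. \<integral>\<^sup>+z. k (cmod z) * ennreal (exp (2 * Re (g (cmod z) * z))) \<partial>L \<partial>CN_std)"
    by simp
  also have "\<dots> = (\<integral>\<^sup>+w. \<integral>\<^sup>+z. k (cmod z) * ennreal (exp (2 * Re (g (cmod z) * z * sgn w))) \<partial>L \<partial>CN_std)"
  proof (rule nn_integral_cong_AE)
    have "AE w in CN_std. cmod (sgn w) = 1"
      using AE_CN_neq[of 0 0 1] by eventually_elim (simp add: norm_sgn)
    then show "AE w in CN_std. (\<integral>\<^sup>+z. k (cmod z) * ennreal (exp (2 * Re (g (cmod z) * z))) \<partial>L)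
        = (\<integral>\<^sup>+z. k (cmod z) * ennreal (exp (2 * Re (g (cmod z) * z * sgn w))) \<partial>L)"
      by eventually_elim (rule rotate[symmetric])
  qed
  also have "\<dots> = (\<integral>\<^sup>+z. \<integral>\<^sup>+w. k (cmod z) * ennreal (exp (2 * Re (g (cmod z) * z * sgn w))) \<partial>CN_std \<partial>L)"
    by (rule nn_integral_swap[OF CN_std.sigma_finite_measure_axioms sigma_finite_L]) measurable
  also have "\<dots> = (\<integral>\<^sup>+z. k (cmod z) * ennreal (bessel_series 0 ((cmod (g (cmod z) * z))\<^sup>2)) \<partial>L)"
    by (intro nn_integral_cong, subst nn_integral_cmult) (measurable, simp only: CN_std_sgn_mgf)
  finally show ?thesis .
qed

section \<open>Standard Gaussian vectors\<close>

abbreviation "CN_vec I \<equiv> PiM I (\<lambda>_. CN_std)"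

interpretation CN_vec: product_sigma_finite "\<lambda>_. CN_std" by standard

lemma prob_space_CN_vec: "prob_space (CN_vec I)"
  by (intro prob_space_PiM CN_std.prob_space_axioms)

lemma nn_integral_CN_std_rotation:
  assumes [measurable]: "(\<lambda>(x, y). F x y) \<in> borel_measurable (borel \<Otimes>\<^sub>M borel)"
    and circle: "c\<^sup>2 + d\<^sup>2 = 1"
  shows "(\<integral>\<^sup>+x. \<integral>\<^sup>+y. F (of_real c * x + of_real d * y) ((cmod x)\<^sup>2 + (cmod y)\<^sup>2) \<partial>CN_std \<partial>CN_std)
       = (\<integral>\<^sup>+x. \<integral>\<^sup>+y. F x ((cmod x)\<^sup>2 + (cmod y)\<^sup>2) \<partial>CN_std \<partial>CN_std)"
proof -
  let ?G = "\<lambda>x y. ennreal (exp (- ((cmod x)\<^sup>2 + (cmod y)\<^sup>2)) / (pi * pi)) * F x ((cmod x)\<^sup>2 + (cmod y)\<^sup>2)"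
  have sqnorm_rotation: "(cmod (c *\<^sub>R x + d *\<^sub>R y))\<^sup>2 + (cmod (c *\<^sub>R y - d *\<^sub>R x))\<^sup>2
      = (cmod x)\<^sup>2 + (cmod y)\<^sup>2" for x y
  proof -
    have "(cmod (c *\<^sub>R x + d *\<^sub>R y))\<^sup>2 + (cmod (c *\<^sub>R y - d *\<^sub>R x))\<^sup>2
        = (c\<^sup>2 + d\<^sup>2) * ((cmod x)\<^sup>2 + (cmod y)\<^sup>2)"
      unfolding cmod_power2 by (simp add: algebra_simps power2_eq_square)
    then show ?thesis using circle by simp
  qed
  have joint_density: "ennreal (cn_density 0 1 x) * (ennreal (cn_density 0 1 y) * z)
      = ennreal (exp (- ((cmod x)\<^sup>2 + (cmod y)\<^sup>2)) / (pi * pi)) * z" for x y z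
    by (subst mult.assoc[symmetric], subst ennreal_mult[symmetric])
       (simp_all add: cn_density_def exp_add[symmetric])
  have "(\<integral>\<^sup>+x. \<integral>\<^sup>+y. ?G (c *\<^sub>R x + d *\<^sub>R y) (c *\<^sub>R y - d *\<^sub>R x) \<partial>lborel \<partial>lborel)
      = (\<integral>\<^sup>+x. \<integral>\<^sup>+y. ?G x y \<partial>lborel \<partial>lborel)"
    by (rule nn_integral_lborel_rotation) (use circle in measurable)
  then show ?thesis
    unfolding sqnorm_rotation
    by (simp add: nn_integral_CN nn_integral_cmult[symmetric] joint_density scaleR_conv_of_real)
qed

lemma nn_integral_CN_std_mult:
  assumes [measurable]: "(\<lambda>(x, y). F x y) \<in> borel_measurable (borel \<Otimes>\<^sub>M borel)"
  shows "(\<integral>\<^sup>+z. F (a * z) ((cmod z)\<^sup>2) \<partial>CN_std) = (\<integral>\<^sup>+z. F (of_real (cmod a) * z) ((cmod z)\<^sup>2) \<partial>CN_std)"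
proof -
  obtain u where polar: "cmod u = 1" "a = of_real (cmod a) * u"
    using that[of "cis (Arg a)"] rcis_cmod_Arg[of a] by (simp add: rcis_def)
  have "(\<integral>\<^sup>+z. F (of_real (cmod a) * z) ((cmod z)\<^sup>2) \<partial>distr CN_std borel (\<lambda>z. u * z))
      = (\<integral>\<^sup>+z. F (a * z) ((cmod z)\<^sup>2) \<partial>CN_std)"
    using polar by (subst nn_integral_distr) (auto simp: norm_mult mult.assoc[symmetric])
  then show ?thesis
    by (simp add: circularly_symmetricD[OF circularly_symmetric_CN polar(1)])
qed

lemma nn_integral_CN_std_pair_linear:
  assumes [measurable]: "(\<lambda>(x, y). F x y) \<in> borel_measurable (borel \<Otimes>\<^sub>M borel)"
  shows "(\<integral>\<^sup>+x. \<integral>\<^sup>+y. F (a * x + b * y) ((cmod x)\<^sup>2 + (cmod y)\<^sup>2) \<partial>CN_std \<partial>CN_std)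
       = (\<integral>\<^sup>+x. \<integral>\<^sup>+y. F (of_real (sqrt ((cmod a)\<^sup>2 + (cmod b)\<^sup>2)) * x) ((cmod x)\<^sup>2 + (cmod y)\<^sup>2) \<partial>CN_std
       \<partial>CN_std)"
proof (cases "a = 0 \<and> b = 0")
  case False
  let ?\<alpha> = "cmod a" and ?\<beta> = "cmod b" and ?r = "sqrt ((cmod a)\<^sup>2 + (cmod b)\<^sup>2)"
  from False have "(cmod a)\<^sup>2 + (cmod b)\<^sup>2 \<noteq> 0" by (simp add: sum_power2_eq_zero_iff)
  then have r_neq_0: "?r \<noteq> 0" by simp
  have "(\<integral>\<^sup>+x. \<integral>\<^sup>+y. F (a * x + b * y) ((cmod x)\<^sup>2 + (cmod y)\<^sup>2) \<partial>CN_std \<partial>CN_std)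
      = (\<integral>\<^sup>+x. \<integral>\<^sup>+y. F (a * x + of_real ?\<beta> * y) ((cmod x)\<^sup>2 + (cmod y)\<^sup>2) \<partial>CN_std \<partial>CN_std)"
    using nn_integral_CN_std_mult[of "\<lambda>u v. F (a * x + u) ((cmod x)\<^sup>2 + v)" b for x] by simp
  also have "\<dots>
      = (\<integral>\<^sup>+x. \<integral>\<^sup>+y. F (of_real ?\<alpha> * x + of_real ?\<beta> * y) ((cmod x)\<^sup>2 + (cmod y)\<^sup>2) \<partial>CN_std \<partial>CN_std)"
    by (rule nn_integral_CN_std_mult[where F="\<lambda>u v. \<integral>\<^sup>+y. F (u + of_real ?\<beta> * y) (v + (cmod y)\<^sup>2) \<partial>CN_std"])
      measurable
  also have "\<dots>
      = (\<integral>\<^sup>+x. \<integral>\<^sup>+y. F (of_real ?r * (of_real (?\<alpha> / ?r) * x + of_real (?\<beta> / ?r) * y))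
          ((cmod x)\<^sup>2 + (cmod y)\<^sup>2) \<partial>CN_std \<partial>CN_std)"
  proof -
    have "of_real ?r * (of_real (?\<alpha> / ?r) * x + of_real (?\<beta> / ?r) * y)
        = of_real (?r * (?\<alpha> / ?r)) * x + of_real (?r * (?\<beta> / ?r)) * y" for x y :: complex
      by (simp only: of_real_mult distrib_left mult.assoc)
    then show ?thesis using r_neq_0 by simp
  qed
  also have "\<dots> = (\<integral>\<^sup>+x. \<integral>\<^sup>+y. F (of_real ?r * x) ((cmod x)\<^sup>2 + (cmod y)\<^sup>2) \<partial>CN_std \<partial>CN_std)"
  proof (rule nn_integral_CN_std_rotation[where F="\<lambda>u v. F (of_real ?r * u) v"])
    show "(?\<alpha> / ?r)\<^sup>2 + (?\<beta> / ?r)\<^sup>2 = 1"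
      using r_neq_0 by (simp add: power_divide add_divide_distrib[symmetric])
  qed measurable
  finally show ?thesis .
qed simp

lemma nn_integral_CN_std_merge_coordinate:
  assumes sigma_finite_M: "sigma_finite_measure M" and [measurable]: "S \<in> borel_measurable M"
    and [measurable]: "(\<lambda>(x, y). F x y) \<in> borel_measurable (borel \<Otimes>\<^sub>M borel)"
  shows "(\<integral>\<^sup>+y. \<integral>\<^sup>+w. \<integral>\<^sup>+x. F (b * y + of_real r * x) ((cmod y)\<^sup>2 + ((cmod x)\<^sup>2 + S w)) \<partial>CN_std \<partial>M \<partial>CN_std)
    = (\<integral>\<^sup>+w. \<integral>\<^sup>+y. \<integral>\<^sup>+x. F (of_real (sqrt (r\<^sup>2 + (cmod b)\<^sup>2)) * x) (((cmod x)\<^sup>2 + (cmod y)\<^sup>2) + S w)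
        \<partial>CN_std \<partial>CN_std \<partial>M)"
proof -
  note swap_CN_std = nn_integral_swap[OF CN_std.sigma_finite_measure_axioms]
  have "(\<integral>\<^sup>+y. \<integral>\<^sup>+w. \<integral>\<^sup>+x. F (b * y + of_real r * x) ((cmod y)\<^sup>2 + ((cmod x)\<^sup>2 + S w)) \<partial>CN_std \<partial>M \<partial>CN_std)
      = (\<integral>\<^sup>+w. \<integral>\<^sup>+y. \<integral>\<^sup>+x. F (b * y + of_real r * x) ((cmod y)\<^sup>2 + ((cmod x)\<^sup>2 + S w)) \<partial>CN_std \<partial>CN_std \<partial>M)"
    by (rule swap_CN_std[OF sigma_finite_M]) measurable
  also have "\<dots>
      = (\<integral>\<^sup>+w. \<integral>\<^sup>+x. \<integral>\<^sup>+y. F (of_real r * x + b * y) (((cmod x)\<^sup>2 + (cmod y)\<^sup>2) + S w) \<partial>CN_std \<partial>CN_std \<partial>M)"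
    by (subst (1) swap_CN_std[OF CN_std.sigma_finite_measure_axioms]) (measurable, simp add: ac_simps)
  also have "\<dots>
      = (\<integral>\<^sup>+w. \<integral>\<^sup>+x. \<integral>\<^sup>+y. F (of_real (sqrt (r\<^sup>2 + (cmod b)\<^sup>2)) * x) (((cmod x)\<^sup>2 + (cmod y)\<^sup>2) + S w)
        \<partial>CN_std \<partial>CN_std \<partial>M)"
    using nn_integral_CN_std_pair_linear[of "\<lambda>s t. F s (t + S w)" "of_real r" b for w] by simp
  also have "\<dots>
      = (\<integral>\<^sup>+w. \<integral>\<^sup>+y. \<integral>\<^sup>+x. F (of_real (sqrt (r\<^sup>2 + (cmod b)\<^sup>2)) * x) (((cmod x)\<^sup>2 + (cmod y)\<^sup>2) + S w)
        \<partial>CN_std \<partial>CN_std \<partial>M)"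
    by (intro nn_integral_cong swap_CN_std CN_std.sigma_finite_measure_axioms) measurable
  finally show ?thesis .
qed

lemma nn_integral_CN_vec_add_coordinate:
  assumes "finite J" and "(\<lambda>(x, y). F x y) \<in> borel_measurable (borel \<Otimes>\<^sub>M borel)"
  shows "(\<integral>\<^sup>+w. \<integral>\<^sup>+x. F (a * x + (\<Sum>j\<in>J. u j * w j)) ((cmod x)\<^sup>2 + (\<Sum>j\<in>J. (cmod (w j))\<^sup>2)) \<partial>CN_std \<partial>CN_vec J)
       = (\<integral>\<^sup>+w. \<integral>\<^sup>+x. F (of_real (sqrt ((cmod a)\<^sup>2 + (\<Sum>j\<in>J. (cmod (u j))\<^sup>2))) * x)
            ((cmod x)\<^sup>2 + (\<Sum>j\<in>J. (cmod (w j))\<^sup>2)) \<partial>CN_std \<partial>CN_vec J)"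
  using assms
proof (induction J arbitrary: F rule: finite_induct)
  case empty
  show ?case using nn_integral_CN_std_mult[OF empty.prems, of a] by simp
next
  case (insert j J)
  note [measurable] = insert.prems
  let ?L = "\<lambda>w. \<Sum>j\<in>J. u j * w j" and ?S = "\<lambda>w. \<Sum>j\<in>J. (cmod (w j))\<^sup>2"
  define r where "r = sqrt ((cmod a)\<^sup>2 + (\<Sum>j\<in>J. (cmod (u j))\<^sup>2))"
  define R where "R = sqrt ((cmod a)\<^sup>2 + (\<Sum>j\<in>insert j J. (cmod (u j))\<^sup>2))"
  have R_eq: "R = sqrt (r\<^sup>2 + (cmod (u j))\<^sup>2)"
    using insert.hyps by (simp add: R_def r_def sum_nonneg add_nonneg_nonneg ac_simps)
  have sums_upd: "?L (w(j := y)) = ?L w" "?S (w(j := y)) = ?S w" for w y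
    using insert.hyps by (auto intro!: sum.cong)
  have "(\<integral>\<^sup>+w. \<integral>\<^sup>+x. F (a * x + (\<Sum>j\<in>insert j J. u j * w j)) ((cmod x)\<^sup>2 + (\<Sum>j\<in>insert j J. (cmod (w j))\<^sup>2))
      \<partial>CN_std \<partial>CN_vec (insert j J))
      = (\<integral>\<^sup>+y. \<integral>\<^sup>+w. \<integral>\<^sup>+x. F (u j * y + (a * x + ?L w)) ((cmod y)\<^sup>2 + ((cmod x)\<^sup>2 + ?S w)) \<partial>CN_std \<partial>CN_vec J
      \<partial>CN_std)"
    using insert.hyps
    by (subst CN_vec.product_nn_integral_insert_rev)
       (auto simp: sums_upd fun_upd_same add.left_commute simp del: fun_upd_apply)
  also have "\<dots>
      = (\<integral>\<^sup>+y. \<integral>\<^sup>+w. \<integral>\<^sup>+x. F (u j * y + of_real r * x) ((cmod y)\<^sup>2 + ((cmod x)\<^sup>2 + ?S w)) \<partial>CN_std \<partial>CN_vec J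
      \<partial>CN_std)"
    using insert.IH[of "\<lambda>s t. F (u j * y + s) ((cmod y)\<^sup>2 + t)" for y] by (simp add: r_def)
  also have "\<dots>
      = (\<integral>\<^sup>+w. \<integral>\<^sup>+y. \<integral>\<^sup>+x. F (of_real R * x) (((cmod x)\<^sup>2 + (cmod y)\<^sup>2) + ?S w) \<partial>CN_std \<partial>CN_std \<partial>CN_vec J)"
    unfolding R_eq
    by (rule nn_integral_CN_std_merge_coordinate[OF prob_space_imp_sigma_finite[OF prob_space_CN_vec]])
       measurable
  also have "\<dots>
      = (\<integral>\<^sup>+w. \<integral>\<^sup>+x. F (of_real R * x) ((cmod x)\<^sup>2 + (\<Sum>j\<in>insert j J. (cmod (w j))\<^sup>2)) \<partial>CN_std
      \<partial>CN_vec (insert j J))"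
    using insert.hyps
    by (subst CN_vec.product_nn_integral_insert)
       (auto simp: sums_upd fun_upd_same add.assoc simp del: fun_upd_apply)
  finally show ?case by (simp only: R_def)
qed

lemma nn_integral_CN_vec_linear:
  assumes "finite I" "i \<in> I" and [measurable]: "(\<lambda>(x, y). F x y) \<in> borel_measurable (borel \<Otimes>\<^sub>M borel)"
  shows "(\<integral>\<^sup>+w. F (\<Sum>j\<in>I. u j * w j) (\<Sum>j\<in>I. (cmod (w j))\<^sup>2) \<partial>CN_vec I)
       = (\<integral>\<^sup>+w. F (of_real (sqrt (\<Sum>j\<in>I. (cmod (u j))\<^sup>2)) * w i) (\<Sum>j\<in>I. (cmod (w j))\<^sup>2) \<partial>CN_vec I)"
proof -
  define J where "J = I - {i}"
  have split_I: "finite J" "i \<notin> J" "I = insert i J" using assms by (auto simp: J_def)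
  have sums_upd: "(\<Sum>j\<in>J. u j * (w(i := y)) j) = (\<Sum>j\<in>J. u j * w j)"
      "(\<Sum>j\<in>J. (cmod ((w(i := y)) j))\<^sup>2) = (\<Sum>j\<in>J. (cmod (w j))\<^sup>2)" for w :: "'a \<Rightarrow> complex" and y
    using split_I by (auto intro!: sum.cong)
  show ?thesis
    using nn_integral_CN_vec_add_coordinate[OF split_I(1) assms(3), of "u i" u] split_I(1,2)
    unfolding split_I(3)
    by (simp add: CN_vec.product_nn_integral_insert sums_upd del: fun_upd_apply cong: nn_integral_cong)
       (simp add: fun_upd_same)
qed

section \<open>Random directions\<close>

lemma borel_measurable_sqnorm [measurable]:
  "sqnorm m \<in> borel_measurable (PiM {..<m} (\<lambda>_. borel))"
  "sqnorm m \<in> borel_measurable (CN_vec {..<m})"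
  unfolding sqnorm_def[abs_def] by measurable

lemma sqnorm_nonneg [simp]: "0 \<le> sqnorm m w"
  by (simp add: sqnorm_def sum_nonneg)

lemma cmod_square_le_sqnorm: "i < m \<Longrightarrow> (cmod (w i))\<^sup>2 \<le> sqnorm m w"
  unfolding sqnorm_def by (intro member_le_sum) auto

lemma sqnorm_fun_upd_0:
  assumes "m \<ge> 1"
  shows "sqnorm m (w(0 := z)) = (cmod z)\<^sup>2 + (\<Sum>i\<in>{1..<m}. (cmod (w i))\<^sup>2)"
proof -
  have "{..<m} = insert 0 {1..<m}" using assms by auto
  then show ?thesis by (simp add: sqnorm_def)
qed

lemma nn_integral_CN_vec_split_0:
  fixes m :: nat
  assumes m_ge_1: "m \<ge> 1" and measurable_F: "F \<in> borel_measurable (CN_vec {..<m})"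
  shows "(\<integral>\<^sup>+w. F w \<partial>CN_vec {..<m}) = (\<integral>\<^sup>+w. \<integral>\<^sup>+z. F (w(0 := z)) \<partial>CN_std \<partial>CN_vec {1..<m})"
proof -
  have split_0: "{..<m} = insert 0 {1..<m}" using m_ge_1 by auto
  show ?thesis using measurable_F unfolding split_0 by (intro CN_vec.product_nn_integral_insert) auto
qed

lemma emeasure_CN_std_cmod_square_gt:
  assumes "c \<ge> 0"
  shows "emeasure CN_std {z. c < (cmod z)\<^sup>2} = ennreal (exp (- c))"
  using CN_std.exponential_distributedD_gt[OF _ assms, of "\<lambda>z. (cmod z)\<^sup>2" 1]
    distributed_CN_cmod_square[of 1]
  by (simp add: CN_std.emeasure_eq_measure)

lemma nn_integral_CN_std_exp_cmod_square:
  assumes c_nonneg: "c \<ge> 0"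
  shows "(\<integral>\<^sup>+z. ennreal (exp (- c * (cmod z)\<^sup>2)) \<partial>CN_std) = ennreal (1 / (1 + c))"
proof -
  interpret E: prob_space "density lborel (exponential_density (1 + c))"
    using c_nonneg by (intro prob_space_exponential_density) simp
  have "exponential_density 1 x * exp (- c * x) = 1 / (1 + c) * exponential_density (1 + c) x" for x
    using c_nonneg by (simp add: exponential_density_def exp_add[symmetric] field_simps add_pos_nonneg)
  then have "ennreal (exponential_density 1 x) * ennreal (exp (- c * x))
      = ennreal (1 / (1 + c)) * ennreal (exponential_density (1 + c) x)" for x
    using c_nonneg by (simp only: ennreal_mult[symmetric] exponential_density_nonneg exp_ge_zero
        zero_less_one
        add_pos_nonneg divide_nonneg_nonneg zero_le_one add_nonneg_nonneg)
  moreover have "(\<integral>\<^sup>+x. ennreal (exponential_density (1 + c) x) \<partial>lborel) = 1"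
    using E.emeasure_space_1 by (simp add: emeasure_density)
  ultimately show ?thesis
    using nn_integral_CN_cmod_square[of "\<lambda>x. ennreal (exp (- c * x))" 1]
    by (simp add: nn_integral_cmult)
qed

lemma less_fraction_iff:
  assumes "i < m" and "t \<ge> 0"
  shows "t < (cmod (w i))\<^sup>2 / sqnorm m w \<longleftrightarrow> t * sqnorm m w < (cmod (w i))\<^sup>2"
  using cmod_square_le_sqnorm[of i m w] assms
  by (cases "sqnorm m w = 0") (simp_all add: pos_less_divide_eq less_le[of 0 "sqnorm m w"])

text \<open>Given the other coordinates, the event is an exponential tail, and its conditional probability
  factorises over those coordinates.\<close>

lemma emeasure_CN_vec_fraction_gt:
  assumes m_ge_1: "m \<ge> 1" and t_range: "0 \<le> t" "t < 1"
  shows "emeasure (CN_vec {..<m}) {w \<in> space (CN_vec {..<m}). t < (cmod (w 0))\<^sup>2 / sqnorm m w}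
      = ennreal ((1 - t) ^ (m - 1))"
    (is "emeasure _ ?E = _")
proof -
  define c where "c = t / (1 - t)"
  have c_eq: "c \<ge> 0" "1 / (1 + c) = 1 - t" using t_range by (auto simp: c_def field_simps)
  let ?S = "\<lambda>w. \<Sum>i\<in>{1..<m}. (cmod (w i))\<^sup>2"
  have [measurable]: "0 \<in> {..<m}" using m_ge_1 by auto
  have tail: "(\<integral>\<^sup>+z. indicator ?E (w(0 := z)) \<partial>CN_std) = ennreal (exp (- c * ?S w))"
    if "w \<in> space (CN_vec {1..<m})" for w
  proof -
    have "t * ((cmod z)\<^sup>2 + ?S w) < (cmod z)\<^sup>2 \<longleftrightarrow> c * ?S w < (cmod z)\<^sup>2" for z
      using t_range by (simp add: c_def field_simps)
    moreover have "w(0 := z) \<in> space (CN_vec {..<m})" for z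
      using that m_ge_1 by (auto simp: space_PiM PiE_iff extensional_def)
    ultimately have "indicator ?E (w(0 := z)) = (indicator {z. c * ?S w < (cmod z)\<^sup>2} z :: ennreal)" for z
      using m_ge_1 t_range(1)
      by (simp add: indicator_def less_fraction_iff sqnorm_fun_upd_0[OF m_ge_1] del: fun_upd_apply)
         (simp add: fun_upd_same)
    moreover have "c * ?S w \<ge> 0" using c_eq by (simp add: sum_nonneg)
    ultimately show ?thesis by (simp add: emeasure_CN_std_cmod_square_gt)
  qed
  have "emeasure (CN_vec {..<m}) ?E = (\<integral>\<^sup>+w. indicator ?E w \<partial>CN_vec {..<m})"
    by (rule nn_integral_indicator[symmetric]) measurable
  also have "\<dots> = (\<integral>\<^sup>+w. ennreal (exp (- c * ?S w)) \<partial>CN_vec {1..<m})"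
    by (subst nn_integral_CN_vec_split_0[OF m_ge_1]) (measurable, rule nn_integral_cong, rule tail)
  also have "\<dots> = (\<integral>\<^sup>+w. (\<Prod>i\<in>{1..<m}. ennreal (exp (- c * (cmod (w i))\<^sup>2))) \<partial>CN_vec {1..<m})"
    by (simp add: prod_ennreal exp_sum[symmetric] sum_distrib_left sum_negf)
  also have "\<dots> = (\<Prod>i\<in>{1..<m}. ennreal (1 / (1 + c)))"
    using nn_integral_CN_std_exp_cmod_square[OF c_eq(1)] by (subst CN_vec.product_nn_integral_prod) auto
  finally show ?thesis using c_eq t_range by (simp add: ennreal_power)
qed

lemma (in sigma_finite_measure) nn_integral_power_layer_cake:
  assumes [measurable]: "V \<in> borel_measurable M" and V_nonneg: "\<And>x. V x \<ge> 0" and k_ge_1: "k \<ge> 1"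
  shows "(\<integral>\<^sup>+x. ennreal (V x ^ k) \<partial>M)
    = (\<integral>\<^sup>+t\<in>{0..}. ennreal (real k * t ^ (k - 1)) * emeasure M {x \<in> space M. t < V x} \<partial>lborel)"
proof -
  have power_eq_integral: "ennreal (v ^ k)
      = (\<integral>\<^sup>+t\<in>{0..}. ennreal (real k * t ^ (k - 1)) * indicator {..<v} t \<partial>lborel)"
    if "v \<ge> 0" for v :: real
  proof -
    have "(\<integral>\<^sup>+t\<in>{0..}. ennreal (real k * t ^ (k - 1)) * indicator {..<v} t \<partial>lborel)
        = (\<integral>\<^sup>+t. ennreal (real k * t ^ (k - 1)) * indicator {0..v} t \<partial>lborel)"
      by (rule nn_integral_cong_AE)
         (use that in \<open>auto intro!: AE_I'[of "{v}"] simp: indicator_def split: if_splits\<close>)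
    also have "\<dots> = ennreal (v ^ k - 0 ^ k)"
      by (rule nn_integral_FTC_Icc) (use that in \<open>auto intro!: derivative_eq_intros\<close>)
    finally show ?thesis using k_ge_1 by (cases k) auto
  qed
  have "(\<integral>\<^sup>+x. ennreal (V x ^ k) \<partial>M)
      = (\<integral>\<^sup>+x. \<integral>\<^sup>+t. ennreal (real k * t ^ (k - 1)) * indicator {0..} t
      * indicator {y \<in> space M. t < V y} x \<partial>lborel \<partial>M)"
    using V_nonneg by (intro nn_integral_cong)
      (auto simp: power_eq_integral indicator_def intro!: nn_integral_cong)
  also have "\<dots>
      = (\<integral>\<^sup>+t. \<integral>\<^sup>+x. ennreal (real k * t ^ (k - 1)) * indicator {0..} t
      * indicator {y \<in> space M. t < V y} x \<partial>M \<partial>lborel)"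
    by (rule nn_integral_swap[OF sigma_finite_measure_axioms lborel.sigma_finite_measure_axioms]) measurable
  finally show ?thesis by (simp add: nn_integral_cmult mult.commute mult.left_commute)
qed

lemma nn_integral_Beta_nat:
  assumes "k \<ge> 1" and "m \<ge> 1"
  shows "(\<integral>\<^sup>+t\<in>{0..1}. ennreal (real k * t ^ (k - 1) * (1 - t) ^ (m - 1)) \<partial>lborel)
     = ennreal (fact k * fact (m - 1) / fact (k + (m - 1)))"
proof -
  obtain i j where Suc_ij: "k = Suc i" "m = Suc j" using assms by (metis Suc_le_D One_nat_def)
  have "Gamma (real k) = fact i" "Gamma (real m) = fact j" "Gamma (real k + real m) = fact (k + j)"
    using Gamma_fact[of i, where 'a=real] Gamma_fact[of j, where 'a=real] Gamma_fact[of "k + j",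
      where 'a=real]
    by (simp_all add: Suc_ij ac_simps)
  then have "real k * Beta (real k) (real m) = fact k * fact (m - 1) / fact (k + (m - 1))"
    by (simp add: Beta_def Suc_ij)
  moreover have "((\<lambda>t. real k * (t powr (real k - 1) * (1 - t) powr (real m - 1)))
      has_integral real k * Beta (real k) (real m)) {0..1}"
    using assms by (intro has_integral_mult_right has_integral_Beta_real) auto
  then have "((\<lambda>t. real k * (t ^ (k - 1) * (1 - t) ^ (m - 1)))
      has_integral real k * Beta (real k) (real m)) {0..1}"
    by (rule has_integral_spike_finite[of "{0, 1}", rotated 2]) (auto simp: Suc_ij powr_realpow)
  ultimately have "((\<lambda>t. real k * (t ^ (k - 1) * (1 - t) ^ (m - 1)))
      has_integral fact k * fact (m - 1) / fact (k + (m - 1))) {0..1}"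
    by simp
  from nn_integral_has_integral_lebesgue[OF _ this]
  show ?thesis
    by (auto simp: ennreal_mult' mult_ac ennreal_indicator[symmetric] zero_le_mult_iff
      ennreal_mult''[symmetric] simp del: ennreal_indicator)
qed

lemma nn_integral_CN_vec_fraction_power:
  assumes m_ge_1: "m \<ge> 1"
  shows "(\<integral>\<^sup>+w. ennreal (((cmod (w 0))\<^sup>2 / sqnorm m w) ^ k) \<partial>CN_vec {..<m})
     = ennreal (fact k * fact (m - 1) / fact (k + (m - 1)))"
proof (cases "k = 0")
  case True
  then show ?thesis using prob_space.emeasure_space_1[OF prob_space_CN_vec] by simp
next
  case False
  interpret V: prob_space "CN_vec {..<m}" by (rule prob_space_CN_vec)
  let ?V = "\<lambda>w. (cmod (w 0))\<^sup>2 / sqnorm m w"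
  let ?tail = "\<lambda>t. emeasure (CN_vec {..<m}) {w \<in> space (CN_vec {..<m}). t < ?V w}"
  have [measurable]: "0 \<in> {..<m}" using m_ge_1 by auto
  have tail_eq_0: "?tail t = 0" if "t > 1" for t
  proof -
    have "?V w \<le> 1" for w using cmod_square_le_sqnorm[of 0 m w] m_ge_1 by (simp add: divide_le_eq_1 less_le)
    then have "\<not> t < ?V w" for w using that by (metis leD order.strict_trans2 order_less_asym)
    then show ?thesis by simp
  qed
  have "(\<integral>\<^sup>+w. ennreal (?V w ^ k) \<partial>CN_vec {..<m})
      = (\<integral>\<^sup>+t\<in>{0..}. ennreal (real k * t ^ (k - 1)) * ?tail t \<partial>lborel)"
    by (rule V.nn_integral_power_layer_cake) (use False in auto)
  also have "\<dots> = (\<integral>\<^sup>+t\<in>{0..1}. ennreal (real k * t ^ (k - 1) * (1 - t) ^ (m - 1)) \<partial>lborel)"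
  proof (rule nn_integral_cong_AE)
    show "AE t in lborel. ennreal (real k * t ^ (k - 1)) * ?tail t * indicator {0..} t
      = ennreal (real k * t ^ (k - 1) * (1 - t) ^ (m - 1)) * indicator {0..1} t"
      using AE_lborel_singleton[of "1::real"]
    proof eventually_elim
      case (elim t)
      then consider "t < 0" | "0 \<le> t" "t < 1" | "t > 1" by linarith
      then show ?case
        by cases (simp_all add: emeasure_CN_vec_fraction_gt[OF m_ge_1] tail_eq_0 indicator_def
          ennreal_mult[symmetric])
    qed
  qed
  also have "\<dots> = ennreal (fact k * fact (m - 1) / fact (k + (m - 1)))"
    using False m_ge_1 by (intro nn_integral_Beta_nat) auto
  finally show ?thesis .
qed

lemma CN_vec_direction_phase_average:
  assumes m_ge_1: "m \<ge> 1"
  shows "(\<integral>\<^sup>+w. ennreal (exp (2 * Re (b * w 0 / of_real (sqrt (sqnorm m w))))) \<partial>CN_vec {..<m})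
     = (\<integral>\<^sup>+w. ennreal (bessel_series 0 ((cmod b)\<^sup>2 * ((cmod (w 0))\<^sup>2 / sqnorm m w))) \<partial>CN_vec {..<m})"
proof -
  let ?S = "\<lambda>w. \<Sum>i\<in>{1..<m}. (cmod (w i))\<^sup>2"
  have [measurable]: "0 \<in> {..<m}" using m_ge_1 by auto
  have phase_average: "(\<integral>\<^sup>+z. ennreal (exp (2 * Re (b * z / of_real (sqrt ((cmod z)\<^sup>2 + ?S w))))) \<partial>CN_std)
      = (\<integral>\<^sup>+z. ennreal (bessel_series 0 ((cmod b)\<^sup>2 * ((cmod z)\<^sup>2 / ((cmod z)\<^sup>2 + ?S w)))) \<partial>CN_std)" for w
  proof -
    let ?g = "\<lambda>r. b / of_real (sqrt (r\<^sup>2 + ?S w))"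
    have "(cmod (?g (cmod z) * z))\<^sup>2 = (cmod b)\<^sup>2 * ((cmod z)\<^sup>2 / ((cmod z)\<^sup>2 + ?S w))" for z
      by (simp add: norm_divide norm_mult power_divide power_mult_distrib sum_nonneg)
    then show ?thesis
      using circularly_symmetric_nn_integral_exp[OF circularly_symmetric_CN
        CN_std.sigma_finite_measure_axioms, of "\<lambda>_. 1" ?g]
      by simp
  qed
  show ?thesis
    by (subst (1 2) nn_integral_CN_vec_split_0[OF m_ge_1])
       (measurable, simp only: sqnorm_fun_upd_0[OF m_ge_1] fun_upd_same phase_average)
qed

lemma CN_vec_direction_mgf:
  assumes m_ge_1: "m \<ge> 1"
  shows "(\<integral>\<^sup>+w. ennreal (exp (2 * Re (b * w 0 / of_real (sqrt (sqnorm m w))))) \<partial>CN_vec {..<m})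
     = ennreal (fact (m - 1) * bessel_series (m - 1) ((cmod b)\<^sup>2))"
proof -
  let ?V = "\<lambda>w. (cmod (w 0))\<^sup>2 / sqnorm m w" and ?\<beta> = "(cmod b)\<^sup>2"
  have [measurable]: "0 \<in> {..<m}" using m_ge_1 by auto
  have bessel_expansion: "ennreal (bessel_series 0 (?\<beta> * ?V w))
      = (\<Sum>k. ennreal (?\<beta> ^ k / (fact k)\<^sup>2) * ennreal (?V w ^ k))" for w
    by (subst ennreal_bessel_series)
       (simp_all add: power_mult_distrib power_divide power2_eq_square ennreal_mult'[symmetric] mult_ac)
  have "(\<integral>\<^sup>+w. ennreal (exp (2 * Re (b * w 0 / of_real (sqrt (sqnorm m w))))) \<partial>CN_vec {..<m})
      = (\<integral>\<^sup>+w. (\<Sum>k. ennreal (?\<beta> ^ k / (fact k)\<^sup>2) * ennreal (?V w ^ k)) \<partial>CN_vec {..<m})"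
    by (simp only: CN_vec_direction_phase_average[OF m_ge_1] bessel_expansion)
  also have "\<dots> = (\<Sum>k. \<integral>\<^sup>+w. ennreal (?\<beta> ^ k / (fact k)\<^sup>2) * ennreal (?V w ^ k) \<partial>CN_vec {..<m})"
    by (rule nn_integral_suminf) measurable
  also have "\<dots> = (\<Sum>k. ennreal (?\<beta> ^ k / (fact k)\<^sup>2) * ennreal (fact k * fact (m - 1) / fact (k + (m - 1))))"
    by (subst nn_integral_cmult) (measurable, simp only: nn_integral_CN_vec_fraction_power[OF m_ge_1])
  also have "\<dots> = (\<Sum>k. ennreal (fact (m - 1)) * ennreal (?\<beta> ^ k / (fact k * fact (k + (m - 1)))))"
    by (intro suminf_cong) (simp add: ennreal_mult[symmetric] power2_eq_square mult_ac)
  also have "\<dots> = ennreal (fact (m - 1) * bessel_series (m - 1) ?\<beta>)"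
    by (simp add: ennreal_suminf_cmult ennreal_bessel_series ennreal_mult')
  finally show ?thesis .
qed

section \<open>Gaussian likelihood ratios\<close>

definition cn_lr :: "complex \<Rightarrow> real \<Rightarrow> complex \<Rightarrow> real" where
  "cn_lr mu s z = cn_density mu s z / cn_density 0 1 z"

lemma cn_lr_pos: "s > 0 \<Longrightarrow> cn_lr mu s z > 0"
  by (simp add: cn_lr_def cn_density_pos)

lemma borel_measurable_cn_lr [measurable]:
  assumes [measurable]: "f \<in> borel_measurable M" "g \<in> borel_measurable M" "h \<in> borel_measurable M"
  shows "(\<lambda>x. cn_lr (f x) (g x) (h x)) \<in> borel_measurable M"
  unfolding cn_lr_def by measurable

lemma cn_lr_altdef: "cn_lr mu s z = exp ((cmod z)\<^sup>2 - (cmod (z - mu))\<^sup>2 / s) / s"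
  by (simp add: cn_lr_def cn_density_def exp_diff exp_minus field_simps flip: minus_divide_left)

lemma cn_lr_shift: "cn_lr a 1 z = exp (2 * Re (cnj a * z) - (cmod a)\<^sup>2)"
proof -
  have "(cmod z)\<^sup>2 - (cmod (z - a))\<^sup>2 = 2 * Re (cnj a * z) - (cmod a)\<^sup>2"
    unfolding cmod_power2 by (simp add: power2_eq_square algebra_simps)
  then show ?thesis by (simp add: cn_lr_altdef)
qed

lemma cn_lr_0_1 [simp]: "cn_lr 0 1 z = 1"
  by (simp add: cn_lr_shift)

lemma cn_lr_le:
  assumes "s \<ge> 1" shows "cn_lr mu s z \<le> exp ((cmod z)\<^sup>2)"
proof -
  have "cn_lr mu s z \<le> exp ((cmod z)\<^sup>2 - (cmod (z - mu))\<^sup>2 / s) / 1"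
    unfolding cn_lr_altdef using assms by (intro divide_left_mono) auto
  also have "\<dots> \<le> exp ((cmod z)\<^sup>2)" using assms by simp
  finally show ?thesis .
qed

lemma CN_eq_density_CN_std:
  assumes "s > 0"
  shows "CN mu s = density CN_std (\<lambda>z. ennreal (cn_lr mu s z))"
proof -
  have "cn_density 0 1 z * cn_lr mu s z = cn_density mu s z" for z
    using cn_density_pos[of 1 0 z] by (simp add: cn_lr_def)
  then have "ennreal (cn_density 0 1 z) * ennreal (cn_lr mu s z) = ennreal (cn_density mu s z)" for z
    using assms by (simp add: ennreal_mult[symmetric] cn_density_pos cn_lr_pos less_imp_le)
  then show ?thesis
    unfolding CN_def by (subst density_density_eq) simp_all
qed

lemma cn_density_bayes:
  assumes s_pos: "s > 0" and t_pos: "t > 0"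
  shows "cn_density mu s h * cn_density (of_real a * h) t v =
     cn_density (of_real a * mu) (s * a\<^sup>2 + t) v *
     cn_density ((of_real (s * a) * v + of_real t * mu) / of_real (s * a\<^sup>2 + t)) (s * t / (s * a\<^sup>2 + t)) h"
proof -
  let ?d = "s * a\<^sup>2 + t"
  let ?n = "of_real (s * a) * v + of_real t * mu"
  have d_pos: "?d > 0" using s_pos t_pos by (simp add: add_nonneg_pos)
  have "h - ?n / of_real ?d = (of_real ?d * h - ?n) / of_real ?d"
    using d_pos by (simp add: field_simps del: of_real_add of_real_mult)
  then have posterior_centre: "(cmod (h - ?n / of_real ?d))\<^sup>2 = (cmod (of_real ?d * h - ?n))\<^sup>2 / ?d\<^sup>2"
    using d_pos by (simp add: norm_divide power_divide del: of_real_add of_real_mult)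
  have complete_square: "?d * t * (cmod (h - mu))\<^sup>2 + ?d * s * (cmod (v - of_real a * h))\<^sup>2 =
     s * t * (cmod (v - of_real a * mu))\<^sup>2 + (cmod (of_real ?d * h - ?n))\<^sup>2"
    unfolding cmod_power2 by (simp add: power2_eq_square algebra_simps)
  have "(cmod (h - mu))\<^sup>2 / s + (cmod (v - of_real a * h))\<^sup>2 / t =
      (?d * t * (cmod (h - mu))\<^sup>2 + ?d * s * (cmod (v - of_real a * h))\<^sup>2) / (s * t * ?d)"
    using s_pos t_pos d_pos by (simp add: add_divide_distrib)
  also have "\<dots> = (cmod (v - of_real a * mu))\<^sup>2 / ?d + (cmod (h - ?n / of_real ?d))\<^sup>2 / (s * t / ?d)"
    unfolding posterior_centre complete_square
    using s_pos t_pos d_pos by (simp add: add_divide_distrib power2_eq_square)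
  finally have "exp (- (cmod (h - mu))\<^sup>2 / s) * exp (- (cmod (v - of_real a * h))\<^sup>2 / t) =
      exp (- (cmod (v - of_real a * mu))\<^sup>2 / ?d) * exp (- (cmod (h - ?n / of_real ?d))\<^sup>2 / (s * t / ?d))"
    by (simp add: exp_add[symmetric])
  moreover have "(pi * s) * (pi * t) = (pi * ?d) * (pi * (s * t / ?d))"
    using d_pos by simp
  ultimately show ?thesis
    unfolding cn_density_def by (simp only: times_divide_times_eq)
qed

lemma nn_integral_cn_lr_mixture:
  assumes s_pos: "s > 0"
  shows "(\<integral>\<^sup>+h. ennreal (cn_lr (of_real a * h) 1 v) \<partial>CN mu s)
      = ennreal (cn_lr (of_real a * mu) (s * a\<^sup>2 + 1) v)"
proof -
  define d where "d = s * a\<^sup>2 + 1"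
  define p where "p = (of_real (s * a) * v + of_real 1 * mu) / of_real d"
  have d_pos: "d > 0" "s * 1 / d > 0" using s_pos by (simp_all add: d_def add_nonneg_pos)
  have "cn_density mu s h * cn_lr (of_real a * h) 1 v
      = cn_lr (of_real a * mu) d v * cn_density p (s * 1 / d) h" for h
    using cn_density_bayes[OF s_pos zero_less_one, of mu h a v] by (simp add: cn_lr_def p_def d_def)
  then have "ennreal (cn_density mu s h) * ennreal (cn_lr (of_real a * h) 1 v)
      = ennreal (cn_lr (of_real a * mu) d v) * ennreal (cn_density p (s * 1 / d) h)" for h
    using s_pos d_pos by (simp only: ennreal_mult[symmetric] cn_density_pos cn_lr_pos less_imp_le
      zero_less_one)
  then have "(\<integral>\<^sup>+h. ennreal (cn_lr (of_real a * h) 1 v) \<partial>CN mu s)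
      = ennreal (cn_lr (of_real a * mu) d v) * (\<integral>\<^sup>+h. ennreal (cn_density p (s * 1 / d) h) \<partial>lborel)"
    by (simp add: nn_integral_CN nn_integral_cmult)
  also have "(\<integral>\<^sup>+h. ennreal (cn_density p (s * 1 / d) h) \<partial>lborel) = emeasure (CN p (s * 1 / d)) UNIV"
    by (simp add: CN_def emeasure_density)
  also have "\<dots> = 1" using d_pos(2) by (rule emeasure_CN_UNIV)
  finally show ?thesis by (simp add: d_def)
qed

lemma nn_integral_CN_posterior:
  assumes s_pos: "s > 0" and t_pos: "t > 0"
    and [measurable]: "(\<lambda>(x, y). F x y) \<in> borel_measurable (borel \<Otimes>\<^sub>M borel)"
  shows "(\<integral>\<^sup>+h. \<integral>\<^sup>+e. F h (h + e) \<partial>CN 0 t \<partial>CN mu s)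
     = (\<integral>\<^sup>+v. \<integral>\<^sup>+h. F h v \<partial>CN ((of_real s * v + of_real t * mu) / of_real (s + t)) (s * t / (s + t))
     \<partial>CN mu (s + t))"
proof -
  have "(\<integral>\<^sup>+e. F h (h + e) \<partial>CN 0 t) = (\<integral>\<^sup>+v. F h v \<partial>CN h t)" for h
    using nn_integral_CN_affine[where f="F h" and a=h and b=1 and mu=0 and s=t] by simp
  then have "(\<integral>\<^sup>+h. \<integral>\<^sup>+e. F h (h + e) \<partial>CN 0 t \<partial>CN mu s)
      = (\<integral>\<^sup>+h. \<integral>\<^sup>+v. ennreal (cn_density mu s h * cn_density h t v) * F h v \<partial>lborel \<partial>lborel)"
    using s_pos t_pos by (simp add: nn_integral_CN nn_integral_cmult[symmetric] ennreal_mult' cn_density_pos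
      less_imp_le mult.assoc)
  also have "\<dots> = (\<integral>\<^sup>+v. \<integral>\<^sup>+h. ennreal (cn_density mu s h * cn_density h t v) * F h v \<partial>lborel \<partial>lborel)"
    by (rule lborel_pair.Fubini'[symmetric]) measurable
  also have "\<dots>
      = (\<integral>\<^sup>+v. \<integral>\<^sup>+h. F h v \<partial>CN ((of_real s * v + of_real t * mu) / of_real (s + t)) (s * t / (s + t))
      \<partial>CN mu (s + t))"
    using s_pos t_pos cn_density_bayes[OF s_pos t_pos, of mu _ 1]
    by (simp add: nn_integral_CN nn_integral_cmult[symmetric] ennreal_mult' cn_density_pos less_imp_le
      mult.assoc)
  finally show ?thesis .
qed

definition cdot :: "nat \<Rightarrow> (nat \<Rightarrow> complex) \<Rightarrow> (nat \<Rightarrow> complex) \<Rightarrow> complex" where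
  "cdot m u w = (\<Sum>j<m. cnj (u j) * w j)"

lemma borel_measurable_cdot [measurable]: "cdot m u \<in> borel_measurable (CN_vec {..<m})"
  unfolding cdot_def[abs_def] by measurable

lemma cdot_le:
  assumes "sqnorm m u = 1" shows "(cmod (cdot m u w))\<^sup>2 \<le> sqnorm m w"
proof -
  have "cmod (cdot m u w) \<le> (\<Sum>j<m. \<bar>cmod (u j)\<bar> * \<bar>cmod (w j)\<bar>)"
    unfolding cdot_def by (rule order_trans[OF norm_sum]) (simp add: norm_mult)
  also have "\<dots> \<le> L2_set (\<lambda>j. cmod (u j)) {..<m} * L2_set (\<lambda>j. cmod (w j)) {..<m}"
    by (rule L2_set_mult_ineq)
  also have "\<dots> = sqrt (sqnorm m w)" using assms by (simp add: L2_set_def sqnorm_def)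
  finally show ?thesis using power_mono[of "cmod (cdot m u w)" "sqrt (sqnorm m w)" 2] by simp
qed

lemma nn_integral_CN_vec_cdot:
  assumes "m \<ge> 1" and "sqnorm m u = 1" and "(\<lambda>(x, y). F x y) \<in> borel_measurable (borel \<Otimes>\<^sub>M borel)"
  shows "(\<integral>\<^sup>+w. F (cdot m u w) (sqnorm m w) \<partial>CN_vec {..<m}) = (\<integral>\<^sup>+w. F (w 0) (sqnorm m w) \<partial>CN_vec {..<m})"
  using nn_integral_CN_vec_linear[of "{..<m}" 0 F "\<lambda>j. cnj (u j)"] assms
  by (simp add: cdot_def sqnorm_def)

lemma prod_cn_lr_shift:
  assumes "sqnorm m u = 1"
  shows "(\<Prod>j<m. cn_lr (c * u j) 1 (w j)) = cn_lr c 1 (cdot m u w)"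
proof -
  have "(\<Sum>j<m. 2 * Re (cnj (c * u j) * w j) - (cmod (c * u j))\<^sup>2)
      = 2 * Re (\<Sum>j<m. cnj (c * u j) * w j) - (cmod c)\<^sup>2 * sqnorm m u"
    by (simp add: sum_subtractf sum_distrib_left sqnorm_def norm_mult power_mult_distrib)
  also have "(\<Sum>j<m. cnj (c * u j) * w j) = cnj c * cdot m u w"
    by (simp add: cdot_def sum_distrib_left mult.assoc)
  finally show ?thesis
    using assms by (simp add: cn_lr_shift flip: exp_sum)
qed

lemma distr_CN_vec_affine:
  assumes finite_I: "finite I" and b_neq_0: "\<And>i. b i \<noteq> 0"
  shows "distr (CN_vec I) (CN_vec I) (\<lambda>w. \<lambda>i\<in>I. a i + b i * w i)
    = density (CN_vec I) (\<lambda>w. \<Prod>i\<in>I. ennreal (cn_lr (a i) ((cmod (b i))\<^sup>2) (w i)))"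
proof -
  have component_law: "distr CN_std CN_std (\<lambda>z. a i + b i * z)
      = density CN_std (\<lambda>z. ennreal (cn_lr (a i) ((cmod (b i))\<^sup>2) z))" for i
  proof -
    have "distr CN_std CN_std (\<lambda>z. a i + b i * z) = distr CN_std borel (\<lambda>z. a i + b i * z)"
      by (rule distr_cong) simp_all
    then show ?thesis
      using b_neq_0[of i] by (simp add: distr_CN_affine CN_eq_density_CN_std[symmetric])
  qed
  have "distr (CN_vec I) (CN_vec I) (\<lambda>w. \<lambda>i\<in>I. a i + b i * w i)
      = PiM I (\<lambda>i. distr CN_std CN_std (\<lambda>z. a i + b i * z))"
    by (rule distr_PiM_components[OF finite_I CN_std.prob_space_axioms]) measurable
  also have "\<dots> = density (CN_vec I) (\<lambda>w. \<Prod>i\<in>I. ennreal (cn_lr (a i) ((cmod (b i))\<^sup>2) (w i)))"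
    unfolding component_law
  proof (rule density_PiM[OF finite_I CN_std.prob_space_axioms, symmetric])
    show "prob_space (density CN_std (\<lambda>z. ennreal (cn_lr (a i) ((cmod (b i))\<^sup>2) z)))" for i
      unfolding component_law[symmetric] by (rule CN_std.prob_space_distr) measurable
  qed measurable
  finally show ?thesis .
qed

lemma nn_integral_CN_vec_shift:
  assumes unit_u: "sqnorm m u = 1" and [measurable]: "F \<in> borel_measurable (CN_vec {..<m})"
  shows "(\<integral>\<^sup>+w. F (\<lambda>j\<in>{..<m}. c * u j + w j) \<partial>CN_vec {..<m})
     = (\<integral>\<^sup>+w. ennreal (cn_lr c 1 (cdot m u w)) * F w \<partial>CN_vec {..<m})"
proof -
  have "distr (CN_vec {..<m}) (CN_vec {..<m}) (\<lambda>w. \<lambda>j\<in>{..<m}. c * u j + w j)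
      = density (CN_vec {..<m}) (\<lambda>w. ennreal (cn_lr c 1 (cdot m u w)))"
    using distr_CN_vec_affine[of "{..<m}" "\<lambda>_. 1" "\<lambda>j. c * u j"]
    by (simp add: prod_ennreal cn_lr_pos less_imp_le prod_cn_lr_shift[OF unit_u])
  moreover have "(\<integral>\<^sup>+w. F (\<lambda>j\<in>{..<m}. c * u j + w j) \<partial>CN_vec {..<m})
      = (\<integral>\<^sup>+w. F w \<partial>distr (CN_vec {..<m}) (CN_vec {..<m}) (\<lambda>w. \<lambda>j\<in>{..<m}. c * u j + w j))"
    by (subst nn_integral_distr) auto
  ultimately show ?thesis by (simp add: nn_integral_density)
qed

section \<open>Output density of one coherence block\<close>

lemma nn_integral_CN_noncentral:
  assumes s_pos: "s > 0" and [measurable]: "k \<in> borel_measurable borel"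
  shows "(\<integral>\<^sup>+h. k ((cmod h)\<^sup>2) \<partial>CN mu s) = (\<integral>\<^sup>+x. ennreal (exponential_density (1 / s) x *
      (exp (- (cmod mu)\<^sup>2 / s) * bessel_series 0 (x * (cmod mu)\<^sup>2 / s\<^sup>2))) * k x \<partial>lborel)"
proof -
  define b where "b = cnj mu / of_real s"
  define e where "e = exp (- (cmod mu)\<^sup>2 / s)"
  have cmod_b_mult: "(cmod (b * h))\<^sup>2 = (cmod h)\<^sup>2 * (cmod mu)\<^sup>2 / s\<^sup>2" for h
    by (simp add: b_def norm_divide norm_mult power_divide power_mult_distrib mult.commute)
  have density_expansion: "cn_density mu s h = cn_density 0 s h * (e * exp (2 * Re (b * h)))" for h
  proof -
    have "- (cmod (h - mu))\<^sup>2 / s = - (cmod h)\<^sup>2 / s + (- (cmod mu)\<^sup>2 / s + 2 * Re (b * h))"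
      using s_pos unfolding cmod_power2 b_def by (simp add: power2_eq_square field_simps)
    then have "exp (- (cmod (h - mu))\<^sup>2 / s) = exp (- (cmod h)\<^sup>2 / s) * (e * exp (2 * Re (b * h)))"
      by (simp only: exp_add e_def)
    then show ?thesis by (simp only: cn_density_def diff_0_right times_divide_eq_left)
  qed
  have "(\<integral>\<^sup>+h. k ((cmod h)\<^sup>2) \<partial>CN mu s)
      = (\<integral>\<^sup>+h. (k ((cmod h)\<^sup>2) * ennreal e) * ennreal (exp (2 * Re (b * h))) \<partial>CN 0 s)"
    using s_pos by (simp add: nn_integral_CN density_expansion ennreal_mult cn_density_pos less_imp_le e_def
      mult_ac del: mult_minus_left)
  also have "\<dots>
      = (\<integral>\<^sup>+h. (k ((cmod h)\<^sup>2) * ennreal e) * ennreal (bessel_series 0 ((cmod (b * h))\<^sup>2)) \<partial>CN 0 s)"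
    by (rule circularly_symmetric_nn_integral_exp[OF circularly_symmetric_CN
          prob_space_imp_sigma_finite[OF prob_space_CN[OF s_pos]], where k="\<lambda>r. k (r\<^sup>2) * ennreal e"])
            measurable
  also have "\<dots> = (\<integral>\<^sup>+x. ennreal (exponential_density (1 / s) x) *
      (k x * ennreal e * ennreal (bessel_series 0 (x * (cmod mu)\<^sup>2 / s\<^sup>2))) \<partial>lborel)"
    unfolding cmod_b_mult
    by (rule nn_integral_CN_cmod_square[where f="\<lambda>x. k x * ennreal e
        * ennreal (bessel_series 0 (x * (cmod mu)\<^sup>2 / s\<^sup>2))", OF _ s_pos])
       measurable
  also have "\<dots>
      = (\<integral>\<^sup>+x. ennreal (exponential_density (1 / s) x * (e * bessel_series 0 (x * (cmod mu)\<^sup>2 / s\<^sup>2)))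
      * k x \<partial>lborel)"
    using s_pos by (intro nn_integral_cong)
      (simp add: ennreal_mult' e_def exponential_density_nonneg mult_ac)
  finally show ?thesis by (simp add: e_def)
qed

text \<open>The zero vector is sent to \<open>e\<^sub>1\<close>, so that every seed yields a codeword of exactly the prescribed
  power.\<close>

definition unit_dir :: "nat \<Rightarrow> (nat \<Rightarrow> complex) \<Rightarrow> nat \<Rightarrow> complex" where
  "unit_dir m g j = (if sqnorm m g = 0 then (if j = 0 then 1 else 0)
    else g j / of_real (sqrt (sqnorm m g)))"

lemma sqnorm_unit_dir:
  assumes "m \<ge> 1" shows "sqnorm m (unit_dir m g) = 1"
proof (cases "sqnorm m g = 0")
  case True
  have "unit_dir m g = (\<lambda>_. 0)(0 := 1)" using True by (auto simp: unit_dir_def)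
  then show ?thesis by (simp add: sqnorm_fun_upd_0[OF assms] del: fun_upd_apply)
next
  case False
  then have "sqnorm m (unit_dir m g) = (\<Sum>i<m. (cmod (g i))\<^sup>2) / sqnorm m g"
    unfolding sqnorm_def[of m "unit_dir m g"]
    by (simp add: unit_dir_def norm_divide power_divide sum_divide_distrib)
  then show ?thesis using False by (simp add: sqnorm_def)
qed

lemma measurable_unit_dir [measurable]: "j < m \<Longrightarrow> (\<lambda>g. unit_dir m g j) \<in> borel_measurable (CN_vec {..<m})"
  unfolding unit_dir_def by measurable

lemma measurable_cdot_unit_dir [measurable]:
  assumes measurable_f: "f \<in> measurable M (CN_vec {..<m})"
    and [measurable]: "\<And>j. j < m \<Longrightarrow> (\<lambda>x. h x j) \<in> borel_measurable M"
  shows "(\<lambda>x. cdot m (unit_dir m (f x)) (h x)) \<in> borel_measurable M"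
proof -
  have [measurable]: "(\<lambda>x. unit_dir m (f x) j) \<in> borel_measurable M" if "j < m" for j
    by (rule measurable_compose[OF measurable_f measurable_unit_dir[OF that]])
  show ?thesis unfolding cdot_def by measurable
qed

lemma AE_sqnorm_neq_0:
  assumes m_ge_1: "m \<ge> 1" shows "AE w in CN_vec {..<m}. sqnorm m w \<noteq> 0"
proof -
  have "AE w in CN_vec {..<m}. w 0 \<noteq> 0"
    using m_ge_1 by (intro AE_PiM_component[where M="\<lambda>_. CN_std" and P="\<lambda>z. z \<noteq> 0"] CN_std.prob_space_axioms
      AE_CN_neq) simp
  then show ?thesis
  proof eventually_elim
    case (elim w)
    then have "0 < (cmod (w 0))\<^sup>2" by simp
    also have "\<dots> \<le> sqnorm m w" using m_ge_1 by (intro cmod_square_le_sqnorm) simp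
    finally show ?case by simp
  qed
qed

lemma unit_dir_mgf:
  assumes m_ge_1: "m \<ge> 1"
  shows "(\<integral>\<^sup>+g. ennreal (exp (2 * Re (c * cdot m (unit_dir m g) w))) \<partial>CN_vec {..<m})
     = ennreal (fact (m - 1) * bessel_series (m - 1) ((cmod c)\<^sup>2 * sqnorm m w))"
proof -
  let ?F = "\<lambda>x y. ennreal (exp (2 * Re (cnj c * x / of_real (sqrt y))))"
  have "ennreal (exp (2 * Re (c * cdot m (unit_dir m g) w)))
      = ?F (\<Sum>j<m. cnj (w j) * g j) (\<Sum>j<m. (cmod (g j))\<^sup>2)"
    if "sqnorm m g \<noteq> 0" for g
  proof -
    have "c * cdot m (unit_dir m g) w = cnj (cnj c * (\<Sum>j<m. cnj (w j) * g j) / of_real (sqrt (sqnorm m g)))"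
      using that by (simp add: cdot_def unit_dir_def sum_divide_distrib sum_distrib_left mult_ac)
    then have "Re (c * cdot m (unit_dir m g) w)
        = Re (cnj c * (\<Sum>j<m. cnj (w j) * g j) / of_real (sqrt (sqnorm m g)))"
      by (simp only: cnj.sel)
    then show ?thesis by (simp only: sqnorm_def)
  qed
  then have "(\<integral>\<^sup>+g. ennreal (exp (2 * Re (c * cdot m (unit_dir m g) w))) \<partial>CN_vec {..<m})
     = (\<integral>\<^sup>+g. ?F (\<Sum>j<m. cnj (w j) * g j) (\<Sum>j<m. (cmod (g j))\<^sup>2) \<partial>CN_vec {..<m})"
    using AE_sqnorm_neq_0[OF m_ge_1] by (intro nn_integral_cong_AE) (auto elim: eventually_mono)
  also have "\<dots>
      = (\<integral>\<^sup>+g. ?F (of_real (sqrt (\<Sum>j<m. (cmod (cnj (w j)))\<^sup>2)) * g 0) (\<Sum>j<m. (cmod (g j))\<^sup>2)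
      \<partial>CN_vec {..<m})"
    by (rule nn_integral_CN_vec_linear) (use m_ge_1 in auto)
  also have "\<dots>
      = (\<integral>\<^sup>+g. ennreal (exp (2 * Re ((cnj c * of_real (sqrt (sqnorm m w))) * g 0
          / of_real (sqrt (sqnorm m g))))) \<partial>CN_vec {..<m})"
    by (simp only: sqnorm_def[symmetric] complex_mod_cnj mult.assoc)
  also have "\<dots>
      = ennreal (fact (m - 1) * bessel_series (m - 1) ((cmod (cnj c * of_real (sqrt (sqnorm m w))))\<^sup>2))"
    by (rule CN_vec_direction_mgf[OF m_ge_1])
  finally show ?thesis by (simp add: norm_mult power_mult_distrib)
qed

lemma nn_integral_unit_dir_cn_lr:
  assumes m_ge_1: "m \<ge> 1"
  shows "(\<integral>\<^sup>+g. ennreal (cn_lr c 1 (cdot m (unit_dir m g) w)) \<partial>CN_vec {..<m})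
    = ennreal (exp (- (cmod c)\<^sup>2) * (fact (m - 1) * bessel_series (m - 1) ((cmod c)\<^sup>2 * sqnorm m w)))"
proof -
  have "ennreal (cn_lr c 1 z) = ennreal (exp (- (cmod c)\<^sup>2)) * ennreal (exp (2 * Re (cnj c * z)))" for z
    by (simp only: cn_lr_shift ennreal_mult[symmetric] exp_ge_zero exp_add[symmetric] uminus_add_conv_diff)
  then have "(\<integral>\<^sup>+g. ennreal (cn_lr c 1 (cdot m (unit_dir m g) w)) \<partial>CN_vec {..<m})
      = ennreal (exp (- (cmod c)\<^sup>2))
      * (\<integral>\<^sup>+g. ennreal (exp (2 * Re (cnj c * cdot m (unit_dir m g) w))) \<partial>CN_vec {..<m})"
    by (simp only:) (rule nn_integral_cmult, measurable)
  then show ?thesis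
    unfolding unit_dir_mgf[OF m_ge_1] complex_mod_cnj by (simp add: ennreal_mult')
qed

definition noise_density :: "nat \<Rightarrow> (nat \<Rightarrow> complex) \<Rightarrow> real" where
  "noise_density m w = exp (- sqnorm m w) / pi ^ m"

abbreviation faded_lr :: "real \<Rightarrow> complex \<Rightarrow> real \<Rightarrow> nat \<Rightarrow> complex \<Rightarrow> real" where
  "faded_lr \<rho> mu s m \<equiv> cn_lr (of_real (sqrt (real m * \<rho>)) * mu) (s * (real m * \<rho>) + 1)"

definition block_lr :: "real \<Rightarrow> complex \<Rightarrow> real \<Rightarrow> nat \<Rightarrow> (nat \<Rightarrow> complex) \<Rightarrow> (nat \<Rightarrow> complex) \<Rightarrow> real" where
  "block_lr \<rho> mu s m u w = faded_lr \<rho> mu s m (cdot m u w)"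

definition f_out_integrand :: "real \<Rightarrow> complex \<Rightarrow> real \<Rightarrow> nat \<Rightarrow> real \<Rightarrow> real \<Rightarrow> real" where
  "f_out_integrand \<rho> mu s m N z =
     exponential_density (1 / s) z * (exp (- (cmod mu)\<^sup>2 / s) * bessel_series 0 (z * (cmod mu)\<^sup>2 / s\<^sup>2)) *
     (exp (- (real m * \<rho> * z)) * (fact (m - 1) * bessel_series (m - 1) (real m * \<rho> * z * N)))"

lemma noise_density_pos: "noise_density m w > 0"
  by (simp add: noise_density_def)

lemma block_lr_pos: "s > 0 \<Longrightarrow> \<rho> > 0 \<Longrightarrow> block_lr \<rho> mu s m u w > 0"
  unfolding block_lr_def by (intro cn_lr_pos add_nonneg_pos) simp_all

lemma f_out_integrand_nonneg:
  assumes "s > 0" "\<rho> > 0" "N \<ge> 0"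
  shows "f_out_integrand \<rho> mu s m N z \<ge> 0"
proof (cases "z \<ge> 0")
  case True
  then show ?thesis
    unfolding f_out_integrand_def using assms
    by (intro mult_nonneg_nonneg less_imp_le[OF bessel_series_pos] exponential_density_nonneg) simp_all
qed (simp add: f_out_integrand_def exponential_density_def)

lemma borel_measurable_f_out_integrand [measurable]: "f_out_integrand \<rho> mu s m N \<in> borel_measurable borel"
  unfolding f_out_integrand_def[abs_def] by measurable

lemma f_out_eq_integral:
  assumes m_ge_1: "m \<ge> 1" and rho_pos: "\<rho> > 0" and w_neq_0: "sqnorm m w \<noteq> 0"
  shows "f_out \<rho> mu s m w = noise_density m w * (\<integral>z. f_out_integrand \<rho> mu s m (sqnorm m w) z \<partial>lborel)"
proof -
  have sqnorm_pos: "sqnorm m w > 0" using w_neq_0 sqnorm_nonneg[of m w] by linarith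
  let ?A = "\<lambda>z. sqnorm m w * \<rho> * real m * z"
  let ?I = "\<lambda>z. exp (- (\<rho> * real m + 1 / s) * z) / (sqrt (?A z)) ^ (m - 1) *
    bessel_I 0 (2 * sqrt (z * (cmod mu)\<^sup>2 / s\<^sup>2)) * bessel_I (m - 1) (2 * sqrt (?A z))"
  have Gamma_m: "Gamma (real m) = fact (m - 1)"
    using Gamma_fact[of "m - 1", where 'a=real] m_ge_1 by (simp add: of_nat_diff)
  have "fact (m - 1) / s * exp (- (cmod mu)\<^sup>2 / s) * (indicator {0<..} z *\<^sub>R ?I z)
      = f_out_integrand \<rho> mu s m (sqnorm m w) z"
    if "z \<noteq> 0" for z
  proof (cases "z > 0")
    case True
    then have A_pos: "?A z > 0" using sqnorm_pos rho_pos m_ge_1 by simp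
    have "bessel_I 0 (2 * sqrt (z * (cmod mu)\<^sup>2 / s\<^sup>2)) = bessel_series 0 (z * (cmod mu)\<^sup>2 / s\<^sup>2)"
      "bessel_I (m - 1) (2 * sqrt (?A z)) = sqrt (?A z) ^ (m - 1) * bessel_series (m - 1) (?A z)"
      using True A_pos by (simp_all add: bessel_I_eq_series del: real_sqrt_mult)
    moreover have "exp (- (\<rho> * real m + 1 / s) * z) = exp (- z / s) * exp (- (real m * \<rho> * z))"
      by (simp add: exp_add[symmetric] algebra_simps)
    ultimately show ?thesis
      using True A_pos sqnorm_pos rho_pos m_ge_1
      by (simp add: f_out_integrand_def exponential_density_def mult_ac)
  qed (use that in \<open>simp add: f_out_integrand_def exponential_density_def\<close>)
  then have "(\<integral>z. f_out_integrand \<rho> mu s m (sqnorm m w) z \<partial>lborel)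
      = (\<integral>z. fact (m - 1) / s * exp (- (cmod mu)\<^sup>2 / s) * (indicator {0<..} z *\<^sub>R ?I z) \<partial>lborel)"
    by (intro integral_cong_AE) (auto intro!: eventually_mono[OF AE_lborel_singleton[of 0]])
  also have "\<dots> = fact (m - 1) / s * exp (- (cmod mu)\<^sup>2 / s) * (LINT z:{0<..}|lborel. ?I z)"
    by (simp only: set_lebesgue_integral_def integral_mult_right_zero)
  finally show ?thesis
    unfolding f_out_def Gamma_m noise_density_def by (simp only:) (simp add: mult_ac)
qed

lemma block_lr_average_eq_integral:
  assumes m_ge_1: "m \<ge> 1" and s_pos: "s > 0" and rho_pos: "\<rho> > 0"
  shows "(\<integral>\<^sup>+g. ennreal (block_lr \<rho> mu s m (unit_dir m g) w) \<partial>CN_vec {..<m})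
      = (\<integral>\<^sup>+z. ennreal (f_out_integrand \<rho> mu s m (sqnorm m w) z) \<partial>lborel)"
proof -
  let ?a = "sqrt (real m * \<rho>)"
  define k where "k x = exp (- (real m * \<rho> * x))
    * (fact (m - 1) * bessel_series (m - 1) (real m * \<rho> * x * sqnorm m w))" for x
  have [measurable]: "k \<in> borel_measurable borel" unfolding k_def by measurable
  have amplitude: "?a\<^sup>2 = real m * \<rho>" "(cmod (of_real ?a * h))\<^sup>2 = real m * \<rho> * (cmod h)\<^sup>2" for h
    using rho_pos by (simp_all add: norm_mult power_mult_distrib)
  have "(\<integral>\<^sup>+g. ennreal (block_lr \<rho> mu s m (unit_dir m g) w) \<partial>CN_vec {..<m})
      = (\<integral>\<^sup>+g. \<integral>\<^sup>+h. ennreal (cn_lr (of_real ?a * h) 1 (cdot m (unit_dir m g) w)) \<partial>CN mu s \<partial>CN_vec {..<m})"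
    by (simp only: block_lr_def nn_integral_cn_lr_mixture[OF s_pos] amplitude)
  also have "\<dots>
      = (\<integral>\<^sup>+h. \<integral>\<^sup>+g. ennreal (cn_lr (of_real ?a * h) 1 (cdot m (unit_dir m g) w)) \<partial>CN_vec {..<m} \<partial>CN mu s)"
    by (intro nn_integral_swap prob_space_imp_sigma_finite prob_space_CN_vec prob_space_CN s_pos) measurable
  also have "\<dots> = (\<integral>\<^sup>+h. ennreal (k ((cmod h)\<^sup>2)) \<partial>CN mu s)"
    by (simp only: nn_integral_unit_dir_cn_lr[OF m_ge_1] amplitude k_def)
  also have "\<dots> = (\<integral>\<^sup>+z. ennreal (exponential_density (1 / s) z *
      (exp (- (cmod mu)\<^sup>2 / s) * bessel_series 0 (z * (cmod mu)\<^sup>2 / s\<^sup>2))) * ennreal (k z) \<partial>lborel)"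
    by (rule nn_integral_CN_noncentral[OF s_pos]) measurable
  also have "\<dots> = (\<integral>\<^sup>+z. ennreal (f_out_integrand \<rho> mu s m (sqnorm m w) z) \<partial>lborel)"
  proof (intro nn_integral_cong)
    fix z :: real
    have "exponential_density (1 / s) z
        * (exp (- (cmod mu)\<^sup>2 / s) * bessel_series 0 (z * (cmod mu)\<^sup>2 / s\<^sup>2)) \<ge> 0"
      using s_pos bessel_series_pos[of "z * (cmod mu)\<^sup>2 / s\<^sup>2" 0]
      by (cases "z \<ge> 0") (simp_all add: exponential_density_def)
    then show "ennreal (exponential_density (1 / s) z
        * (exp (- (cmod mu)\<^sup>2 / s) * bessel_series 0 (z * (cmod mu)\<^sup>2 / s\<^sup>2))) * ennreal (k z)
        = ennreal (f_out_integrand \<rho> mu s m (sqnorm m w) z)"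
      by (simp only: f_out_integrand_def k_def ennreal_mult'[symmetric])
  qed
  finally show ?thesis .
qed

lemma block_lr_average:
  assumes m_ge_1: "m \<ge> 1" and s_pos: "s > 0" and rho_pos: "\<rho> > 0" and w_neq_0: "sqnorm m w \<noteq> 0"
  shows "(\<integral>\<^sup>+g. ennreal (block_lr \<rho> mu s m (unit_dir m g) w) \<partial>CN_vec {..<m})
      = ennreal (f_out \<rho> mu s m w / noise_density m w)" (is "?L = _")
    and "f_out \<rho> mu s m w > 0"
proof -
  interpret V: prob_space "CN_vec {..<m}" by (rule prob_space_CN_vec)
  let ?J = "f_out_integrand \<rho> mu s m (sqnorm m w)"
  have integrand_nonneg: "?J z \<ge> 0" for z by (rule f_out_integrand_nonneg[OF s_pos rho_pos sqnorm_nonneg])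
  have "block_lr \<rho> mu s m (unit_dir m g) w \<le> exp (sqnorm m w)" for g
    unfolding block_lr_def using s_pos rho_pos cdot_le[OF sqnorm_unit_dir[OF m_ge_1], of g w]
    by (intro order_trans[OF cn_lr_le]) simp_all
  then have "?L \<le> (\<integral>\<^sup>+g. ennreal (exp (sqnorm m w)) \<partial>CN_vec {..<m})"
    by (intro nn_integral_mono ennreal_leI)
  then have "?L < \<infinity>" by (simp add: V.emeasure_space_1 order_le_less_trans[OF _ ennreal_less_top])
  then have "(\<integral>\<^sup>+z. ennreal (?J z) \<partial>lborel) = ennreal (\<integral>z. ?J z \<partial>lborel)"
    unfolding block_lr_average_eq_integral[OF m_ge_1 s_pos rho_pos]
    using integrand_nonneg by (subst integral_eq_nn_integral) (auto simp: less_top)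
  then show average: "?L = ennreal (f_out \<rho> mu s m w / noise_density m w)"
    unfolding block_lr_average_eq_integral[OF m_ge_1 s_pos rho_pos]
      f_out_eq_integral[OF m_ge_1 rho_pos w_neq_0]
    using noise_density_pos[of m w] by simp
  have "?L \<noteq> 0"
  proof
    assume "?L = 0"
    then have "AE g in CN_vec {..<m}. ennreal (block_lr \<rho> mu s m (unit_dir m g) w) = 0"
      unfolding block_lr_def by (subst (asm) nn_integral_0_iff_AE) measurable
    then have "AE g in CN_vec {..<m}. False"
      by eventually_elim (metis ennreal_eq_0_iff not_le block_lr_pos[OF s_pos rho_pos])
    then show False by simp
  qed
  then show "f_out \<rho> mu s m w > 0"
    using noise_density_pos[of m w]
    unfolding average by (simp add: ennreal_eq_0_iff not_le zero_less_divide_iff)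
qed

section \<open>Information density of one coherence block\<close>

lemma f_cond_eq:
  assumes "m \<ge> 1" and "\<rho> > 0"
  shows "f_cond \<rho> mu s m w = noise_density m w * faded_lr \<rho> mu s m (w 0)"
proof -
  have "sqnorm m w = (cmod (w 0))\<^sup>2 + (\<Sum>i\<in>{1..<m}. (cmod (w i))\<^sup>2)"
    using sqnorm_fun_upd_0[OF assms(1), of w "w 0"] by simp
  then have "exp (- (cmod (w 0 - mu * of_real (sqrt (real m * \<rho>))))\<^sup>2 / (s * real m * \<rho> + 1)
        - (\<Sum>i\<in>{1..<m}. (cmod (w i))\<^sup>2))
      = exp (- sqnorm m w) * exp ((cmod (w 0))\<^sup>2
        - (cmod (w 0 - of_real (sqrt (real m * \<rho>)) * mu))\<^sup>2 / (s * (real m * \<rho>) + 1))"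
    by (simp add: exp_add[symmetric] mult_ac)
  then show ?thesis
    unfolding f_cond_def noise_density_def cn_lr_altdef by (simp add: mult_ac)
qed

lemma f_out_cong: "sqnorm m w = sqnorm m w' \<Longrightarrow> f_out \<rho> mu s m w = f_out \<rho> mu s m w'"
  by (simp add: f_out_def)

lemma borel_measurable_f_out:
  assumes [measurable]: "f \<in> borel_measurable M" "(\<lambda>x. sqnorm m (h x)) \<in> borel_measurable M"
  shows "(\<lambda>x. f_out \<rho> (f x) s m (h x)) \<in> borel_measurable M"
  unfolding f_out_def set_lebesgue_integral_def by measurable

lemma f_out_radial:
  assumes "m \<ge> 1"
  obtains R where "R \<in> borel_measurable borel" "\<And>w. f_out \<rho> mu s m w = R (sqnorm m w)"
proof
  let ?e = "\<lambda>N. (\<lambda>_. 0)(0 := complex_of_real (sqrt N))"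
  have sqnorm_e: "sqnorm m (?e N) = \<bar>N\<bar>" for N
    using assms by (simp add: sqnorm_fun_upd_0 power2_eq_square del: fun_upd_apply)
  then show "(\<lambda>N. f_out \<rho> mu s m (?e N)) \<in> borel_measurable borel"
    by (intro borel_measurable_f_out) simp_all
  show "f_out \<rho> mu s m w = f_out \<rho> mu s m (?e (sqnorm m w))" for w
    by (rule f_out_cong) (simp only: sqnorm_e abs_of_nonneg sqnorm_nonneg)
qed

definition block_info :: "real \<Rightarrow> complex \<Rightarrow> real \<Rightarrow> nat \<Rightarrow> (nat \<Rightarrow> complex) \<Rightarrow> (nat \<Rightarrow> complex) \<Rightarrow> real" where
  "block_info \<rho> mu s m u w = ln (noise_density m w * block_lr \<rho> mu s m u w / f_out \<rho> mu s m w)"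

lemma block_lr_mult_exp_info:
  assumes s_pos: "s > 0" and rho_pos: "\<rho> > 0" and f_out_pos: "f_out \<rho> mu s m w > 0"
  shows "ennreal (f_out \<rho> mu s m w / noise_density m w)
    = ennreal (block_lr \<rho> mu s m u w) * ennreal (exp (- block_info \<rho> mu s m u w))"
proof -
  have "exp (- block_info \<rho> mu s m u w) = f_out \<rho> mu s m w / (noise_density m w * block_lr \<rho> mu s m u w)"
    using block_lr_pos[OF s_pos rho_pos] noise_density_pos[of m w] f_out_pos
    by (simp add: block_info_def exp_minus)
  then show ?thesis
    using block_lr_pos[OF s_pos rho_pos, of mu m u w] by (simp add: ennreal_mult'[symmetric])
qed

lemma distr_W_tilde:
  assumes m_ge_1: "m \<ge> 1" and rho_pos: "\<rho> > 0" and s_pos: "s > 0"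
  shows "distr (CN_vec {..<m}) (CN_vec {..<m}) (\<lambda>w. \<lambda>i\<in>{..<m}. W_tilde \<rho> mu s m w i)
     = density (CN_vec {..<m}) (\<lambda>w. ennreal (faded_lr \<rho> mu s m (w 0)))"
proof -
  let ?d = "s * (real m * \<rho>) + 1"
  have variance_pos: "?d > 0" using s_pos rho_pos by (simp add: add_nonneg_pos)
  define a :: "nat \<Rightarrow> complex" where "a i = (if i = 0 then of_real (sqrt (real m * \<rho>)) * mu else 0)" for i
  define b :: "nat \<Rightarrow> complex" where "b i = (if i = 0 then of_real (sqrt ?d) else 1)" for i
  have scale_b: "b i \<noteq> 0" "(cmod (b i))\<^sup>2 = (if i = 0 then ?d else 1)" for i
    using variance_pos by (simp_all add: b_def)
  have "W_tilde \<rho> mu s m w i = a i + b i * w i" for w i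
    by (simp add: W_tilde_def a_def b_def mult_ac)
  moreover have "(\<Prod>i\<in>{..<m}. ennreal (cn_lr (a i) ((cmod (b i))\<^sup>2) (w i)))
      = ennreal (faded_lr \<rho> mu s m (w 0))" for w
  proof -
    have "ennreal (cn_lr (a i) ((cmod (b i))\<^sup>2) (w i))
        = (if i = 0 then ennreal (faded_lr \<rho> mu s m (w 0)) else 1)" for i
      by (simp add: scale_b a_def)
    then show ?thesis using m_ge_1 by (simp add: prod.delta)
  qed
  ultimately show ?thesis
    using distr_CN_vec_affine[of "{..<m}" b a] scale_b(1) by simp
qed

lemma S_rv_cong:
  assumes "m \<ge> 1" and "\<And>i. i < m \<Longrightarrow> w i = w' i"
  shows "S_rv \<rho> mu s m w = S_rv \<rho> mu s m w'"
proof -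
  have W_tilde_eq: "W_tilde \<rho> mu s m w i = W_tilde \<rho> mu s m w' i" if "i < m" for i
    using assms that by (auto simp: W_tilde_def)
  then have "f_cond \<rho> mu s m (W_tilde \<rho> mu s m w) = f_cond \<rho> mu s m (W_tilde \<rho> mu s m w')"
    using assms(1) by (simp add: f_cond_def)
  moreover have "f_out \<rho> mu s m (W_tilde \<rho> mu s m w) = f_out \<rho> mu s m (W_tilde \<rho> mu s m w')"
    by (rule f_out_cong) (simp add: sqnorm_def W_tilde_eq)
  ultimately show ?thesis by (simp add: S_rv_def)
qed

lemma borel_measurable_S_rv:
  assumes m_ge_1: "m \<ge> 1"
    and [measurable]: "f \<in> borel_measurable M"
    and measurable_h [measurable]: "\<And>j. j < m \<Longrightarrow> (\<lambda>x. h x j) \<in> borel_measurable M"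
  shows "(\<lambda>x. S_rv \<rho> (f x) s m (h x)) \<in> borel_measurable M"
proof -
  have measurable_W_tilde [measurable]: "(\<lambda>x. W_tilde \<rho> (f x) s m (h x) j) \<in> borel_measurable M"
    if "j < m" for j
    using that measurable_h[of 0] measurable_h[of j] unfolding W_tilde_def by (cases "j = 0") simp_all
  have [measurable]: "(\<lambda>x. sqnorm m (W_tilde \<rho> (f x) s m (h x))) \<in> borel_measurable M"
    unfolding sqnorm_def by measurable
  have [measurable]: "(\<lambda>x. W_tilde \<rho> (f x) s m (h x) 0) \<in> borel_measurable M"
    using m_ge_1 by (intro measurable_W_tilde) simp
  have [measurable]: "(\<lambda>x. f_cond \<rho> (f x) s m (W_tilde \<rho> (f x) s m (h x))) \<in> borel_measurable M"
    unfolding f_cond_def by measurable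
  have [measurable]: "(\<lambda>x. f_out \<rho> (f x) s m (W_tilde \<rho> (f x) s m (h x))) \<in> borel_measurable M"
    by (rule borel_measurable_f_out) measurable
  show ?thesis unfolding S_rv_def by measurable
qed

text \<open>By unitary invariance the direction may be taken to be \<open>e\<^sub>1\<close>, where the likelihood ratio is that of
  \<^const>\<open>W_tilde\<close>.\<close>

lemma nn_integral_block_info:
  assumes m_ge_1: "m \<ge> 1" and rho_pos: "\<rho> > 0" and s_pos: "s > 0" and unit_u: "sqnorm m u = 1"
    and [measurable]: "f \<in> borel_measurable borel"
  shows "(\<integral>\<^sup>+w. ennreal (block_lr \<rho> mu s m u w) * f (block_info \<rho> mu s m u w) \<partial>CN_vec {..<m})
     = (\<integral>\<^sup>+w. f (S_rv \<rho> mu s m w) \<partial>CN_vec {..<m})"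
proof -
  let ?N = "CN_vec {..<m}"
  let ?lr = "faded_lr \<rho> mu s m"
  have [measurable]: "0 \<in> {..<m}" using m_ge_1 by auto
  obtain R where [measurable]: "R \<in> borel_measurable borel"
    and f_out_eq: "f_out \<rho> mu s m w = R (sqnorm m w)" for w
    using f_out_radial[OF m_ge_1] by blast
  let ?i = "\<lambda>x N. ln (exp (- N) / pi ^ m * ?lr x / R N)"
  have "(\<integral>\<^sup>+w. ennreal (block_lr \<rho> mu s m u w) * f (block_info \<rho> mu s m u w) \<partial>?N)
      = (\<integral>\<^sup>+w. ennreal (?lr (cdot m u w)) * f (?i (cdot m u w) (sqnorm m w)) \<partial>?N)"
    by (simp only: block_info_def block_lr_def noise_density_def f_out_eq)
  also have "\<dots> = (\<integral>\<^sup>+w. ennreal (?lr (w 0)) * f (?i (w 0) (sqnorm m w)) \<partial>?N)"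
    by (rule nn_integral_CN_vec_cdot[OF m_ge_1 unit_u, where F="\<lambda>x N. ennreal (?lr x) * f (?i x N)"])
      measurable
  also have "\<dots> = (\<integral>\<^sup>+w. f (?i (w 0) (sqnorm m w)) \<partial>density ?N (\<lambda>w. ennreal (?lr (w 0))))"
    by (rule nn_integral_density[symmetric]) measurable
  also have "\<dots> = (\<integral>\<^sup>+w. f (?i (w 0) (sqnorm m w)) \<partial>distr ?N ?N (\<lambda>w. \<lambda>i\<in>{..<m}. W_tilde \<rho> mu s m w i))"
    unfolding distr_W_tilde[OF m_ge_1 rho_pos s_pos] ..
  also have "\<dots> = (\<integral>\<^sup>+w. f (?i (W_tilde \<rho> mu s m w 0) (sqnorm m (W_tilde \<rho> mu s m w))) \<partial>?N)"
  proof -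
    have "(\<lambda>w. \<lambda>i\<in>{..<m}. W_tilde \<rho> mu s m w i) \<in> measurable ?N ?N"
      unfolding W_tilde_def by (intro measurable_restrict) (auto split: if_split)
    moreover have "(\<lambda>i\<in>{..<m}. W_tilde \<rho> mu s m w i) 0 = W_tilde \<rho> mu s m w 0"
      "sqnorm m (\<lambda>i\<in>{..<m}. W_tilde \<rho> mu s m w i) = sqnorm m (W_tilde \<rho> mu s m w)" for w
      using m_ge_1 by (simp_all add: sqnorm_def)
    ultimately show ?thesis by (subst nn_integral_distr) (simp_all del: restrict_apply)
  qed
  also have "\<dots> = (\<integral>\<^sup>+w. f (S_rv \<rho> mu s m w) \<partial>?N)"
    by (simp only: S_rv_def f_cond_eq[OF m_ge_1 rho_pos] noise_density_def f_out_eq)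
  finally show ?thesis .
qed

section \<open>Pilot-assisted transmission over one block\<close>

lemma sigH2_pos: "\<kappa> \<ge> 0 \<Longrightarrow> sigH2 \<kappa> > 0"
  by (simp add: sigH2_def)

lemma sig_e2_pos: "np \<ge> 1 \<Longrightarrow> \<rho> > 0 \<Longrightarrow> sig_e2 np \<rho> > 0"
  by (simp add: sig_e2_def)

lemma sig_p2_pos: "\<kappa> \<ge> 0 \<Longrightarrow> np \<ge> 1 \<Longrightarrow> \<rho> > 0 \<Longrightarrow> sig_p2 \<kappa> np \<rho> > 0"
  unfolding sig_p2_def by (intro divide_pos_pos mult_pos_pos add_pos_pos sigH2_pos sig_e2_pos)

lemma borel_measurable_mu_p [measurable]: "mu_p \<kappa> np \<rho> \<in> borel_measurable borel"
  unfolding mu_p_def[abs_def] by measurable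

definition block_word :: "nat \<Rightarrow> nat \<Rightarrow> real \<Rightarrow> (nat \<Rightarrow> complex) \<Rightarrow> nat \<Rightarrow> complex" where
  "block_word np m \<rho> u i = (if i < np then of_real (sqrt \<rho>) else of_real (sqrt (real m * \<rho>)) * u (i - np))"

definition pilot_estimate :: "nat \<Rightarrow> real \<Rightarrow> (nat \<Rightarrow> complex) \<Rightarrow> complex" where
  "pilot_estimate np \<rho> y = (\<Sum>i<np. y i) / of_real (real np * sqrt \<rho>)"

definition block_stat :: "nat \<Rightarrow> nat \<Rightarrow> real \<Rightarrow> (nat \<Rightarrow> complex) \<Rightarrow> complex \<times> (nat \<Rightarrow> complex)" where
  "block_stat np m \<rho> y = (pilot_estimate np \<rho> y, \<lambda>j\<in>{..<m}. y (np + j))"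

lemma measurable_block_stat:
  assumes [measurable]: "\<And>i. i < np + m \<Longrightarrow> (\<lambda>x. f x i) \<in> borel_measurable M"
  shows "(\<lambda>x. block_stat np m \<rho> (f x)) \<in> measurable M (borel \<Otimes>\<^sub>M CN_vec {..<m})"
  unfolding block_stat_def pilot_estimate_def
  by (intro measurable_Pair measurable_restrict) (auto simp: measurable_cong_sets[OF refl sets_CN])

lemma nn_integral_pilot_noise:
  assumes np_ge_1: "np \<ge> 1" and rho_pos: "\<rho> > 0" and [measurable]: "f \<in> borel_measurable borel"
  shows "(\<integral>\<^sup>+w. f (pilot_estimate np \<rho> w) \<partial>CN_vec {..<np}) = (\<integral>\<^sup>+e. f e \<partial>CN 0 (sig_e2 np \<rho>))"
proof -
  define r where "r = sqrt (sig_e2 np \<rho>)"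
  have r_eq: "complex_of_real r \<noteq> 0" "r\<^sup>2 = sig_e2 np \<rho>"
    using sig_e2_pos[OF np_ge_1 rho_pos] by (auto simp: r_def)
  let ?c = "1 / complex_of_real (real np * sqrt \<rho>)"
  have "(\<Sum>i<np. (cmod ?c)\<^sup>2) = sig_e2 np \<rho>"
    using np_ge_1 rho_pos
    by (simp add: sig_e2_def norm_divide norm_mult power_divide power_mult_distrib power2_eq_square)
  then have "(\<integral>\<^sup>+w. f (\<Sum>i<np. ?c * w i) \<partial>CN_vec {..<np}) = (\<integral>\<^sup>+w. f (of_real r * w 0) \<partial>CN_vec {..<np})"
    using nn_integral_CN_vec_linear[of "{..<np}" 0 "\<lambda>x _. f x" "\<lambda>_. ?c"] np_ge_1
    by (simp add: r_def del: of_real_mult)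
  also have "\<dots> = (\<integral>\<^sup>+z. f (of_real r * z) \<partial>CN_std)"
    using np_ge_1 CN_std.prob_space_axioms
    by (intro nn_integral_PiM_component[where f="\<lambda>z. f (of_real r * z)" and M="\<lambda>_. CN_std"]) auto
  also have "\<dots> = (\<integral>\<^sup>+e. f e \<partial>CN 0 (sig_e2 np \<rho>))"
    using nn_integral_CN_affine[OF _ r_eq(1), where f=f and a=0 and mu=0 and s=1] r_eq(2) by simp
  finally show ?thesis by (simp add: pilot_estimate_def sum_divide_distrib del: of_real_mult)
qed

lemma nn_integral_noisy_fading:
  assumes s_pos: "s > 0" and t_pos: "t > 0" and unit_u: "sqnorm m u = 1"
    and [measurable]: "(\<lambda>(v, w). F v w) \<in> borel_measurable (borel \<Otimes>\<^sub>M CN_vec {..<m})"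
  shows "(\<integral>\<^sup>+h. \<integral>\<^sup>+e. \<integral>\<^sup>+w. F (h + e) (\<lambda>j\<in>{..<m}. h * of_real a * u j + w j) \<partial>CN_vec {..<m} \<partial>CN 0 t
      \<partial>CN mu s)
    = (\<integral>\<^sup>+v. \<integral>\<^sup>+w. ennreal (cn_lr (of_real a * ((of_real s * v + of_real t * mu) / of_real (s + t)))
        (s * t / (s + t) * a\<^sup>2 + 1) (cdot m u w)) * F v w \<partial>CN_vec {..<m} \<partial>CN mu (s + t))"
proof -
  let ?N = "CN_vec {..<m}"
  interpret N: prob_space ?N by (rule prob_space_CN_vec)
  define post where "post v
    = CN ((of_real s * v + of_real t * mu) / of_real (s + t)) (s * t / (s + t))" for v
  have variance_pos: "s * t / (s + t) > 0" using s_pos t_pos by simp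
  have prob_post: "prob_space (post v)" "sets (post v) = sets borel" for v
    unfolding post_def by (simp_all only: prob_space_CN[OF variance_pos] sets_CN)
  note [measurable_cong] = prob_post(2)
  have shift_data: "(\<integral>\<^sup>+w. F v (\<lambda>j\<in>{..<m}. h * of_real a * u j + w j) \<partial>?N)
      = (\<integral>\<^sup>+w. ennreal (cn_lr (of_real a * h) 1 (cdot m u w)) * F v w \<partial>?N)" for h v
    using nn_integral_CN_vec_shift[OF unit_u, of "F v" "h * of_real a"] by (simp add: mult.commute[of h])
  have "(\<integral>\<^sup>+h. \<integral>\<^sup>+e. \<integral>\<^sup>+w. F (h + e) (\<lambda>j\<in>{..<m}. h * of_real a * u j + w j) \<partial>?N \<partial>CN 0 t \<partial>CN mu s)
      = (\<integral>\<^sup>+h. \<integral>\<^sup>+e. \<integral>\<^sup>+w. ennreal (cn_lr (of_real a * h) 1 (cdot m u w)) * F (h + e) w \<partial>?N \<partial>CN 0 t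
      \<partial>CN mu s)"
    by (simp only: shift_data)
  also have "\<dots>
      = (\<integral>\<^sup>+v. \<integral>\<^sup>+h. \<integral>\<^sup>+w. ennreal (cn_lr (of_real a * h) 1 (cdot m u w)) * F v w \<partial>?N \<partial>post v
      \<partial>CN mu (s + t))"
    unfolding post_def by (rule nn_integral_CN_posterior[OF s_pos t_pos]) measurable
  also have "\<dots>
      = (\<integral>\<^sup>+v. \<integral>\<^sup>+w. \<integral>\<^sup>+h. ennreal (cn_lr (of_real a * h) 1 (cdot m u w)) * F v w \<partial>post v \<partial>?N
      \<partial>CN mu (s + t))"
    by (intro nn_integral_cong nn_integral_swap prob_space_imp_sigma_finite prob_post(1) prob_space_CN_vec)
      measurable
  also have "\<dots>
      = (\<integral>\<^sup>+v. \<integral>\<^sup>+w. (\<integral>\<^sup>+h. ennreal (cn_lr (of_real a * h) 1 (cdot m u w)) \<partial>post v) * F v w \<partial>?N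
      \<partial>CN mu (s + t))"
    by (intro nn_integral_cong nn_integral_multc) measurable
  finally show ?thesis
    by (simp only: post_def nn_integral_cn_lr_mixture[OF variance_pos])
qed

lemma nn_integral_block_stat_noise:
  assumes np_ge_1: "np \<ge> 1" and rho_pos: "\<rho> > 0"
    and measurable_F [measurable]: "(\<lambda>(v, w). F v w) \<in> borel_measurable (borel \<Otimes>\<^sub>M CN_vec {..<m})"
  shows "(\<integral>\<^sup>+w. case_prod F (block_stat np m \<rho> (\<lambda>i. h * block_word np m \<rho> u i + w i)) \<partial>CN_vec {..<np + m})
      = (\<integral>\<^sup>+e. \<integral>\<^sup>+y. F (h + e) (\<lambda>j\<in>{..<m}. h * of_real (sqrt (real m * \<rho>)) * u j + y j) \<partial>CN_vec {..<m}
      \<partial>CN 0 (sig_e2 np \<rho>))"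
proof -
  interpret N: prob_space "CN_vec {..<m}" by (rule prob_space_CN_vec)
  let ?a = "sqrt (real m * \<rho>)"
    and ?G = "\<lambda>w. case_prod F (block_stat np m \<rho> (\<lambda>i. h * block_word np m \<rho> u i + w i))"
  have [measurable]: "?G \<in> borel_measurable (CN_vec {..<np + m})"
  proof -
    have "(\<lambda>w. block_stat np m \<rho> (\<lambda>i. h * block_word np m \<rho> u i + w i))
        \<in> measurable (CN_vec {..<np + m}) (borel \<Otimes>\<^sub>M CN_vec {..<m})"
      by (rule measurable_block_stat) measurable
    from measurable_compose[OF this measurable_F] show ?thesis by (simp add: case_prod_beta)
  qed
  have block_stat_append: "block_stat np m \<rho> (\<lambda>i. h * block_word np m \<rho> u i + append_seq np m x y i)
      = (h + pilot_estimate np \<rho> x, \<lambda>j\<in>{..<m}. h * of_real ?a * u j + y j)" for x y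
    using np_ge_1 rho_pos
    by (auto simp: block_stat_def pilot_estimate_def block_word_def append_seq_def sum.distrib
      add_divide_distrib mult.assoc)
  have "(\<integral>\<^sup>+w. ?G w \<partial>CN_vec {..<np + m})
      = (\<integral>\<^sup>+x. \<integral>\<^sup>+y. ?G (append_seq np m x y) \<partial>CN_vec {..<m} \<partial>CN_vec {..<np})"
    by (rule nn_integral_PiM_append[OF CN_std.prob_space_axioms]) measurable
  also have "\<dots>
      = (\<integral>\<^sup>+x. \<integral>\<^sup>+y. F (h + pilot_estimate np \<rho> x) (\<lambda>j\<in>{..<m}. h * of_real ?a * u j + y j) \<partial>CN_vec {..<m}
      \<partial>CN_vec {..<np})"
    by (simp only: block_stat_append prod.case)
  also have "\<dots>
      = (\<integral>\<^sup>+e. \<integral>\<^sup>+y. F (h + e) (\<lambda>j\<in>{..<m}. h * of_real ?a * u j + y j) \<partial>CN_vec {..<m}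
      \<partial>CN 0 (sig_e2 np \<rho>))"
    by (rule nn_integral_pilot_noise[OF np_ge_1 rho_pos]) measurable
  finally show ?thesis .
qed

lemma nn_integral_block_stat:
  assumes np_ge_1: "np \<ge> 1" and rho_pos: "\<rho> > 0" and kappa_nonneg: "\<kappa> \<ge> 0" and unit_u: "sqnorm m u = 1"
    and measurable_F [measurable]: "(\<lambda>(v, w). F v w) \<in> borel_measurable (borel \<Otimes>\<^sub>M CN_vec {..<m})"
  shows "(\<integral>\<^sup>+h. \<integral>\<^sup>+w. case_prod F (block_stat np m \<rho> (\<lambda>i. h * block_word np m \<rho> u i + w i))
      \<partial>CN_vec {..<np + m} \<partial>CN (muH \<kappa>) (sigH2 \<kappa>))
     = (\<integral>\<^sup>+v. \<integral>\<^sup>+w. ennreal (block_lr \<rho> (mu_p \<kappa> np \<rho> v) (sig_p2 \<kappa> np \<rho>) m u w) * F v w \<partial>CN_vec {..<m}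
     \<partial>CN (muH \<kappa>) (sigH2 \<kappa> + sig_e2 np \<rho>))"
  using nn_integral_noisy_fading[OF sigH2_pos[OF kappa_nonneg] sig_e2_pos[OF np_ge_1 rho_pos] unit_u
    measurable_F, where a="sqrt (real m * \<rho>)" and mu="muH \<kappa>"] rho_pos
  by (simp add: nn_integral_block_stat_noise[OF np_ge_1 rho_pos measurable_F]
      block_lr_def mu_p_def sig_p2_def)

section \<open>The dependence testing bound\<close>

abbreviation dt_weight :: "real \<Rightarrow> real \<Rightarrow> real" where
  "dt_weight \<gamma> v \<equiv> exp (- max 0 (v - ln \<gamma>))"

definition threshold_decoder :: "real \<Rightarrow> nat \<Rightarrow> (nat \<Rightarrow> real) \<Rightarrow> nat" where
  "threshold_decoder t M s = (LEAST j. j \<in> {1..M} \<and> (t < s j \<or> j = M))"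

lemma threshold_decoder:
  assumes "M \<ge> 1"
  shows threshold_decoder_range: "threshold_decoder t M s \<in> {1..M}"
    and "t < s (threshold_decoder t M s) \<or> threshold_decoder t M s = M"
  using LeastI[of "\<lambda>j. j \<in> {1..M} \<and> (t < s j \<or> j = M)" M] assms unfolding threshold_decoder_def by auto

lemma threshold_decoder_error:
  assumes message_j: "j \<in> {1..M}" and wrong_decision: "threshold_decoder t M s \<noteq> j"
  shows "s j \<le> t \<or> (\<exists>k\<in>{1..<j}. t < s k)"
proof (rule disjCI)
  assume "\<not> (\<exists>k\<in>{1..<j}. t < s k)"
  then have "\<not> threshold_decoder t M s < j"
    using threshold_decoder[of M t s] message_j by fastforce
  then show "s j \<le> t"
    using Least_le[of "\<lambda>j. j \<in> {1..M} \<and> (t < s j \<or> j = M)" j] message_j wrong_decision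
    unfolding threshold_decoder_def by (meson linorder_neqE_nat not_le)
qed

lemma measurable_threshold_decoder:
  assumes [measurable]: "\<And>j. j \<in> {1..M} \<Longrightarrow> (\<lambda>y. s j y) \<in> borel_measurable N"
  shows "(\<lambda>y. threshold_decoder t M (\<lambda>j. s j y)) \<in> measurable N (count_space UNIV)"
  unfolding threshold_decoder_def
proof (rule measurable_Least)
  show "(\<lambda>y. j \<in> {1..M} \<and> (t < s j y \<or> j = M)) \<in> measurable N (count_space UNIV)" for j
  proof (cases "j \<in> {1..M}")
    case True
    then have [measurable]: "(\<lambda>y. s j y) \<in> borel_measurable N" by simp
    show ?thesis by measurable
  qed simp
qed

lemma sum_preceding: "real (\<Sum>j\<in>{1..n}. j - 1) = real n * ((real n - 1) / 2)"
  by (induction n) (auto simp: field_simps)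

text \<open>There are \<open>N (N - 1) / 2\<close> pairs of distinct messages, each contributing one term \<open>h\<close>.\<close>

lemma (in prob_space) nn_integral_random_codebook:
  assumes N_ge_1: "N \<ge> 1"
    and [measurable]: "f \<in> borel_measurable M" "(\<lambda>(x', x). h x' x) \<in> borel_measurable (M \<Otimes>\<^sub>M M)"
  shows "(\<integral>\<^sup>+c. (\<Sum>j\<in>{1..N}. f (c j) + (\<Sum>k\<in>{1..<j}. h (c k) (c j))) \<partial>PiM {1..N} (\<lambda>_. M))
    = ennreal (real N) * ((\<integral>\<^sup>+x. f x \<partial>M) + ennreal ((real N - 1) / 2) * (\<integral>\<^sup>+x'. \<integral>\<^sup>+x. h x' x \<partial>M \<partial>M))"
proof -
  let ?P = "PiM {1..N} (\<lambda>_. M)" and ?a = "\<integral>\<^sup>+x. f x \<partial>M" and ?b = "\<integral>\<^sup>+x'. \<integral>\<^sup>+x. h x' x \<partial>M \<partial>M"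
  have [measurable]: "(\<lambda>c. f (c j)) \<in> borel_measurable ?P" if "j \<in> {1..N}" for j
    using that by measurable
  have measurable_h: "(\<lambda>c. h (c k) (c j)) \<in> borel_measurable ?P" if "k \<in> {1..<j}" "j \<in> {1..N}" for j k
  proof -
    have "k \<in> {1..N}" "j \<in> {1..N}" using that by auto
    then show ?thesis by measurable
  qed
  have summand: "(\<integral>\<^sup>+c. f (c j) + (\<Sum>k\<in>{1..<j}. h (c k) (c j)) \<partial>?P) = ?a + (\<Sum>k\<in>{1..<j}. ?b)"
    if message_j: "j \<in> {1..N}" for j
  proof -
    have "(\<integral>\<^sup>+c. f (c j) + (\<Sum>k\<in>{1..<j}. h (c k) (c j)) \<partial>?P)
        = (\<integral>\<^sup>+c. f (c j) \<partial>?P) + (\<Sum>k\<in>{1..<j}. \<integral>\<^sup>+c. h (c k) (c j) \<partial>?P)"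
      using message_j by (subst nn_integral_add, simp, simp add: measurable_h, subst nn_integral_sum)
        (auto simp: measurable_h)
    also have "(\<integral>\<^sup>+c. f (c j) \<partial>?P) = ?a"
      using message_j by (intro nn_integral_PiM_component[where M="\<lambda>_. M"] prob_space_axioms) auto
    also have "(\<Sum>k\<in>{1..<j}. \<integral>\<^sup>+c. h (c k) (c j) \<partial>?P) = (\<Sum>k\<in>{1..<j}. ?b)"
      using message_j by (intro sum.cong nn_integral_PiM_pair[where M="\<lambda>_. M"] prob_space_axioms) auto
    finally show ?thesis .
  qed
  have "(\<integral>\<^sup>+c. (\<Sum>j\<in>{1..N}. f (c j) + (\<Sum>k\<in>{1..<j}. h (c k) (c j))) \<partial>?P)
      = (\<Sum>j\<in>{1..N}. \<integral>\<^sup>+c. f (c j) + (\<Sum>k\<in>{1..<j}. h (c k) (c j)) \<partial>?P)"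
    by (intro nn_integral_sum borel_measurable_add borel_measurable_sum) (auto simp: measurable_h)
  also have "\<dots> = (\<Sum>j\<in>{1..N}. ?a + (\<Sum>k\<in>{1..<j}. ?b))"
    by (intro sum.cong refl summand)
  also have "\<dots> = of_nat N * ?a + of_nat (\<Sum>j\<in>{1..N}. j - 1) * ?b"
    by (simp add: sum.distrib sum_distrib_right)
  also have "\<dots> = ennreal (real N) * ?a + ennreal (real N * ((real N - 1) / 2)) * ?b"
    by (simp only: ennreal_of_nat_eq_real_of_nat sum_preceding)
  also have "ennreal (real N * ((real N - 1) / 2)) = ennreal (real N) * ennreal ((real N - 1) / 2)"
    using N_ge_1 by (intro ennreal_mult) auto
  finally show ?thesis by (simp only: distrib_left mult.assoc)
qed

text \<open>\<open>W x\<close> is the density of the output law given input \<open>x\<close> with respect to \<open>Y\<close>, and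
  \<open>i x y = ln (W x y / q y)\<close> where \<open>q\<close> is the output density for an input drawn from \<open>X\<close>.\<close>

locale info_density_channel = X: prob_space X + Y: prob_space Y
  for X :: "'x measure" and Y :: "'y measure" +
  fixes W :: "'x \<Rightarrow> 'y \<Rightarrow> ennreal" and i :: "'x \<Rightarrow> 'y \<Rightarrow> real"
  assumes measurable_W [measurable]: "(\<lambda>(x, y). W x y) \<in> borel_measurable (X \<Otimes>\<^sub>M Y)"
    and measurable_i [measurable]: "(\<lambda>(x, y). i x y) \<in> borel_measurable (X \<Otimes>\<^sub>M Y)"
    and prob_space_output: "x \<in> space X \<Longrightarrow> prob_space (density Y (W x))"
    and average_W: "AE y in Y. \<forall>x\<in>space X. (\<integral>\<^sup>+x'. W x' y \<partial>X) = W x y * ennreal (exp (- i x y))"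
begin

lemma measurable_slices [measurable]:
  "x \<in> space X \<Longrightarrow> W x \<in> borel_measurable Y" "x \<in> space X \<Longrightarrow> i x \<in> borel_measurable Y"
  using measurable_compose[OF measurable_Pair1' measurable_W]
    measurable_compose[OF measurable_Pair1' measurable_i]
  by simp_all

definition missed :: "real \<Rightarrow> 'x \<Rightarrow> ennreal" where
  "missed t x = (\<integral>\<^sup>+y. W x y * indicator {..t} (i x y) \<partial>Y)"

definition confused :: "real \<Rightarrow> 'x \<Rightarrow> 'x \<Rightarrow> ennreal" where
  "confused t x' x = (\<integral>\<^sup>+y. W x y * indicator {t<..} (i x' y) \<partial>Y)"

lemma measurable_missed [measurable]: "missed t \<in> borel_measurable X"
  unfolding missed_def by measurable

lemma measurable_confused [measurable]: "(\<lambda>(x', x). confused t x' x) \<in> borel_measurable (X \<Otimes>\<^sub>M X)"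
  unfolding confused_def by measurable

lemma threshold_decoder_error_le:
  assumes codebook: "\<And>j. j \<in> {1..M} \<Longrightarrow> cb j \<in> space X" and message_j: "j \<in> {1..M}"
  shows "emeasure (density Y (W (cb j))) {y \<in> space Y. threshold_decoder t M (\<lambda>k. i (cb k) y) \<noteq> j}
    \<le> missed t (cb j) + (\<Sum>k\<in>{1..<j}. confused t (cb k) (cb j))"
proof -
  let ?D = "density Y (W (cb j))"
  have preceding_codeword: "cb k \<in> space X" if "k \<in> {1..<j}" for k
    using that message_j by (intro codebook) auto
  note [measurable] = measurable_slices[OF codebook[OF message_j]]
    measurable_slices(2)[OF preceding_codeword]
  let ?below = "{y \<in> space Y. i (cb j) y \<le> t}" and ?above = "\<lambda>k. {y \<in> space Y. t < i (cb k) y}"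
  have sets_above: "?above k \<in> sets ?D" if "k \<in> {1..<j}" for k using that by measurable
  have "emeasure ?D {y \<in> space Y. threshold_decoder t M (\<lambda>k. i (cb k) y) \<noteq> j}
      \<le> emeasure ?D (?below \<union> (\<Union>k\<in>{1..<j}. ?above k))"
    using threshold_decoder_error[OF message_j] sets_above by (intro emeasure_mono) (fastforce, auto)
  also have "\<dots> \<le> emeasure ?D ?below + emeasure ?D (\<Union>k\<in>{1..<j}. ?above k)"
    using sets_above by (intro emeasure_subadditive) auto
  also have "\<dots> \<le> emeasure ?D ?below + (\<Sum>k\<in>{1..<j}. emeasure ?D (?above k))"
    using sets_above by (intro add_left_mono emeasure_subadditive_finite) auto
  also have "emeasure ?D ?below = missed t (cb j)"
    unfolding missed_def by (subst emeasure_density) (auto intro!: nn_integral_cong simp: indicator_def)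
  also have "(\<Sum>k\<in>{1..<j}. emeasure ?D (?above k)) = (\<Sum>k\<in>{1..<j}. confused t (cb k) (cb j))"
    unfolding confused_def using sets_above
    by (intro sum.cong refl, subst emeasure_density) (auto intro!: nn_integral_cong simp: indicator_def)
  finally show ?thesis .
qed

lemma nn_integral_confused:
  assumes input_x: "x \<in> space X"
  shows "(\<integral>\<^sup>+x'. confused t x x' \<partial>X)
      = (\<integral>\<^sup>+y. W x y * ennreal (exp (- i x y)) * indicator {t<..} (i x y) \<partial>Y)"
proof -
  note [measurable] = measurable_slices[OF input_x]
  have "(\<integral>\<^sup>+x'. confused t x x' \<partial>X) = (\<integral>\<^sup>+y. \<integral>\<^sup>+x'. W x' y * indicator {t<..} (i x y) \<partial>X \<partial>Y)"
    unfolding confused_def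
    by (rule nn_integral_swap[OF X.sigma_finite_measure_axioms Y.sigma_finite_measure_axioms]) measurable
  also have "\<dots> = (\<integral>\<^sup>+y. W x y * ennreal (exp (- i x y)) * indicator {t<..} (i x y) \<partial>Y)"
  proof (rule nn_integral_cong_AE)
    show "AE y in Y. (\<integral>\<^sup>+x'. W x' y * indicator {t<..} (i x y) \<partial>X)
        = W x y * ennreal (exp (- i x y)) * indicator {t<..} (i x y)"
      using average_W AE_space
    proof eventually_elim
      case (elim y)
      then have "(\<lambda>x'. W x' y) \<in> borel_measurable X" by measurable
      then have "(\<integral>\<^sup>+x'. W x' y * indicator {t<..} (i x y) \<partial>X)
          = (\<integral>\<^sup>+x'. W x' y \<partial>X) * indicator {t<..} (i x y)"
        by (rule nn_integral_multc)
      with elim input_x show ?case by simp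
    qed
  qed
  finally show ?thesis .
qed

lemma missed_add_confused:
  assumes input_x: "x \<in> space X" and gamma_pos: "\<gamma> > 0"
  shows "missed (ln \<gamma>) x + ennreal \<gamma> * (\<integral>\<^sup>+x'. confused (ln \<gamma>) x x' \<partial>X)
    = (\<integral>\<^sup>+y. W x y * ennreal (dt_weight \<gamma> (i x y)) \<partial>Y)"
proof -
  note [measurable] = measurable_slices[OF input_x]
  have pointwise: "w * indicator {..ln \<gamma>} v + ennreal \<gamma> * (w * ennreal (exp (- v)) * indicator {ln \<gamma><..} v)
      = w * ennreal (dt_weight \<gamma> v)" for w v
  proof (cases "v \<le> ln \<gamma>")
    case False
    then have "ennreal \<gamma> * ennreal (exp (- v)) = ennreal (dt_weight \<gamma> v)"
      using gamma_pos by (simp add: ennreal_mult[symmetric] exp_diff exp_minus field_simps)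
    with False show ?thesis by (simp add: mult.left_commute)
  qed simp
  have "missed (ln \<gamma>) x + ennreal \<gamma> * (\<integral>\<^sup>+x'. confused (ln \<gamma>) x x' \<partial>X)
      = (\<integral>\<^sup>+y. W x y * indicator {..ln \<gamma>} (i x y)
          + ennreal \<gamma> * (W x y * ennreal (exp (- i x y)) * indicator {ln \<gamma><..} (i x y)) \<partial>Y)"
    unfolding nn_integral_confused[OF input_x] missed_def
    by (subst nn_integral_cmult[symmetric], measurable, subst nn_integral_add) measurable
  then show ?thesis by (simp only: pointwise)
qed

lemma exists_good_codebook:
  assumes M_ge_2: "M \<ge> 2" and eps_nonneg: "\<epsilon> \<ge> 0"
    and average_le: "(\<integral>\<^sup>+x. \<integral>\<^sup>+y. W x y * ennreal (dt_weight ((real M - 1) / 2) (i x y)) \<partial>Y \<partial>X) \<le> ennreal \<epsilon>"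
  defines "t \<equiv> ln ((real M - 1) / 2)"
  obtains cb where "\<And>j. j \<in> {1..M} \<Longrightarrow> cb j \<in> space X"
    and "(\<Sum>j\<in>{1..M}. missed t (cb j) + (\<Sum>k\<in>{1..<j}. confused t (cb k) (cb j))) \<le> ennreal (real M * \<epsilon>)"
proof -
  define \<gamma> where "\<gamma> = (real M - 1) / 2"
  have gamma_pos: "\<gamma> > 0" using M_ge_2 by (simp add: \<gamma>_def)
  interpret P: prob_space "PiM {1..M} (\<lambda>_. X)" by (intro prob_space_PiM X.prob_space_axioms)
  define err where "err c = (\<Sum>j\<in>{1..M}. missed t (c j) + (\<Sum>k\<in>{1..<j}. confused t (c k) (c j)))" for c
  have "(\<integral>\<^sup>+c. err c \<partial>PiM {1..M} (\<lambda>_. X))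
      = ennreal (real M) * ((\<integral>\<^sup>+x. missed t x \<partial>X) + ennreal \<gamma> * (\<integral>\<^sup>+x. \<integral>\<^sup>+x'. confused t x x' \<partial>X \<partial>X))"
    unfolding err_def \<gamma>_def using M_ge_2 by (intro X.nn_integral_random_codebook) auto
  also have "\<dots> = ennreal (real M) * (\<integral>\<^sup>+x. missed t x + ennreal \<gamma> * (\<integral>\<^sup>+x'. confused t x x' \<partial>X) \<partial>X)"
    by (subst nn_integral_cmult[symmetric], measurable, subst nn_integral_add) measurable
  also have "\<dots> = ennreal (real M) * (\<integral>\<^sup>+x. \<integral>\<^sup>+y. W x y * ennreal (dt_weight \<gamma> (i x y)) \<partial>Y \<partial>X)"
    unfolding t_def \<gamma>_def[symmetric]
    by (intro arg_cong[where f="\<lambda>z. _ * z"] nn_integral_cong missed_add_confused gamma_pos)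
  also have "\<dots> \<le> ennreal (real M) * ennreal \<epsilon>"
    using average_le unfolding \<gamma>_def by (intro mult_left_mono) simp_all
  also have "\<dots> = ennreal (real M * \<epsilon>)" using eps_nonneg by (simp add: ennreal_mult)
  finally obtain cb where "cb \<in> space (PiM {1..M} (\<lambda>_. X))" and "err cb \<le> ennreal (real M * \<epsilon>)"
    using P.exists_le_nn_integral[of err "ennreal (real M * \<epsilon>)"] unfolding err_def by fastforce
  then have "cb j \<in> space X" if "j \<in> {1..M}" for j
    using that by (auto simp: space_PiM)
  then show ?thesis using \<open>err cb \<le> _\<close> unfolding err_def by (rule that)
qed

theorem dependence_testing_bound:
  assumes M_ge_2: "M \<ge> 2" and eps_nonneg: "\<epsilon> \<ge> 0"
    and average_le: "(\<integral>\<^sup>+x. \<integral>\<^sup>+y. W x y * ennreal (dt_weight ((real M - 1) / 2) (i x y)) \<partial>Y \<partial>X) \<le> ennreal \<epsilon>"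
  obtains cb dec where "\<And>j. j \<in> {1..M} \<Longrightarrow> cb j \<in> space X" and "\<And>y. dec y \<in> {1..M}"
    and "dec \<in> measurable Y (count_space UNIV)"
    and "(1 / real M) * (\<Sum>j\<in>{1..M}. measure (density Y (W (cb j))) {y \<in> space Y. dec y \<noteq> j}) \<le> \<epsilon>"
proof -
  define t where "t = ln ((real M - 1) / 2)"
  obtain cb where codebook: "\<And>j. j \<in> {1..M} \<Longrightarrow> cb j \<in> space X"
    and total_error_le: "(\<Sum>j\<in>{1..M}. missed t (cb j) + (\<Sum>k\<in>{1..<j}. confused t (cb k) (cb j)))
        \<le> ennreal (real M * \<epsilon>)"
    using exists_good_codebook[OF M_ge_2 eps_nonneg average_le] unfolding t_def by blast
  define dec where "dec y = threshold_decoder t M (\<lambda>k. i (cb k) y)" for y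
  define p where "p j = measure (density Y (W (cb j))) {y \<in> space Y. dec y \<noteq> j}" for j
  have "ennreal (p j) \<le> missed t (cb j) + (\<Sum>k\<in>{1..<j}. confused t (cb k) (cb j))"
    if message_j: "j \<in> {1..M}" for j
  proof -
    interpret D: prob_space "density Y (W (cb j))" by (rule prob_space_output[OF codebook[OF message_j]])
    show ?thesis
      using threshold_decoder_error_le[of M cb j t, OF codebook message_j]
      by (simp add: p_def dec_def D.emeasure_eq_measure)
  qed
  then have "(\<Sum>j\<in>{1..M}. ennreal (p j)) \<le> ennreal (real M * \<epsilon>)"
    by (rule order_trans[OF sum_mono total_error_le])
  moreover have "(\<Sum>j\<in>{1..M}. ennreal (p j)) = ennreal (\<Sum>j\<in>{1..M}. p j)"
    by (rule sum_ennreal) (simp add: p_def)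
  ultimately have "(1 / real M) * (\<Sum>j\<in>{1..M}. p j) \<le> \<epsilon>"
    using M_ge_2 eps_nonneg by (simp add: ennreal_le_iff field_simps)
  moreover have "dec \<in> measurable Y (count_space UNIV)"
    unfolding dec_def using codebook by (intro measurable_threshold_decoder measurable_slices) auto
  moreover have "dec y \<in> {1..M}" for y
    unfolding dec_def using M_ge_2 by (intro threshold_decoder_range) simp
  ultimately show ?thesis using that codebook unfolding p_def by blast
qed

lemma prob_space_memoryless_output:
  assumes finite_K: "finite K" and inputs: "\<And>k. k \<in> K \<Longrightarrow> x k \<in> space X"
  shows "prob_space (density (PiM K (\<lambda>_. Y)) (\<lambda>y. \<Prod>k\<in>K. W (x k) (y k)))"
proof -
  define V where "V k = (if k \<in> K then W (x k) else (\<lambda>_. 1))" for k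
  have output_V: "V k \<in> borel_measurable Y" "prob_space (density Y (V k))" for k
    using measurable_slices(1)[OF inputs] prob_space_output[OF inputs] Y.prob_space_axioms
    by (auto simp: V_def density_1)
  have "density (PiM K (\<lambda>_. Y)) (\<lambda>y. \<Prod>k\<in>K. W (x k) (y k)) = density (PiM K (\<lambda>_. Y)) (\<lambda>y. \<Prod>k\<in>K. V k (y k))"
    by (simp add: V_def cong: prod.cong)
  also have "\<dots> = PiM K (\<lambda>k. density Y (V k))"
    by (rule density_PiM[OF finite_K Y.prob_space_axioms output_V])
  finally show ?thesis by (simp add: prob_space_PiM output_V)
qed

lemma average_memoryless_W:
  assumes finite_K: "finite K" and inputs: "\<And>k. k \<in> K \<Longrightarrow> x k \<in> space X"
    and outputs: "\<And>k. k \<in> K \<Longrightarrow> y k \<in> space Y"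
    and average_letter: "\<And>k. k \<in> K \<Longrightarrow> (\<integral>\<^sup>+x'. W x' (y k) \<partial>X)
        = W (x k) (y k) * ennreal (exp (- i (x k) (y k)))"
  shows "(\<integral>\<^sup>+x'. (\<Prod>k\<in>K. W (x' k) (y k)) \<partial>PiM K (\<lambda>_. X))
    = (\<Prod>k\<in>K. W (x k) (y k)) * ennreal (exp (- (\<Sum>k\<in>K. i (x k) (y k))))"
proof -
  interpret PX: product_sigma_finite "\<lambda>_. X"
    by (intro product_sigma_finite.intro X.sigma_finite_measure_axioms)
  have "(\<integral>\<^sup>+x'. (\<Prod>k\<in>K. W (x' k) (y k)) \<partial>PiM K (\<lambda>_. X)) = (\<Prod>k\<in>K. \<integral>\<^sup>+x'. W x' (y k) \<partial>X)"
  proof (rule PX.product_nn_integral_prod[OF finite_K])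
    fix k assume "k \<in> K"
    then have "y k \<in> space Y" by (rule outputs)
    then show "(\<lambda>x'. W x' (y k)) \<in> borel_measurable X" by measurable
  qed
  also have "\<dots> = (\<Prod>k\<in>K. W (x k) (y k) * ennreal (exp (- i (x k) (y k))))"
    by (intro prod.cong refl average_letter)
  finally show ?thesis
    by (simp add: prod.distrib prod_ennreal exp_sum[OF finite_K, symmetric] sum_negf)
qed

lemma memoryless_extension:
  assumes finite_K: "finite K"
  shows "info_density_channel (PiM K (\<lambda>_. X)) (PiM K (\<lambda>_. Y))
      (\<lambda>x y. \<Prod>k\<in>K. W (x k) (y k)) (\<lambda>x y. \<Sum>k\<in>K. i (x k) (y k))"
    (is "info_density_channel ?X ?Y ?W ?i")
proof (intro info_density_channel.intro info_density_channel_axioms.intro)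
  show "prob_space ?X" "prob_space ?Y"
    by (intro prob_space_PiM X.prob_space_axioms Y.prob_space_axioms)+
  have "(\<lambda>xy. (fst xy k, snd xy k)) \<in> measurable (?X \<Otimes>\<^sub>M ?Y) (X \<Otimes>\<^sub>M Y)" if "k \<in> K" for k
    using that by measurable
  from measurable_compose[OF this measurable_W] measurable_compose[OF this measurable_i]
  show "(\<lambda>(x, y). ?W x y) \<in> borel_measurable (?X \<Otimes>\<^sub>M ?Y)" "(\<lambda>(x, y). ?i x y) \<in> borel_measurable (?X \<Otimes>\<^sub>M ?Y)"
    unfolding case_prod_beta by (auto intro!: borel_measurable_prod_ennreal borel_measurable_sum)
  show "prob_space (density ?Y (?W x))" if "x \<in> space ?X" for x
    using that by (intro prob_space_memoryless_output finite_K) (auto simp: space_PiM)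
  have "AE y in ?Y. \<forall>k\<in>K. \<forall>x\<in>space X. (\<integral>\<^sup>+x'. W x' (y k) \<partial>X) = W x (y k) * ennreal (exp (- i x (y k)))"
    using finite_K by (intro AE_finite_allI AE_PiM_component[where M="\<lambda>_. Y"] Y.prob_space_axioms average_W)
  then show "AE y in ?Y. \<forall>x\<in>space ?X. (\<integral>\<^sup>+x'. ?W x' y \<partial>?X) = ?W x y * ennreal (exp (- ?i x y))"
    using AE_space by eventually_elim (intro ballI average_memoryless_W finite_K, auto simp: space_PiM)
qed

end

section \<open>The pilot-assisted random code\<close>

lemma measurable_CN_vec_component [measurable]:
  "f \<in> measurable M (CN_vec {..<n}) \<Longrightarrow> j < n \<Longrightarrow> (\<lambda>x. f x j) \<in> borel_measurable M"
  by (rule measurable_compose[of f M "CN_vec {..<n}"]) auto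

locale pilot_scheme =
  fixes l np m :: nat and \<rho> \<kappa> :: real
  assumes m_ge_1: "m \<ge> 1" and np_ge_1: "np \<ge> 1" and rho_pos: "\<rho> > 0" and kappa_nonneg: "\<kappa> \<ge> 0"
begin

abbreviation "fading_law \<equiv> CN (muH \<kappa>) (sigH2 \<kappa>)"

abbreviation "estimate_law \<equiv> CN (muH \<kappa>) (sigH2 \<kappa> + sig_e2 np \<rho>)"

abbreviation "channel_block \<equiv> fading_law \<Otimes>\<^sub>M CN_vec {..<np + m}"

abbreviation "stat_block \<equiv> estimate_law \<Otimes>\<^sub>M CN_vec {..<m}"

abbreviation "seed_law \<equiv> PiM {..<l} (\<lambda>_. CN_vec {..<m})"

abbreviation "stat_law \<equiv> PiM {..<l} (\<lambda>_. stat_block)"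

definition stat_lr :: "(nat \<Rightarrow> complex) \<Rightarrow> complex \<times> (nat \<Rightarrow> complex) \<Rightarrow> ennreal" where
  "stat_lr g b = ennreal (block_lr \<rho> (mu_p \<kappa> np \<rho> (fst b)) (sig_p2 \<kappa> np \<rho>) m (unit_dir m g) (snd b))"

definition stat_info :: "(nat \<Rightarrow> complex) \<Rightarrow> complex \<times> (nat \<Rightarrow> complex) \<Rightarrow> real" where
  "stat_info g b = block_info \<rho> (mu_p \<kappa> np \<rho> (fst b)) (sig_p2 \<kappa> np \<rho>) m (unit_dir m g) (snd b)"

definition stat_S :: "complex \<times> (nat \<Rightarrow> complex) \<Rightarrow> real" where
  "stat_S b = S_rv \<rho> (mu_p \<kappa> np \<rho> (fst b)) (sig_p2 \<kappa> np \<rho>) m (snd b)"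

definition block_output_stat ::
  "(nat \<Rightarrow> complex) \<Rightarrow> complex \<times> (nat \<Rightarrow> complex) \<Rightarrow> complex \<times> (nat \<Rightarrow> complex)" where
  "block_output_stat g c = block_stat np m \<rho> (\<lambda>i. fst c * block_word np m \<rho> (unit_dir m g) i + snd c i)"

lemma variances_pos: "sig_p2 \<kappa> np \<rho> > 0" "sigH2 \<kappa> > 0" "sigH2 \<kappa> + sig_e2 np \<rho> > 0"
  using sig_p2_pos[OF kappa_nonneg np_ge_1 rho_pos] sigH2_pos[OF kappa_nonneg]
    sig_e2_pos[OF np_ge_1 rho_pos] by auto

lemma prob_spaces:
  "prob_space fading_law" "prob_space estimate_law" "prob_space channel_block" "prob_space stat_block"
  by (intro prob_space_pair prob_space_CN prob_space_CN_vec variances_pos)+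

lemma measurable_stat_lr_info:
  "(\<lambda>(g, b). stat_lr g b) \<in> borel_measurable (CN_vec {..<m} \<Otimes>\<^sub>M stat_block)"
  "(\<lambda>(g, b). stat_info g b) \<in> borel_measurable (CN_vec {..<m} \<Otimes>\<^sub>M stat_block)"
proof -
  let ?P = "CN_vec {..<m} \<Otimes>\<^sub>M stat_block"
  have [measurable]: "(\<lambda>x. cdot m (unit_dir m (fst x)) (snd (snd x))) \<in> borel_measurable ?P"
    by (intro measurable_cdot_unit_dir measurable_CN_vec_component) measurable
  have [measurable]: "(\<lambda>x. mu_p \<kappa> np \<rho> (fst (snd x))) \<in> borel_measurable ?P"
    by measurable
  have [measurable]: "(\<lambda>x. f_out \<rho> (mu_p \<kappa> np \<rho> (fst (snd x))) (sig_p2 \<kappa> np \<rho>) m (snd (snd x)))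
      \<in> borel_measurable ?P"
    by (rule borel_measurable_f_out) measurable
  have [measurable]: "(\<lambda>x.
      block_lr \<rho> (mu_p \<kappa> np \<rho> (fst (snd x))) (sig_p2 \<kappa> np \<rho>) m (unit_dir m (fst x)) (snd (snd x)))
      \<in> borel_measurable ?P"
    unfolding block_lr_def by measurable
  show "(\<lambda>(g, b). stat_lr g b) \<in> borel_measurable ?P" "(\<lambda>(g, b). stat_info g b) \<in> borel_measurable ?P"
    unfolding stat_lr_def stat_info_def block_info_def noise_density_def case_prod_beta by measurable
qed

lemma measurable_stat_S [measurable]: "stat_S \<in> borel_measurable stat_block"
  unfolding stat_S_def by (rule borel_measurable_S_rv[OF m_ge_1]) auto

lemma measurable_block_output_stat [measurable]: "block_output_stat g \<in> measurable channel_block stat_block"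
proof -
  have "(\<lambda>c. snd c i) \<in> borel_measurable channel_block" if "i < np + m" for i
    using that by (intro measurable_CN_vec_component) auto
  then have "block_output_stat g \<in> measurable channel_block (borel \<Otimes>\<^sub>M CN_vec {..<m})"
    unfolding block_output_stat_def
    by (intro measurable_block_stat borel_measurable_add borel_measurable_times) auto
  then show ?thesis
    by (simp add: measurable_cong_sets[OF refl sets_pair_measure_cong[OF sets_CN refl]])
qed

lemma measurable_stat_slices [measurable]:
  "stat_lr g \<in> borel_measurable stat_block" "stat_info g \<in> borel_measurable stat_block"
proof -
  have [measurable]: "(\<lambda>b. f_out \<rho> (mu_p \<kappa> np \<rho> (fst b)) (sig_p2 \<kappa> np \<rho>) m (snd b))
      \<in> borel_measurable stat_block"
    by (rule borel_measurable_f_out) measurable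
  show "stat_lr g \<in> borel_measurable stat_block" "stat_info g \<in> borel_measurable stat_block"
    unfolding stat_lr_def[abs_def] stat_info_def[abs_def] block_info_def block_lr_def noise_density_def
    by measurable
qed

lemma distr_block_output_stat:
  "distr channel_block stat_block (block_output_stat g) = density stat_block (stat_lr g)"
proof (rule measure_eqI)
  interpret C: prob_space "CN_vec {..<np + m}" by (rule prob_space_CN_vec)
  interpret N: prob_space "CN_vec {..<m}" by (rule prob_space_CN_vec)
  fix A assume "A \<in> sets (distr channel_block stat_block (block_output_stat g))"
  then have sets_A [measurable]: "A \<in> sets stat_block" by simp
  then have [measurable]: "A \<in> sets (borel \<Otimes>\<^sub>M CN_vec {..<m})"
    by (simp add: sets_pair_measure_cong[OF sets_CN refl])
  have "emeasure (distr channel_block stat_block (block_output_stat g)) A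
      = (\<integral>\<^sup>+c. indicator A (block_output_stat g c) \<partial>channel_block)"
    by (subst nn_integral_indicator[symmetric], simp, subst nn_integral_distr) auto
  also have "\<dots> = (\<integral>\<^sup>+h. \<integral>\<^sup>+w. indicator A (block_output_stat g (h, w)) \<partial>CN_vec {..<np + m} \<partial>fading_law)"
    by (rule C.nn_integral_fst[symmetric]) measurable
  also have "\<dots> = (\<integral>\<^sup>+v. \<integral>\<^sup>+w. stat_lr g (v, w) * indicator A (v, w) \<partial>CN_vec {..<m} \<partial>estimate_law)"
    using nn_integral_block_stat[OF np_ge_1 rho_pos kappa_nonneg sqnorm_unit_dir[OF m_ge_1],
      of "\<lambda>v w. indicator A (v, w)" g]
    unfolding block_output_stat_def stat_lr_def by (simp add: case_prod_beta)
  also have "\<dots> = (\<integral>\<^sup>+b. stat_lr g b * indicator A b \<partial>stat_block)"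
    by (rule N.nn_integral_fst) measurable
  also have "\<dots> = emeasure (density stat_block (stat_lr g)) A"
    by (simp add: emeasure_density)
  finally show "emeasure (distr channel_block stat_block (block_output_stat g)) A
      = emeasure (density stat_block (stat_lr g)) A" .
qed simp

lemma prob_space_density_stat_lr: "prob_space (density stat_block (stat_lr g))"
  unfolding distr_block_output_stat[symmetric]
  by (intro prob_space.prob_space_distr prob_spaces) measurable

lemma distr_stat_info: "distr (density stat_block (stat_lr g)) borel (stat_info g)
    = distr stat_block borel stat_S"
proof (rule measure_eqI)
  interpret N: prob_space "CN_vec {..<m}" by (rule prob_space_CN_vec)
  fix A assume "A \<in> sets (distr (density stat_block (stat_lr g)) borel (stat_info g))"
  then have [measurable]: "A \<in> sets borel" by simp
  have "emeasure (distr (density stat_block (stat_lr g)) borel (stat_info g)) A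
      = (\<integral>\<^sup>+b. stat_lr g b * indicator A (stat_info g b) \<partial>stat_block)"
    by (subst nn_integral_indicator[symmetric], simp, subst nn_integral_distr)
      (auto simp: nn_integral_density)
  also have "\<dots>
      = (\<integral>\<^sup>+v. \<integral>\<^sup>+w. stat_lr g (v, w) * indicator A (stat_info g (v, w)) \<partial>CN_vec {..<m} \<partial>estimate_law)"
    by (rule N.nn_integral_fst[symmetric]) measurable
  also have "\<dots> = (\<integral>\<^sup>+v. \<integral>\<^sup>+w. indicator A (stat_S (v, w)) \<partial>CN_vec {..<m} \<partial>estimate_law)"
    using nn_integral_block_info[OF m_ge_1 rho_pos variances_pos(1) sqnorm_unit_dir[OF m_ge_1],
      of "indicator A"]
    by (simp add: stat_lr_def stat_info_def stat_S_def)
  also have "\<dots> = (\<integral>\<^sup>+b. indicator A (stat_S b) \<partial>stat_block)"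
    by (rule N.nn_integral_fst) measurable
  also have "\<dots> = emeasure (distr stat_block borel stat_S) A"
    by (subst nn_integral_indicator[symmetric], simp, subst nn_integral_distr) auto
  finally show "emeasure (distr (density stat_block (stat_lr g)) borel (stat_info g)) A
      = emeasure (distr stat_block borel stat_S) A" .
qed simp

lemma AE_stat_block: "AE b in stat_block. sqnorm m (snd b) \<noteq> 0"
proof -
  interpret pair_sigma_finite estimate_law "CN_vec {..<m}"
    by (intro pair_sigma_finite.intro prob_space_imp_sigma_finite prob_spaces prob_space_CN_vec)
  show ?thesis
  proof (rule AE_pair_measure)
    show "{b \<in> space stat_block. sqnorm m (snd b) \<noteq> 0} \<in> sets stat_block" by measurable
    show "AE v in estimate_law. AE w in CN_vec {..<m}. sqnorm m (snd (v, w)) \<noteq> 0"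
      using AE_sqnorm_neq_0[OF m_ge_1] by simp
  qed
qed

sublocale block: info_density_channel "CN_vec {..<m}" stat_block stat_lr stat_info
proof (intro info_density_channel.intro info_density_channel_axioms.intro)
  show "AE b in stat_block. \<forall>g\<in>space (CN_vec {..<m}). (\<integral>\<^sup>+g'. stat_lr g' b \<partial>CN_vec {..<m})
      = stat_lr g b * ennreal (exp (- stat_info g b))"
    using AE_stat_block
  proof eventually_elim
    case (elim b)
    note average = block_lr_average[OF m_ge_1 variances_pos(1) rho_pos elim, of "mu_p \<kappa> np \<rho> (fst b)"]
    show ?case
      unfolding stat_lr_def stat_info_def average(1)
      by (intro ballI block_lr_mult_exp_info[OF variances_pos(1) rho_pos] average(2))
  qed
qed (intro prob_space_CN_vec prob_spaces measurable_stat_lr_info prob_space_density_stat_lr)+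

definition total_lr :: "(nat \<Rightarrow> nat \<Rightarrow> complex) \<Rightarrow> (nat \<Rightarrow> complex \<times> (nat \<Rightarrow> complex)) \<Rightarrow> ennreal" where
  "total_lr G b = (\<Prod>k<l. stat_lr (G k) (b k))"

definition total_info :: "(nat \<Rightarrow> nat \<Rightarrow> complex) \<Rightarrow> (nat \<Rightarrow> complex \<times> (nat \<Rightarrow> complex)) \<Rightarrow> real" where
  "total_info G b = (\<Sum>k<l. stat_info (G k) (b k))"

sublocale word: info_density_channel seed_law stat_law total_lr total_info
  using block.memoryless_extension[of "{..<l}"]
  unfolding total_lr_def[abs_def] total_info_def[abs_def] by simp

definition codeword :: "(nat \<Rightarrow> nat \<Rightarrow> complex) \<Rightarrow> nat \<times> nat \<Rightarrow> complex" where
  "codeword G = (\<lambda>(k, i). block_word np m \<rho> (unit_dir m (G k)) i)"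

definition stats :: "(nat \<times> nat \<Rightarrow> complex) \<Rightarrow> nat \<Rightarrow> complex \<times> (nat \<Rightarrow> complex)" where
  "stats y = (\<lambda>k\<in>{..<l}. block_stat np m \<rho> (\<lambda>i. y (k, i)))"

definition output_stats ::
  "(nat \<Rightarrow> nat \<Rightarrow> complex) \<Rightarrow> (nat \<Rightarrow> complex) \<times> (nat \<times> nat \<Rightarrow> complex) \<Rightarrow> nat \<Rightarrow> complex \<times> (nat \<Rightarrow> complex)" where
  "output_stats G hw = stats (channel_out l (np + m) (codeword G) (fst hw) (snd hw))"

lemma sum_codeword_power:
  assumes "k < l"
  shows "(\<Sum>i<np + m. (cmod (codeword G (k, i)))\<^sup>2) = real (np + m) * \<rho>"
proof -
  have "(\<Sum>i<np + n. f i) = (\<Sum>i<np. f i) + (\<Sum>j<n. f (np + j))" for f :: "nat \<Rightarrow> real" and n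
    by (induction n) (auto simp: add.assoc)
  then have "(\<Sum>i<np + m. (cmod (codeword G (k, i)))\<^sup>2)
      = (\<Sum>i<np. (cmod (codeword G (k, i)))\<^sup>2) + (\<Sum>j<m. (cmod (codeword G (k, np + j)))\<^sup>2)" .
  also have "(\<Sum>i<np. (cmod (codeword G (k, i)))\<^sup>2) = real np * \<rho>"
    using rho_pos by (simp add: codeword_def block_word_def)
  also have "(\<Sum>j<m. (cmod (codeword G (k, np + j)))\<^sup>2) = real m * \<rho> * sqnorm m (unit_dir m (G k))"
    using rho_pos by (simp add: codeword_def block_word_def sqnorm_def norm_mult power_mult_distrib
      sum_distrib_left)
  finally show ?thesis by (simp add: sqnorm_unit_dir[OF m_ge_1] algebra_simps)
qed

lemma measurable_stats [measurable]: "stats \<in> measurable (PiM (idx l (np + m)) (\<lambda>_. borel)) stat_law"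
proof -
  have "(\<lambda>y. block_stat np m \<rho> (\<lambda>i. y (k, i)))
      \<in> measurable (PiM (idx l (np + m)) (\<lambda>_. borel)) (borel \<Otimes>\<^sub>M CN_vec {..<m})"
    if "k \<in> {..<l}" for k
    using that by (intro measurable_block_stat measurable_component_singleton) (auto simp: idx_def)
  then show ?thesis
    unfolding stats_def[abs_def]
    by (intro measurable_restrict)
      (simp add: measurable_cong_sets[OF refl sets_pair_measure_cong[OF sets_CN refl]])
qed

lemma channel_space_eq: "channel_space l (np + m) \<kappa>
    = PiM {..<l} (\<lambda>_. fading_law) \<Otimes>\<^sub>M PiM ({..<l} \<times> {..<np + m}) (\<lambda>_. CN_std)"
  by (simp add: channel_space_def idx_def)

lemma output_stats_eq_blocks:
  "output_stats G hw = (\<lambda>k\<in>{..<l}. block_output_stat (G k) (blocks {..<l} {..<np + m} hw k))"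
  by (auto simp: output_stats_def stats_def block_output_stat_def blocks_def codeword_def block_stat_def
      pilot_estimate_def channel_out_def idx_def case_prod_beta restrict_def fun_eq_iff
      intro!: arg_cong2[where f="(/)"] sum.cong)

lemma measurable_output_stats [measurable]: "output_stats G
    \<in> measurable (channel_space l (np + m) \<kappa>) stat_law"
  unfolding output_stats_eq_blocks[abs_def] channel_space_eq
  by (intro measurable_restrict measurable_compose[OF measurable_blocks]
    measurable_compose[OF measurable_component_singleton]
      measurable_block_output_stat)

lemma distr_output_stats: "distr (channel_space l (np + m) \<kappa>) stat_law (output_stats G)
    = density stat_law (total_lr G)"
proof -
  let ?C = "PiM {..<l} (\<lambda>_. channel_block)" and ?D = "\<lambda>x. \<lambda>k\<in>{..<l}. block_output_stat (G k) (x k)"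
  have "distr (channel_space l (np + m) \<kappa>) stat_law (output_stats G)
      = distr (distr (channel_space l (np + m) \<kappa>) ?C (blocks {..<l} {..<np + m})) stat_law ?D"
    unfolding channel_space_eq
    by (subst distr_distr) (measurable, simp add: output_stats_eq_blocks[abs_def] comp_def)
  also have "\<dots> = distr ?C stat_law ?D"
    unfolding channel_space_eq
    by (simp only: distr_PiM_blocks[OF finite_lessThan finite_lessThan prob_spaces(1)
      CN_std.prob_space_axioms])
  also have "\<dots> = PiM {..<l} (\<lambda>k. density stat_block (stat_lr (G k)))"
    using distr_PiM_components[of "{..<l}" "\<lambda>_. channel_block" "\<lambda>k. block_output_stat (G k)"
      "\<lambda>_. stat_block"]
    by (simp add: prob_spaces distr_block_output_stat)
  also have "\<dots> = density stat_law (total_lr G)"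
    unfolding total_lr_def[abs_def]
    by (rule density_PiM[symmetric]) (auto intro: prob_spaces prob_space_density_stat_lr)
  finally show ?thesis .
qed

lemma nn_integral_total_info:
  assumes "f \<in> borel_measurable borel"
  shows "(\<integral>\<^sup>+b. total_lr G b * f (total_info G b) \<partial>stat_law) = (\<integral>\<^sup>+b. f (\<Sum>k<l. stat_S (b k)) \<partial>stat_law)"
  unfolding total_lr_def total_info_def
  by (rule nn_integral_PiM_sum_law) (auto intro: prob_spaces distr_stat_info assms)

lemma eps_ub_eq:
  "ennreal (eps_ub l (np + m) np \<rho> \<kappa> M)
    = (\<integral>\<^sup>+b. ennreal (dt_weight ((real M - 1) / 2) (\<Sum>k<l. stat_S (b k))) \<partial>stat_law)"
proof -
  let ?A = "PiM {..<l} (\<lambda>_. estimate_law) \<Otimes>\<^sub>M PiM ({..<l} \<times> {..<m}) (\<lambda>_. CN_std)"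
  let ?f = "\<lambda>b. dt_weight ((real M - 1) / 2) (\<Sum>k<l. stat_S (b k))"
  have stat_S_blocks: "stat_S (blocks {..<l} {..<m} hw k)
      = S_rv \<rho> (mu_p \<kappa> np \<rho> (fst hw k)) (sig_p2 \<kappa> np \<rho>) m (\<lambda>i. snd hw (k, i))"
    if "k < l" for hw k
    using that m_ge_1 by (auto simp: stat_S_def blocks_def case_prod_beta intro!: S_rv_cong)
  have "eps_ub l (np + m) np \<rho> \<kappa> M = (\<integral>hw. ?f (blocks {..<l} {..<m} hw) \<partial>?A)"
    unfolding eps_ub_def ub_space_def idx_def by (simp add: stat_S_blocks)
  also have "\<dots> = (\<integral>b. ?f b \<partial>distr ?A stat_law (blocks {..<l} {..<m}))"
    by (rule integral_distr[symmetric]) measurable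
  also have "\<dots> = (\<integral>b. ?f b \<partial>stat_law)"
    by (simp only: distr_PiM_blocks[OF finite_lessThan finite_lessThan prob_spaces(2)
      CN_std.prob_space_axioms])
  finally have "ennreal (eps_ub l (np + m) np \<rho> \<kappa> M) = ennreal (\<integral>b. ?f b \<partial>stat_law)" by simp
  also have "\<dots> = (\<integral>\<^sup>+b. ennreal (?f b) \<partial>stat_law)"
    by (rule nn_integral_eq_integral[symmetric], rule word.Y.integrable_const_bound[where B=1]) auto
  finally show ?thesis .
qed

theorem exists_code:
  assumes M_ge_2: "M \<ge> 2" and eps_nonneg: "\<epsilon> \<ge> 0" and eps_ub_le: "eps_ub l (np + m) np \<rho> \<kappa> M \<le> \<epsilon>"
  shows "\<exists>c g. is_code l (np + m) M \<epsilon> \<rho> \<kappa> c g"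
proof -
  let ?C = "channel_space l (np + m) \<kappa>"
  have "(\<integral>\<^sup>+G. \<integral>\<^sup>+b. total_lr G b * ennreal (dt_weight ((real M - 1) / 2) (total_info G b)) \<partial>stat_law
      \<partial>seed_law)
      = ennreal (eps_ub l (np + m) np \<rho> \<kappa> M)"
    by (subst nn_integral_total_info[where f="\<lambda>v. ennreal (dt_weight ((real M - 1) / 2) v)"])
       (simp_all add: eps_ub_eq word.X.emeasure_space_1)
  with eps_ub_le have "(\<integral>\<^sup>+G. \<integral>\<^sup>+b. total_lr G b
      * ennreal (dt_weight ((real M - 1) / 2) (total_info G b)) \<partial>stat_law \<partial>seed_law) \<le> ennreal \<epsilon>"
    by (simp add: ennreal_leI)
  then obtain cb dec where decoder: "\<And>y. dec y \<in> {1..M}" "dec \<in> measurable stat_law (count_space UNIV)"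
      and error_le: "(1 / real M)
          * (\<Sum>j\<in>{1..M}. measure (density stat_law (total_lr (cb j))) {b \<in> space stat_law. dec b \<noteq> j}) \<le> \<epsilon>"
    by (rule word.dependence_testing_bound[OF M_ge_2 eps_nonneg]) (rule that)
  note [measurable] = decoder(2)
  have "measure (density stat_law (total_lr (cb j))) {b \<in> space stat_law. dec b \<noteq> j}
      = measure ?C {hw \<in> space ?C. dec (output_stats (cb j) hw) \<noteq> j}" for j
  proof -
    have "output_stats (cb j) -` {b \<in> space stat_law. dec b \<noteq> j} \<inter> space ?C
        = {hw \<in> space ?C. dec (output_stats (cb j) hw) \<noteq> j}"
      using measurable_space[OF measurable_output_stats] by auto
    then show ?thesis
      unfolding distr_output_stats[symmetric] by (subst measure_distr) (simp_all, measurable)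
  qed
  then have "is_code l (np + m) M \<epsilon> \<rho> \<kappa> (\<lambda>j. codeword (cb j)) (\<lambda>y. dec (stats y))"
    unfolding is_code_def
    using error_le M_ge_2 decoder(1) sum_codeword_power measurable_compose[OF measurable_stats decoder(2)]
    by (simp add: output_stats_def)
  then show ?thesis by blast
qed

end

theorem theorem3:
  fixes l nc np :: nat and \<epsilon> \<rho> \<kappa> :: real
  assumes "l \<ge> 1" and "nc \<ge> 2" and "0 < \<epsilon>" and "\<epsilon> < 1" and "\<rho> > 0" and "\<kappa> \<ge> 0"
    and "1 \<le> np" and "np \<le> nc - 1"
  shows "\<forall>M::nat. M \<ge> 2 \<and> eps_ub l nc np \<rho> \<kappa> M \<le> \<epsilon> \<longrightarrow>
           ereal (log 2 (real M) / (real nc * real l)) \<le> R_star l nc \<epsilon> \<rho> \<kappa>"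
proof (intro allI impI)
  fix M :: nat assume M_admissible: "M \<ge> 2 \<and> eps_ub l nc np \<rho> \<kappa> M \<le> \<epsilon>"
  have nc_split: "nc = np + (nc - np)" using assms by simp
  interpret pilot_scheme l np "nc - np" \<rho> \<kappa> using assms by unfold_locales auto
  have "\<exists>c g. is_code l nc M \<epsilon> \<rho> \<kappa> c g"
    using exists_code[of M \<epsilon>] M_admissible assms by (simp flip: nc_split)
  then show "ereal (log 2 (real M) / (real nc * real l)) \<le> R_star l nc \<epsilon> \<rho> \<kappa>"
    unfolding R_star_def by (intro Sup_upper) (auto simp: mult.commute)
qed

end
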